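(* Let $\mathcal{L}\subset\mathbb{R}^N$ be a repetitive Delone set of finite local complexity whose dynamical system $(\Omega_{\mathcal{L}},\mathbb{R}^N)$ has finite coincidence rank. Then $(\Omega_{\mathcal{L}},\mathbb{R}^N)$ is topologically conjugate to a Meyer dynamical system. Moreover, if $\mathcal{L}$ is non-periodic (i.e. $\mathcal{L}-t=\mathcal{L}$ only for $t=0$), then the topological eigenvalues of $(\Omega_{\mathcal{L}},\mathbb{R}^N)$ form a dense subgroup of $\widehat{\mathbb{R}}^N$.
   Context: A Delone set in $\mathbb{R}^N$ is a uniformly discrete and relatively dense subset. It has finite local complexity (FLC) if for each compact $K$ the set $\{(\mathcal{L}-x)\cap K:x\in\mathcal{L}\}$ is finite; sets $(\mathcal{L}-x)\cap K$ with $x\in\mathcal L$, $K$ compact are its patches. It is repetitive if for each nonempty patch the set of its occurrences in $\mathcal{L}$ is relatively dense. The hull $\Omega_{\mathcal{L}}$ of an FLC Delone set is the set of all Delone sets all of whose patches are patches of $\mathcal{L}$, with $\mathbb{R}^N$ acting by $(t,\mathcal{L}')\mapsto\mathcal{L}'-t$, and with the compact topology of the metric $d(\mathcal{L}_1,\mathcal{L}_2)=\inf\{\frac{\epsilon}{\epsilon+1}:\exists t,t'\in B_\epsilon(0),\ (\mathcal{L}_1-t)\cap B_{1/\epsilon}(0)=(\mathcal{L}_2-t')\cap B_{1/\epsilon}(0)\}$. For repetitive FLC $\mathcal{L}$ the system $(\Omega_{\mathcal{L}},\mathbb{R}^N)$ is minimal. A Meyer set is a Delone set $\mathcal{M}$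 with $\mathcal{M}-\mathcal{M}\subset\mathcal{M}+F$ for some finite $F$; a Meyer dynamical system is the system $(\Omega_{\mathcal{M}},\mathbb{R}^N)$ of a Meyer set $\mathcal{M}\subset\mathbb{R}^N$. Topologically conjugate means related by an $\mathbb{R}^N$-equivariant homeomorphism. A topological (continuous) eigenvalue is a $\chi\in\widehat{\mathbb{R}}^N$ (the dual group of $\mathbb{R}^N$) for which there is a continuous $f\neq0$ on $\Omega_{\mathcal{L}}$ with $f(\mathcal{L}'-t)=(\chi,t)f(\mathcal{L}')$ for all $t$ and $\mathcal{L}'$. The maximal equicontinuous factor of a minimal system $(X,G)$ is the unique (up to conjugacy) equicontinuous factor $(X_{max},G)$ of which every equicontinuous factor is a factor, with factor map $\pi_{max}$. Points $x,y$ are proximal if $\inf_t d(t\cdot x,t\cdot y)=0$. The coincidence rank is $\sup\{l:\exists x_1,\dots,x_l\in\pi_{max}^{-1}(\xi)\text{ pairwise non-proximal}\}\in\mathbb N\cup\{+\infty\}$, which is independent of $\xi\in X_{max}$. *)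

theory Defs
  imports "HOL-Analysis.Analysis" "HOL-Algebra.Group"
begin

section \<open>Delone sets, patches and hulls\<close>

definition relatively_dense :: "(real^'n) set \<Rightarrow> bool" where
  "relatively_dense L \<longleftrightarrow> (\<exists>R>0. \<forall>x. \<exists>y\<in>L. dist x y \<le> R)"

definition delone :: "(real^'n) set \<Rightarrow> bool" where
  "delone L \<longleftrightarrow> uniform_discrete L \<and> relatively_dense L"

definition shift :: "real^'n \<Rightarrow> (real^'n) set \<Rightarrow> (real^'n) set" where
  "shift t L = (\<lambda>x. x - t) ` L"

text \<open>
  A patch carries its window: two patches are compared only for the same compact \<open>K\<close>.
  If only the bare point sets were compared, every finite subset of \<open>L - x\<close> would be a patch
  (take it as its own window), and the hull of the integers would contain the even integers.
\<close>

definition patches :: "(real^'n) set \<Rightarrow> (real^'n) set \<Rightarrow> (real^'n) set set" where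
  "patches K L = {shift x L \<inter> K |x. x \<in> L}"

definition finite_local_complexity :: "(real^'n) set \<Rightarrow> bool" where
  "finite_local_complexity L \<longleftrightarrow> (\<forall>K. compact K \<longrightarrow> finite (patches K L))"

definition occurrences :: "(real^'n) set \<Rightarrow> (real^'n) set \<Rightarrow> (real^'n) set \<Rightarrow> (real^'n) set" where
  "occurrences K P L = {y \<in> L. shift y L \<inter> K = P}"

definition repetitive :: "(real^'n) set \<Rightarrow> bool" where
  "repetitive L \<longleftrightarrow>
     (\<forall>K. compact K \<longrightarrow> (\<forall>P \<in> patches K L. P \<noteq> {} \<longrightarrow> relatively_dense (occurrences K P L)))"

definition delone_hull :: "(real^'n) set \<Rightarrow> (real^'n) set set" where
  "delone_hull L = {L'. delone L' \<and> (\<forall>K. compact K \<longrightarrow> patches K L' \<subseteq> patches K L)}"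

definition delone_dist :: "(real^'n) set \<Rightarrow> (real^'n) set \<Rightarrow> real" where
  "delone_dist L1 L2 = Inf {\<epsilon> / (\<epsilon> + 1) |\<epsilon>. \<epsilon> > 0 \<and>
     (\<exists>t\<in>ball 0 \<epsilon>. \<exists>t'\<in>ball 0 \<epsilon>.
        shift t L1 \<inter> ball 0 (1/\<epsilon>) = shift t' L2 \<inter> ball 0 (1/\<epsilon>))}"

text \<open>
  The topology whose open sets are the \<open>delone_dist\<close>-open ones. It is spelled out, rather than
  obtained from the locale \<open>Metric_space\<close>, so that it does not presuppose the triangle inequality
  for \<open>delone_dist\<close>.
\<close>

definition hull_topology :: "(real^'n) set \<Rightarrow> (real^'n) set topology" where
  "hull_topology L = topology (\<lambda>U. U \<subseteq> delone_hull L \<and>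
     (\<forall>A\<in>U. \<exists>e>0. \<forall>B\<in>delone_hull L. delone_dist A B < e \<longrightarrow> B \<in> U))"

lemma openin_hull_topology:
  "openin (hull_topology L) U \<longleftrightarrow> U \<subseteq> delone_hull L \<and>
     (\<forall>A\<in>U. \<exists>e>0. \<forall>B\<in>delone_hull L. delone_dist A B < e \<longrightarrow> B \<in> U)"
proof -
  have "istopology (\<lambda>U. U \<subseteq> delone_hull L \<and>
     (\<forall>A\<in>U. \<exists>e>0. \<forall>B\<in>delone_hull L. delone_dist A B < e \<longrightarrow> B \<in> U))"
    unfolding istopology_def
  proof (intro conjI allI impI, goal_cases)
    case (1 S T)
    then show ?case by blast
  next
    case (2 S T)
    show ?case
    proof
      fix A assume A: "A \<in> S \<inter> T"
      obtain d where d: "d > 0" "\<forall>B\<in>delone_hull L. delone_dist A B < d \<longrightarrow> B \<in> S"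
        using 2 A by blast
      obtain e where e: "e > 0" "\<forall>B\<in>delone_hull L. delone_dist A B < e \<longrightarrow> B \<in> T"
        using 2 A by blast
      show "\<exists>e>0. \<forall>B\<in>delone_hull L. delone_dist A B < e \<longrightarrow> B \<in> S \<inter> T"
        using d e by (intro exI[of _ "min d e"]) auto
    qed
  next
    case (3 \<K>)
    then show ?case by blast
  next
    case (4 \<K>)
    then show ?case by (meson Union_iff)
  qed
  then show ?thesis
    unfolding hull_topology_def by (simp only: topology_inverse')
qed

lemma topspace_hull_topology: "topspace (hull_topology L) = delone_hull L"
proof
  show "topspace (hull_topology L) \<subseteq> delone_hull L"
    using openin_hull_topology openin_topspace by blast
  have "openin (hull_topology L) (delone_hull L)"
    unfolding openin_hull_topology using zero_less_one by blast
  then show "delone_hull L \<subseteq> topspace (hull_topology L)"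
    by (rule openin_subset)
qed

definition meyer :: "(real^'n) set \<Rightarrow> bool" where
  "meyer M \<longleftrightarrow> delone M \<and>
     (\<exists>F. finite F \<and> {x - y |x y. x \<in> M \<and> y \<in> M} \<subseteq> {z + f |z f. z \<in> M \<and> f \<in> F})"

section \<open>Dynamical systems\<close>

definition dynamical_system :: "'x topology \<Rightarrow> (real^'n \<Rightarrow> 'x \<Rightarrow> 'x) \<Rightarrow> bool" where
  "dynamical_system X \<alpha> \<longleftrightarrow> compact_space X \<and> metrizable_space X \<and>
     continuous_map (prod_topology euclidean X) X (\<lambda>(t, x). \<alpha> t x) \<and>
     (\<forall>x\<in>topspace X. \<alpha> 0 x = x) \<and>
     (\<forall>s t. \<forall>x\<in>topspace X. \<alpha> (s + t) x = \<alpha> s (\<alpha> t x))"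

definition topologically_conjugate ::
  "'x topology \<Rightarrow> (real^'n \<Rightarrow> 'x \<Rightarrow> 'x) \<Rightarrow> 'y topology \<Rightarrow> (real^'n \<Rightarrow> 'y \<Rightarrow> 'y) \<Rightarrow> bool" where
  "topologically_conjugate X \<alpha> Y \<beta> \<longleftrightarrow>
     (\<exists>h. homeomorphic_map X Y h \<and> (\<forall>t. \<forall>x\<in>topspace X. h (\<alpha> t x) = \<beta> t (h x)))"

definition factor_map ::
  "'x topology \<Rightarrow> (real^'n \<Rightarrow> 'x \<Rightarrow> 'x) \<Rightarrow> 'y topology \<Rightarrow> (real^'n \<Rightarrow> 'y \<Rightarrow> 'y) \<Rightarrow> ('x \<Rightarrow> 'y) \<Rightarrow> bool"
  where
  "factor_map X \<alpha> Y \<beta> \<pi> \<longleftrightarrow> dynamical_system Y \<beta> \<and> continuous_map X Y \<pi> \<and>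
     \<pi> ` topspace X = topspace Y \<and> (\<forall>t. \<forall>x\<in>topspace X. \<pi> (\<alpha> t x) = \<beta> t (\<pi> x))"

text \<open>On a compact space the choice of the compatible metric \<open>d\<close> does not matter.\<close>

definition equicontinuous :: "'x topology \<Rightarrow> (real^'n \<Rightarrow> 'x \<Rightarrow> 'x) \<Rightarrow> bool" where
  "equicontinuous X \<alpha> \<longleftrightarrow>
     (\<exists>d. Metric_space (topspace X) d \<and> Metric_space.mtopology (topspace X) d = X \<and>
        (\<forall>e>0. \<exists>\<delta>>0. \<forall>x\<in>topspace X. \<forall>y\<in>topspace X.
           d x y < \<delta> \<longrightarrow> (\<forall>t. d (\<alpha> t x) (\<alpha> t y) < e)))"

text \<open>
  The competing equicontinuous factors \<open>Z\<close> live on the type \<open>'x set\<close>. This is no restriction: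
  a Hausdorff factor of a compact space is homeomorphic to the quotient by the fibres of the
  factor map, whose points are subsets of \<open>topspace X\<close>.
\<close>

definition maximal_equicontinuous_factor ::
  "'x topology \<Rightarrow> (real^'n \<Rightarrow> 'x \<Rightarrow> 'x) \<Rightarrow> 'y topology \<Rightarrow> (real^'n \<Rightarrow> 'y \<Rightarrow> 'y) \<Rightarrow> ('x \<Rightarrow> 'y) \<Rightarrow> bool"
  where
  "maximal_equicontinuous_factor X \<alpha> Y \<beta> \<pi> \<longleftrightarrow> factor_map X \<alpha> Y \<beta> \<pi> \<and> equicontinuous Y \<beta> \<and>
     (\<forall>(Z :: 'x set topology) \<gamma> \<rho>. factor_map X \<alpha> Z \<gamma> \<rho> \<and> equicontinuous Z \<gamma> \<longrightarrow>
        (\<exists>\<phi>. factor_map Y \<beta> Z \<gamma> \<phi>))"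

definition proximal :: "('x \<Rightarrow> 'x \<Rightarrow> real) \<Rightarrow> (real^'n \<Rightarrow> 'x \<Rightarrow> 'x) \<Rightarrow> 'x \<Rightarrow> 'x \<Rightarrow> bool" where
  "proximal d \<alpha> x y \<longleftrightarrow> (INF t. d (\<alpha> t x) (\<alpha> t y)) = 0"

text \<open>
  Families of pairwise non-proximal points are given as finite sets; such points are automatically
  distinct, since every point is proximal to itself.
\<close>

definition coincidence_rank ::
  "'x topology \<Rightarrow> ('x \<Rightarrow> 'x \<Rightarrow> real) \<Rightarrow> (real^'n \<Rightarrow> 'x \<Rightarrow> 'x) \<Rightarrow> ('x \<Rightarrow> 'y) \<Rightarrow> 'y \<Rightarrow> enat" where
  "coincidence_rank X d \<alpha> \<pi> \<xi> =
     (SUP S \<in> {S. finite S \<and> S \<subseteq> {x \<in> topspace X. \<pi> x = \<xi>} \<and>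
                  pairwise (\<lambda>x y. \<not> proximal d \<alpha> x y) S}. enat (card S))"

section \<open>The dual group and topological eigenvalues\<close>

definition dual_group :: "(real^'n \<Rightarrow> complex) monoid" where
  "dual_group =
     \<lparr> carrier = {\<eta>. continuous_on UNIV \<eta> \<and> (\<forall>t. norm (\<eta> t) = 1) \<and> (\<forall>s t. \<eta> (s + t) = \<eta> s * \<eta> t)},
       mult = (\<lambda>\<eta> \<psi> t. \<eta> t * \<psi> t),
       one = (\<lambda>t. 1) \<rparr>"

text \<open>The compact-open topology, i.e. uniform convergence on compact sets.\<close>

definition dual_topology :: "(real^'n \<Rightarrow> complex) topology" where
  "dual_topology = topology (\<lambda>U. U \<subseteq> carrier dual_group \<and>
     (\<forall>\<eta>\<in>U. \<exists>K e. compact K \<and> e > 0 \<and>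
        (\<forall>\<psi>\<in>carrier dual_group. (\<forall>t\<in>K. dist (\<eta> t) (\<psi> t) < e) \<longrightarrow> \<psi> \<in> U)))"

lemma openin_dual_topology:
  fixes U :: "(real^'n \<Rightarrow> complex) set"
  shows "openin dual_topology U \<longleftrightarrow> U \<subseteq> carrier dual_group \<and>
     (\<forall>\<eta>\<in>U. \<exists>K e. compact K \<and> e > 0 \<and>
        (\<forall>\<psi>\<in>carrier dual_group. (\<forall>t\<in>K. dist (\<eta> t) (\<psi> t) < e) \<longrightarrow> \<psi> \<in> U))"
proof -
  have "istopology (\<lambda>U. U \<subseteq> carrier (dual_group :: (real^'n \<Rightarrow> complex) monoid) \<and>
     (\<forall>\<eta>\<in>U. \<exists>K e. compact K \<and> e > 0 \<and>
        (\<forall>\<psi>\<in>carrier dual_group. (\<forall>t\<in>K. dist (\<eta> t) (\<psi> t) < e) \<longrightarrow> \<psi> \<in> U)))"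
    unfolding istopology_def
  proof (intro conjI allI impI, goal_cases)
    case (1 S T)
    then show ?case by blast
  next
    case (2 S T)
    show ?case
    proof
      fix \<eta> assume \<eta>: "\<eta> \<in> S \<inter> T"
      obtain K d where d: "compact K" "d > 0"
        "\<forall>\<psi>\<in>carrier dual_group. (\<forall>t\<in>K. dist (\<eta> t) (\<psi> t) < d) \<longrightarrow> \<psi> \<in> S"
        using 2 \<eta> by blast
      obtain K' e where e: "compact K'" "e > 0"
        "\<forall>\<psi>\<in>carrier dual_group. (\<forall>t\<in>K'. dist (\<eta> t) (\<psi> t) < e) \<longrightarrow> \<psi> \<in> T"
        using 2 \<eta> by blast
      show "\<exists>K e. compact K \<and> e > 0 \<and>
          (\<forall>\<psi>\<in>carrier dual_group. (\<forall>t\<in>K. dist (\<eta> t) (\<psi> t) < e) \<longrightarrow> \<psi> \<in> S \<inter> T)"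
        using d e by (intro exI[of _ "K \<union> K'"] exI[of _ "min d e"]) (auto intro: compact_Un)
    qed
  next
    case (3 \<K>)
    then show ?case by blast
  next
    case (4 \<K>)
    then show ?case by (meson Union_iff)
  qed
  then show ?thesis
    unfolding dual_topology_def by (simp only: topology_inverse')
qed

lemma topspace_dual_topology: "topspace dual_topology = carrier dual_group"
proof
  show "topspace dual_topology \<subseteq> carrier dual_group"
    using openin_dual_topology openin_topspace by blast
  have "openin dual_topology (carrier dual_group)"
    unfolding openin_dual_topology using zero_less_one compact_empty by blast
  then show "carrier dual_group \<subseteq> topspace dual_topology"
    by (rule openin_subset)
qed

definition topological_eigenvalues ::
  "'x topology \<Rightarrow> (real^'n \<Rightarrow> 'x \<Rightarrow> 'x) \<Rightarrow> (real^'n \<Rightarrow> complex) set" where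
  "topological_eigenvalues X \<alpha> = {\<eta> \<in> carrier dual_group.
     \<exists>f :: 'x \<Rightarrow> complex. continuous_map X euclidean f \<and> (\<exists>x\<in>topspace X. f x \<noteq> 0) \<and>
       (\<forall>t. \<forall>x\<in>topspace X. f (\<alpha> t x) = \<eta> t * f x)}"

end

theory Submission
  imports Defs "HOL-Complex_Analysis.Great_Picard" "HOL-Library.Diagonal_Subsequence"
begin

text \<open>
  Twisted means of a function over finer and finer dyadic grids in larger and larger boxes have, by
  Ascoli's argument, limits which are eigenfunctions of the equicontinuous factor. A finite Fourier
  analysis shows that a suitable choice of twists keeps the limit away from \<open>0\<close>, so the eigenvalues
  detect every translation that acts nontrivially on the factor. If all eigenvalues are
  trivial at \<open>s\<close>, the translates of a point by multiples of \<open>s\<close> stay in one fibre of the factor map;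
  finite coincidence rank makes two of them proximal, and by finite local complexity and
  repetitivity some bounded multiple of \<open>s\<close> is a period. As periods are not arbitrarily small, there
  are \<open>n\<close> linearly independent eigenvalues; in the non-periodic case the eigenvalues have trivial
  annihilator and are dense.

  Independent eigenfunctions define an equivariant map from the hull to a torus. Moving
  each point by the small difference between the value of this map at the point and its value at
  a representative of the local pattern puts all points in finitely many translates of a lattice. The
  deformed set is a Meyer set, and the deformation is injective on the hull because differences of
  neighbouring points take finitely many values.
\<close>

section \<open>Finite Fourier analysis\<close>

text \<open>The factor is a compact abelian group in disguise, but neither its group law nor a Haar
  measure is constructed: means over integer vectors modulo \<open>q\<close>, with
  \<open>q = w * 4 ^ n\<close> at spacing \<open>1 / 2 ^ n\<close>, take their place. The obstacle
  is a lower bound that does not degenerate with \<open>n\<close>. One fixed twist may average to 0,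
  so the twist is chosen anew at each level, and only numbers of balls covering the factor enter the
  size of the chosen coefficient. The averaged function is a difference of a function and its
  translate by \<open>s\<close>, so that a nonzero limit separates the base point from its
  translate.

  The multiple of \<open>s\<close> that becomes a period must be bounded independently of
  \<open>s\<close>: only then does a direction missed by all frequencies produce periods that are
  too short.

  In the deformation one constant has to be small against the separation of points, the shortest
  lattice vectors and the gaps between differences of neighbours. The pattern radius is chosen after
  it, so large that the eigenfunctions nearly agree on sets with equal patterns.\<close>

lemma of_real_sum_norm_square:
  "complex_of_real (\<Sum>k\<in>A. (norm (c k))\<^sup>2) = (\<Sum>k\<in>A. c k * cnj (c k))"
  by (simp only: of_real_sum complex_norm_square)

text \<open>Expanding the squares leaves only the diagonal terms, by orthogonality of the columns of
  \<open>E\<close>. The normalisation by \<open>card Q\<close> makes the coefficients means, so the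
  right-hand side is a mean square too.\<close>

lemma finite_fourier_parseval:
  fixes E :: "'a \<Rightarrow> 'a \<Rightarrow> complex" and c :: "'a \<Rightarrow> complex"
  assumes Q: "finite Q" "Q \<noteq> {}"
    and orth: "\<And>k l. k \<in> Q \<Longrightarrow> l \<in> Q \<Longrightarrow>
      (\<Sum>j\<in>Q. E j k * cnj (E j l)) = (if k = l then of_nat (card Q) else 0)"
  shows "(\<Sum>j\<in>Q. (norm ((\<Sum>k\<in>Q. c k * cnj (E j k)) / card Q))\<^sup>2) = (\<Sum>k\<in>Q. (norm (c k))\<^sup>2) / card Q"
proof -
  define n where "n = card Q"
  have n: "n > 0" using Q by (simp add: n_def card_gt_0_iff)
  have "complex_of_real (\<Sum>j\<in>Q. (norm ((\<Sum>k\<in>Q. c k * cnj (E j k)) / n))\<^sup>2)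
      = (\<Sum>j\<in>Q. (\<Sum>k\<in>Q. c k * cnj (E j k)) * cnj (\<Sum>k\<in>Q. c k * cnj (E j k))) / n\<^sup>2"
  proof -
    have "complex_of_real (\<Sum>j\<in>Q. (norm ((\<Sum>k\<in>Q. c k * cnj (E j k)) / n))\<^sup>2)
        = complex_of_real (\<Sum>j\<in>Q. (norm (\<Sum>k\<in>Q. c k * cnj (E j k)))\<^sup>2) / n\<^sup>2"
      by (simp add: norm_divide power_divide sum_divide_distrib[symmetric])
    then show ?thesis by (simp only: of_real_sum_norm_square)
  qed
  also have "(\<Sum>j\<in>Q. (\<Sum>k\<in>Q. c k * cnj (E j k)) * cnj (\<Sum>k\<in>Q. c k * cnj (E j k)))
      = (\<Sum>j\<in>Q. \<Sum>k\<in>Q. \<Sum>l\<in>Q. (c k * cnj (c l)) * (E j l * cnj (E j k)))"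
    by (simp add: sum_product cnj_sum mult_ac)
  also have "\<dots> = (\<Sum>k\<in>Q. \<Sum>l\<in>Q. (c k * cnj (c l)) * (\<Sum>j\<in>Q. E j l * cnj (E j k)))"
    unfolding sum_distrib_left
    by (subst sum.swap, rule sum.cong[OF refl], subst sum.swap, rule refl)
  also have "\<dots> = (\<Sum>k\<in>Q. \<Sum>l\<in>Q. if k = l then (c k * cnj (c l)) * n else 0)"
    by (intro sum.cong refl) (simp add: orth n_def)
  also have "\<dots> = (\<Sum>k\<in>Q. (c k * cnj (c k)) * n)"
    using Q by (simp add: sum.delta')
  also have "\<dots> / n\<^sup>2 = (\<Sum>k\<in>Q. c k * cnj (c k)) / complex_of_real n"
    using n by (simp add: sum_distrib_right[symmetric] power2_eq_square)
  also have "\<dots> = complex_of_real ((\<Sum>k\<in>Q. (norm (c k))\<^sup>2) / n)"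
    by (simp only: of_real_divide of_real_sum_norm_square)
  finally have "complex_of_real (\<Sum>j\<in>Q. (norm ((\<Sum>k\<in>Q. c k * cnj (E j k)) / n))\<^sup>2) =
      complex_of_real ((\<Sum>k\<in>Q. (norm (c k))\<^sup>2) / n)" .
  then show ?thesis unfolding n_def of_real_eq_iff .
qed

text \<open>
  The fourth powers of the Fourier coefficients of \<open>a\<close> sum up to the mean square of the
  autocorrelation of \<open>a\<close>. Many almost periods keep the latter away from \<open>0\<close>, whereas the squares
  of the coefficients sum up to the mean square of \<open>a\<close>: some coefficient is large.
\<close>

lemma finite_fourier_large_coefficient:
  fixes E :: "'a \<Rightarrow> 'a \<Rightarrow> complex" and a :: "'a \<Rightarrow> complex" and ad :: "'a \<Rightarrow> 'a \<Rightarrow> 'a"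
    and \<theta> m C :: real
  assumes Q: "finite Q" "Q \<noteq> {}"
    and orth: "\<And>k l. k \<in> Q \<Longrightarrow> l \<in> Q \<Longrightarrow>
      (\<Sum>j\<in>Q. E j k * cnj (E j l)) = (if k = l then of_nat (card Q) else 0)"
    and bij: "\<And>k. k \<in> Q \<Longrightarrow> bij_betw (\<lambda>l. ad k l) Q Q"
    and add: "\<And>j k l. j \<in> Q \<Longrightarrow> k \<in> Q \<Longrightarrow> l \<in> Q \<Longrightarrow> E j (ad k l) = E j k * E j l"
    and unit: "\<And>j k. norm (E j k) = 1"
    and C: "\<And>k. k \<in> Q \<Longrightarrow> norm (a k) \<le> C" "C > 0"
    and P: "P \<subseteq> Q" "real (card P) \<ge> \<theta> * card Q" "\<theta> > 0"
    and m: "(\<Sum>k\<in>Q. (norm (a k))\<^sup>2) / card Q \<ge> m" "m > 0"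
    and ap: "\<And>l. l \<in> P \<Longrightarrow> (\<Sum>k\<in>Q. norm (a (ad k l) - a k)) / card Q \<le> m / (2 * C)"
  shows "\<exists>j\<in>Q. (norm ((\<Sum>k\<in>Q. a k * cnj (E j k)) / card Q))\<^sup>2 \<ge> \<theta> * m / 4"
proof (rule ccontr)
  assume contra: "\<not> ?thesis"
  define n where "n = card Q"
  have n: "n > 0" using Q by (simp add: n_def card_gt_0_iff)
  define A where "A j = (\<Sum>k\<in>Q. a k * cnj (E j k)) / n" for j
  define b where "b l = (\<Sum>k\<in>Q. a (ad k l) * cnj (a k)) / n" for l
  define B where "B j = (\<Sum>l\<in>Q. b l * cnj (E j l)) / n" for j
  define M where "M = (\<Sum>k\<in>Q. (norm (a k))\<^sup>2) / n"
  have Mm: "M \<ge> m" using m by (simp add: M_def n_def)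
  have unit': "E j k * cnj (E j k) = 1" for j k
    using unit[of j k] by (simp add: complex_norm_square[symmetric])
  \<comment> \<open>Wiener-Khinchin: the transform of the autocorrelation is the squared modulus of
    the transform. Additivity of \<open>E j\<close> and the bijection \<open>ad k\<close> allow the
    inner sum to be reindexed.\<close>
  have BA: "B j = A j * cnj (A j)" if j: "j \<in> Q" for j
  proof -
    have "B j * n\<^sup>2 = (\<Sum>l\<in>Q. \<Sum>k\<in>Q. a (ad k l) * cnj (a k) * cnj (E j l))"
    proof -
      have "B j = (\<Sum>l\<in>Q. (\<Sum>k\<in>Q. a (ad k l) * cnj (a k) * cnj (E j l)) / n) / n"
        by (simp add: B_def b_def sum_distrib_right)
      also have "\<dots> = (\<Sum>l\<in>Q. \<Sum>k\<in>Q. a (ad k l) * cnj (a k) * cnj (E j l)) / n\<^sup>2"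
        by (simp add: sum_divide_distrib[symmetric] power2_eq_square)
      finally show ?thesis using n by simp
    qed
    also have "\<dots> = (\<Sum>k\<in>Q. cnj (a k) * E j k * (\<Sum>l\<in>Q. a (ad k l) * cnj (E j (ad k l))))"
      unfolding sum_distrib_left
    proof (subst sum.swap, intro sum.cong refl)
      fix k l assume "k \<in> Q" "l \<in> Q"
      then have "cnj (E j (ad k l)) = cnj (E j k) * cnj (E j l)" using j add by simp
      then show "a (ad k l) * cnj (a k) * cnj (E j l) =
           cnj (a k) * E j k * (a (ad k l) * cnj (E j (ad k l)))"
        using unit'[of j k] by (simp add: mult_ac)
    qed
    also have "\<dots> = (\<Sum>k\<in>Q. cnj (a k) * E j k * (\<Sum>l\<in>Q. a l * cnj (E j l)))"
    proof (intro sum.cong refl)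
      fix k assume "k \<in> Q"
      have "(\<Sum>l\<in>Q. a (ad k l) * cnj (E j (ad k l))) = (\<Sum>l\<in>Q. a l * cnj (E j l))"
        using sum.reindex_bij_betw[OF bij[OF \<open>k \<in> Q\<close>], of "\<lambda>l. a l * cnj (E j l)"] .
      then show "cnj (a k) * E j k * (\<Sum>l\<in>Q. a (ad k l) * cnj (E j (ad k l))) = cnj (a k) * E j k * (\<Sum>l\<in>Q. a l * cnj (E j l))"
        by simp
    qed
    also have "\<dots> = (A j * cnj (A j)) * n\<^sup>2"
    proof -
      have "(\<Sum>k\<in>Q. cnj (a k) * E j k * (\<Sum>l\<in>Q. a l * cnj (E j l)))
          = cnj (\<Sum>k\<in>Q. a k * cnj (E j k)) * (\<Sum>l\<in>Q. a l * cnj (E j l))"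
        by (simp only: sum_distrib_right[symmetric] cnj_sum complex_cnj_mult complex_cnj_cnj)
      then show ?thesis using n by (simp add: A_def power2_eq_square mult_ac)
    qed
    finally show ?thesis using n by simp
  qed
  have nB: "norm (B j) = (norm (A j))\<^sup>2" if "j \<in> Q" for j
    using BA[OF that] by (simp add: norm_mult power2_eq_square)
  have small: "(norm (A j))\<^sup>2 < \<theta> * m / 4" if "j \<in> Q" for j
    using contra that by (auto simp: A_def n_def not_le)
  \<comment> \<open>\<open>M\<close> is the autocorrelation at shift 0, and an almost period changes
    it by at most \<open>C * (m / (2 * C)) = m / 2\<close>.\<close>
  have b0: "M / 2 \<le> norm (b l)" if l: "l \<in> P" for l
  proof -
    have eq: "b l - M = (\<Sum>k\<in>Q. (a (ad k l) - a k) * cnj (a k)) / n"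
    proof -
      have "complex_of_real M = (\<Sum>k\<in>Q. a k * cnj (a k)) / n"
        unfolding M_def of_real_divide of_real_sum_norm_square by simp
      then show ?thesis by (simp add: b_def sum_subtractf left_diff_distrib diff_divide_distrib)
    qed
    have "norm (b l - M) \<le> (\<Sum>k\<in>Q. norm ((a (ad k l) - a k) * cnj (a k))) / n"
      unfolding eq norm_divide norm_of_nat by (intro divide_right_mono norm_sum) auto
    also have "\<dots> \<le> (\<Sum>k\<in>Q. norm (a (ad k l) - a k) * C) / n"
      using C by (intro divide_right_mono sum_mono) (auto simp: norm_mult intro!: mult_left_mono)
    also have "\<dots> = C * ((\<Sum>k\<in>Q. norm (a (ad k l) - a k)) / n)"
      by (simp add: sum_distrib_right[symmetric])
    also have "\<dots> \<le> C * (m / (2 * C))"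
      using ap[OF l] C by (intro mult_left_mono) (auto simp: n_def)
    also have "\<dots> = m / 2" using C by simp
    finally have "norm (b l - M) \<le> m / 2" .
    moreover have "M \<le> norm (b l) + norm (b l - M)"
      using norm_triangle_ineq4[of "b l" "b l - M"] Mm m by simp
    ultimately show ?thesis using Mm by simp
  qed
  \<comment> \<open>Strict because not all coefficients vanish: their squares sum to
    \<open>M > 0\<close>.\<close>
  have strict: "(\<Sum>j\<in>Q. (norm (A j))\<^sup>2 * (norm (A j))\<^sup>2) < (\<Sum>j\<in>Q. (\<theta> * m / 4) * (norm (A j))\<^sup>2)"
  proof (rule ccontr)
    assume n1: "\<not> ?thesis"
    have "(norm (A j))\<^sup>2 = 0" if "j \<in> Q" for j
    proof (rule ccontr)
      assume nz: "(norm (A j))\<^sup>2 \<noteq> 0"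
      have "(\<Sum>j\<in>Q. (norm (A j))\<^sup>2 * (norm (A j))\<^sup>2) < (\<Sum>j\<in>Q. (\<theta> * m / 4) * (norm (A j))\<^sup>2)"
        using small that nz Q
        by (intro sum_strict_mono_ex1 ballI bexI[of _ j] mult_right_mono mult_strict_right_mono)
          (auto simp: less_imp_le)
      with n1 show False by simp
    qed
    moreover have "M = (\<Sum>j\<in>Q. (norm (A j))\<^sup>2)"
      using finite_fourier_parseval[OF Q orth, of a] by (simp add: A_def n_def M_def)
    ultimately have "M = 0" by simp
    then show False using Mm m by simp
  qed
  \<comment> \<open>The fourth moment of the \<open>A j\<close> is bounded below through the shifts
    in \<open>P\<close>, and above by the assumed small maximum times the second moment.\<close>
  have "\<theta> * (M / 2)\<^sup>2 \<le> real (card P) / n * (M / 2)\<^sup>2"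
    using P n by (intro mult_right_mono) (auto simp: n_def field_simps)
  also have "\<dots> = (\<Sum>l\<in>P. (M / 2)\<^sup>2) / n" by simp
  also have "\<dots> \<le> (\<Sum>l\<in>P. (norm (b l))\<^sup>2) / n"
    using b0 Mm m by (intro divide_right_mono sum_mono power_mono) auto
  also have "\<dots> \<le> (\<Sum>l\<in>Q. (norm (b l))\<^sup>2) / n"
    using P Q by (intro divide_right_mono sum_mono2) auto
  also have "\<dots> = (\<Sum>j\<in>Q. (norm (B j))\<^sup>2)"
    using finite_fourier_parseval[OF Q orth, of b] by (simp add: B_def n_def)
  also have "\<dots> = (\<Sum>j\<in>Q. (norm (A j))\<^sup>2 * (norm (A j))\<^sup>2)"
    by (intro sum.cong) (simp_all add: nB power2_eq_square)
  also have "\<dots> < (\<Sum>j\<in>Q. (\<theta> * m / 4) * (norm (A j))\<^sup>2)" by (rule strict)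
  also have "\<dots> = (\<theta> * m / 4) * (\<Sum>j\<in>Q. (norm (A j))\<^sup>2)"
    by (rule sum_distrib_left[symmetric])
  also have "\<dots> = (\<theta> * m / 4) * M"
    using finite_fourier_parseval[OF Q orth, of a] by (simp add: A_def n_def M_def)
  finally have "\<theta> * (M / 2)\<^sup>2 < (\<theta> * m / 4) * M" .
  moreover have "(\<theta> * m / 4) * M \<le> \<theta> * (M / 2)\<^sup>2"
    using Mm m P by (auto simp: power2_eq_square mult_ac intro!: mult_left_mono)
  ultimately show False by simp
qed

section \<open>Characters of the group of integer vectors modulo q\<close>

definition cyc_box :: "int \<Rightarrow> (int^'n) set" where
  "cyc_box q = {k. \<forall>i. 0 \<le> k $ i \<and> k $ i < q}"

text \<open>The group law is addition followed by this reduction. Elements stay genuine integer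
  vectors, so they also index grid points, and cyclic and true translation can be compared index by
  index.\<close>

definition cyc_mod :: "int \<Rightarrow> int^'n \<Rightarrow> int^'n" where
  "cyc_mod q k = (\<chi> i. k $ i mod q)"

definition cyc_char :: "int \<Rightarrow> int^'n \<Rightarrow> int^'n \<Rightarrow> complex" where
  "cyc_char q j k = cis (2 * pi * (\<Sum>i\<in>UNIV. j $ i * k $ i) / q)"

text \<open>The sides may differ: the wrap-around count below needs boxes that are thin in one
  coordinate and full in the others.\<close>

lemma vec_box_card:
  fixes T :: "'n::finite \<Rightarrow> int set"
  assumes "\<And>i. finite (T i)"
  shows "finite {k :: int^'n. \<forall>i. k $ i \<in> T i}" "card {k :: int^'n. \<forall>i. k $ i \<in> T i} = (\<Prod>i\<in>UNIV. card (T i))"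
proof -
  have eq: "{k :: int^'n. \<forall>i. k $ i \<in> T i} = vec_lambda ` (PiE UNIV T)"
  proof -
    have "k \<in> vec_lambda ` (PiE UNIV T)" if "\<forall>i. k $ i \<in> T i" for k :: "int^'n"
      using that by (intro image_eqI[of _ _ "vec_nth k"]) auto
    then show ?thesis by auto
  qed
  have inj: "inj_on (vec_lambda :: ('n \<Rightarrow> int) \<Rightarrow> int^'n) (PiE UNIV T)"
    by (auto simp: inj_on_def vec_lambda_inject)
  show "finite {k :: int^'n. \<forall>i. k $ i \<in> T i}"
    unfolding eq using assms by (intro finite_imageI finite_PiE) auto
  show "card {k :: int^'n. \<forall>i. k $ i \<in> T i} = (\<Prod>i\<in>UNIV. card (T i))"
    unfolding eq card_image[OF inj] by (simp add: card_PiE)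
qed

lemma cyc_box_alt: "cyc_box q = {k :: int^'n. \<forall>i. k $ i \<in> {0..<q}}"
  by (auto simp: cyc_box_def)

lemma finite_cyc_box [simp]: "finite (cyc_box q :: (int^'n) set)"
  unfolding cyc_box_alt by (rule vec_box_card) simp

lemma card_cyc_box: "card (cyc_box q :: (int^'n) set) = nat q ^ CARD('n)"
  unfolding cyc_box_alt by (subst vec_box_card) simp_all

lemma zero_in_cyc_box: "q > 0 \<Longrightarrow> (0 :: int^'n) \<in> cyc_box q"
  by (simp add: cyc_box_def)

lemma cyc_mod_in_box: "q > 0 \<Longrightarrow> cyc_mod q k \<in> cyc_box q"
  by (simp add: cyc_mod_def cyc_box_def)

lemma cyc_mod_ident: "k \<in> cyc_box q \<Longrightarrow> cyc_mod q k = k"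
  by (simp add: cyc_mod_def cyc_box_def vec_eq_iff)

lemma cyc_mod_add_bij:
  assumes "q > 0"
  shows "bij_betw (\<lambda>l. cyc_mod q (l + k)) (cyc_box q) (cyc_box q)"
proof (rule bij_betw_byWitness[where f' = "\<lambda>l. cyc_mod q (l - k)"])
  have "cyc_mod q (cyc_mod q (a + k) - k) = cyc_mod q a" "cyc_mod q (cyc_mod q (a - k) + k) = cyc_mod q a" for a
    by (simp_all add: cyc_mod_def vec_eq_iff mod_simps)
  then show "\<forall>a\<in>cyc_box q. cyc_mod q (cyc_mod q (a + k) - k) = a"
    and "\<forall>a'\<in>cyc_box q. cyc_mod q (cyc_mod q (a' - k) + k) = a'"
    by (simp_all add: cyc_mod_ident)
qed (use assms in \<open>auto simp: cyc_mod_in_box\<close>)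

lemma norm_cyc_char [simp]: "norm (cyc_char q j k) = 1"
  by (simp add: cyc_char_def)

lemma cyc_char_add: "cyc_char q j (k + l) = cyc_char q j k * cyc_char q j l"
  by (simp add: cyc_char_def cis_mult distrib_left sum.distrib add_divide_distrib)

lemma cyc_char_commute: "cyc_char q j k = cyc_char q k j"
  by (simp add: cyc_char_def mult.commute)

lemma cyc_char_minus: "cyc_char q j (- k) = cnj (cyc_char q j k)"
  by (simp add: cyc_char_def cis_cnj sum_negf)

lemma cyc_char_mod:
  assumes "q > 0"
  shows "cyc_char q j (cyc_mod q k) = cyc_char q j k"
proof -
  define d where "d = (\<chi> i. k $ i div q)"
  have k: "k = cyc_mod q k + (\<chi> i. q * d $ i)"
    by (simp add: vec_eq_iff d_def cyc_mod_def)
  have "cyc_char q j (\<chi> i. q * d $ i) = cis (2 * pi * of_int (\<Sum>i\<in>UNIV. j $ i * d $ i))"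
  proof -
    have "(\<Sum>i\<in>UNIV. j $ i * (q * d $ i)) = q * (\<Sum>i\<in>UNIV. j $ i * d $ i)"
      by (simp add: sum_distrib_left mult_ac)
    then have "cyc_char q j (\<chi> i. q * d $ i) = cis (2 * pi * real_of_int (q * (\<Sum>i\<in>UNIV. j $ i * d $ i)) / q)"
      by (simp add: cyc_char_def)
    then show ?thesis using assms by (simp add: mult.assoc del: of_int_sum)
  qed
  also have "\<dots> = 1" by (rule cis_multiple_2pi) (rule Ints_of_int)
  finally show ?thesis using cyc_char_add[of q j "cyc_mod q k" "\<chi> i. q * d $ i"] k by simp
qed

lemma cyc_char_orth:
  fixes k l :: "int^'n"
  assumes q: "q > 0" and "k \<in> cyc_box q" "l \<in> cyc_box q"
  shows "(\<Sum>j\<in>cyc_box q. cyc_char q j k * cnj (cyc_char q j l))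
      = (if k = l then of_nat (card (cyc_box q :: (int^'n) set)) else 0)"
proof (cases "k = l")
  case True
  have "cyc_char q j l * cnj (cyc_char q j l) = 1" for j
    by (simp add: complex_norm_square[symmetric])
  then show ?thesis using True by simp
next
  case False
  then obtain i where i: "k $ i \<noteq> l $ i" by (auto simp: vec_eq_iff)
  define S where "S = (\<Sum>j\<in>cyc_box q. cyc_char q (k - l) j)"
  \<comment> \<open>A unit step in a coordinate where \<open>k\<close> and \<open>l\<close> differ;
    translating by it multiplies the character sum by a value other than 1.\<close>
  define u :: "int^'n" where "u = axis i 1"
  have "S = (\<Sum>j\<in>cyc_box q. cyc_char q (k - l) (cyc_mod q (j + u)))"
    unfolding S_def
    by (rule sum.reindex_bij_betw[OF cyc_mod_add_bij[OF q], symmetric])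
  also have "\<dots> = S * cyc_char q (k - l) u"
    by (simp add: S_def cyc_char_mod[OF q] cyc_char_add sum_distrib_right)
  finally have "S = S * cyc_char q (k - l) u" .
  moreover have "cyc_char q (k - l) u \<noteq> 1"
  proof
    assume 1: "cyc_char q (k - l) u = 1"
    have "(\<Sum>n\<in>UNIV. (k - l) $ n * u $ n) = k $ i - l $ i"
      by (simp add: u_def axis_def if_distrib cong: if_cong)
    then have "cis (2 * pi * (k $ i - l $ i) / q) = 1" using 1 by (simp add: cyc_char_def)
    then have "cos (2 * pi * (k $ i - l $ i) / q) = 1" by (metis cis.simps(1) one_complex.simps(1))
    then obtain z :: int where "2 * pi * (k $ i - l $ i) / q = z * 2 * pi"
      by (auto simp: cos_one_2pi_int)
    then have "2 * pi * real_of_int (k $ i - l $ i) = 2 * pi * real_of_int (z * q)"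
      using q by (simp add: field_simps)
    then have "real_of_int (k $ i - l $ i) = real_of_int (z * q)" by simp
    then have "k $ i - l $ i = z * q" by (simp only: of_int_eq_iff)
    moreover have "\<bar>k $ i - l $ i\<bar> < q" using assms by (auto simp: cyc_box_def abs_less_iff) (smt (verit))+
    moreover have "\<bar>z\<bar> * q < 1 * q \<Longrightarrow> z = 0" using q mult_less_cancel_right_pos[of q "\<bar>z\<bar>" 1] by linarith
    ultimately show False using i q by (simp add: abs_mult)
  qed
  ultimately have "S = 0" by simp
  moreover have "cyc_char q j k * cnj (cyc_char q j l) = cyc_char q (k - l) j" for j
    by (simp add: cyc_char_commute[of q "k - l"] cyc_char_minus[symmetric] cyc_char_add[symmetric])
  ultimately show ?thesis using False by (simp add: S_def)
qed

text \<open>Translation by \<open>z\<close> leaves the box only from a layer of thickness at most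
  \<open>h\<close> at a face. There is one such layer per coordinate, and each holds at most the
  fraction \<open>h / q\<close> of the box.\<close>

lemma cyc_wrap_card:
  fixes z :: "int^'n"
  assumes q: "q > 0" and z: "\<And>i. \<bar>z $ i\<bar> \<le> h"
  shows "real (card {k \<in> cyc_box q. cyc_mod q (k + z) \<noteq> k + z})
      \<le> CARD('n) * (h / q) * card (cyc_box q :: (int^'n) set)"
proof -
  \<comment> \<open>\<open>T i\<close> describes the layer that leaves the box in direction
    \<open>i\<close>, the other coordinates being free.\<close>
  define T where "T i m = (if m = i then {0..<q} - {- (z $ i)..<q - z $ i} else {0..<q})" for i m :: 'n
  have sub: "{k \<in> cyc_box q. cyc_mod q (k + z) \<noteq> k + z} \<subseteq> (\<Union>i. {k :: int^'n. \<forall>m. k $ m \<in> T i m})"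
  proof
    fix k assume k: "k \<in> {k \<in> cyc_box q. cyc_mod q (k + z) \<noteq> k + z}"
    then have "k + z \<notin> cyc_box q" using cyc_mod_ident by blast
    then obtain i where "\<not> (0 \<le> k $ i + z $ i \<and> k $ i + z $ i < q)" by (auto simp: cyc_box_def)
    then have "k $ i \<notin> {- (z $ i)..<q - z $ i}" by auto
    then have "k \<in> {k. \<forall>m. k $ m \<in> T i m}" using k by (auto simp: T_def cyc_box_def)
    then show "k \<in> (\<Union>i. {k. \<forall>m. k $ m \<in> T i m})" by blast
  qed
  have fT: "finite (T i m)" for i m by (simp add: T_def)
  have ci: "card {k :: int^'n. \<forall>m. k $ m \<in> T i m} \<le> nat h * nat q ^ (CARD('n) - 1)" for i
  proof -
    have "T i i \<subseteq> (if z $ i \<ge> 0 then {q - z $ i..<q} else {0..<- (z $ i)})" by (auto simp: T_def)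
    then have "card (T i i) \<le> card (if z $ i \<ge> 0 then {q - z $ i..<q} else {0..<- (z $ i)})"
      by (intro card_mono) auto
    also have "\<dots> \<le> nat h" using z[of i] by auto
    finally have Ti: "card (T i i) \<le> nat h" .
    have "card {k :: int^'n. \<forall>m. k $ m \<in> T i m} = (\<Prod>m\<in>UNIV. card (T i m))"
      using fT by (rule vec_box_card)
    also have "\<dots> = card (T i i) * (\<Prod>m\<in>UNIV - {i}. card (T i m))"
      by (simp add: prod.remove)
    also have "(\<Prod>m\<in>UNIV - {i}. card (T i m)) = (\<Prod>m\<in>UNIV - {i}. nat q)"
      by (intro prod.cong) (auto simp: T_def)
    also have "\<dots> = nat q ^ (CARD('n) - 1)" by (simp add: card_Diff_singleton)
    finally show ?thesis using Ti by simp
  qed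
  have "card {k \<in> cyc_box q. cyc_mod q (k + z) \<noteq> k + z} \<le> card (\<Union>i. {k :: int^'n. \<forall>m. k $ m \<in> T i m})"
    using fT by (intro card_mono sub finite_UN_I vec_box_card) auto
  also have "\<dots> \<le> (\<Sum>i\<in>UNIV. card {k :: int^'n. \<forall>m. k $ m \<in> T i m})"
    by (intro card_UN_le) auto
  also have "\<dots> \<le> (\<Sum>i\<in>(UNIV::'n set). nat h * nat q ^ (CARD('n) - 1))"
    by (intro sum_mono ci)
  finally have "card {k \<in> cyc_box q. cyc_mod q (k + z) \<noteq> k + z} \<le> CARD('n) * (nat h * nat q ^ (CARD('n) - 1))"
    by simp
  then have "real (card {k \<in> cyc_box q. cyc_mod q (k + z) \<noteq> k + z})
      \<le> real (CARD('n) * (nat h * nat q ^ (CARD('n) - 1)))" by (simp only: of_nat_le_iff)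
  also have "\<dots> = CARD('n) * (h / q) * card (cyc_box q :: (int^'n) set)"
  proof -
    have "h \<ge> 0" using z[of undefined] by linarith
    moreover have "real (nat q) ^ CARD('n) = real (nat q) ^ (CARD('n) - 1) * real (nat q)"
      by (metis power_minus_mult zero_less_card_finite)
    ultimately show ?thesis using q by (simp add: card_cyc_box)
  qed
  finally show ?thesis .
qed

section \<open>Eigenfunctions of equicontinuous actions\<close>

text \<open>Powers of 1/2 make the grids nested: a time of one level belongs to all finer levels and
  can be followed along a sequence of levels.\<close>

definition dyadic_point :: "nat \<Rightarrow> int^'n \<Rightarrow> real^'n" where
  "dyadic_point n k = (\<chi> i. real_of_int (k $ i) / 2 ^ n)"

lemma dyadic_point_add: "dyadic_point n (k + l) = dyadic_point n k + dyadic_point n l"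
  by (simp add: dyadic_point_def vec_eq_iff add_divide_distrib)

lemma dyadic_point_diff: "dyadic_point n (k - l) = dyadic_point n k - dyadic_point n l"
  by (simp add: dyadic_point_def vec_eq_iff diff_divide_distrib)

lemma dyadic_point_refine: "m \<le> n \<Longrightarrow> dyadic_point m k = dyadic_point n (\<chi> i. 2 ^ (n - m) * k $ i)"
proof -
  assume "m \<le> n"
  then have "2 ^ n = 2 ^ (n - m) * (2::real) ^ m" by (simp add: power_add[symmetric])
  then show ?thesis by (simp add: dyadic_point_def vec_eq_iff)
qed

lemma dyadic_dense:
  fixes t :: "real^'n"
  assumes "e > 0"
  shows "\<exists>n k. norm (dyadic_point n k - t) < e"
proof -
  obtain n where n: "(1/2) ^ n < e / CARD('n)"
    using real_arch_pow_inv[of "e / CARD('n)" "1/2"] assms by auto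
  define k where "k = (\<chi> i. \<lfloor>2 ^ n * t $ i\<rfloor>)"
  have "\<bar>(dyadic_point n k - t) $ i\<bar> \<le> (1/2) ^ n" for i
  proof -
    have "(dyadic_point n k - t) $ i = (real_of_int \<lfloor>2 ^ n * t $ i\<rfloor> - 2 ^ n * t $ i) / 2 ^ n"
      by (simp add: dyadic_point_def k_def diff_divide_distrib)
    also have "\<bar>\<dots>\<bar> \<le> 1 / 2 ^ n"
    proof -
      have "\<bar>real_of_int \<lfloor>2 ^ n * t $ i\<rfloor> - 2 ^ n * t $ i\<bar> \<le> 1" by linarith
      then show ?thesis by (simp add: abs_divide divide_right_mono)
    qed
    finally show ?thesis by (simp add: power_one_over)
  qed
  then have "norm (dyadic_point n k - t) \<le> (\<Sum>i\<in>(UNIV::'n set). (1/2) ^ n)"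
    by (intro order_trans[OF norm_le_l1_cart[of "dyadic_point n k - t"] sum_mono]) blast
  also have "\<dots> = CARD('n) * (1/2) ^ n" by simp
  also have "\<dots> < e" using n by (simp only: pos_less_divide_eq of_nat_0_less_iff zero_less_card_finite mult.commute)
  finally show ?thesis by blast
qed

lemma closed_dyadic_all:
  fixes S :: "(real^'n) set"
  assumes "closed S" "\<And>n k. dyadic_point n k \<in> S"
  shows "t \<in> S"
proof -
  have "t \<in> closure S"
    unfolding closure_approachable dist_norm using dyadic_dense assms(2) by blast
  then show ?thesis using assms(1) by simp
qed

text \<open>Metric rather than topological, because the function to be averaged is the distance from
  \<open>y0\<close>. Continuity in time is asked for at time 0; the group law carries it to all
  times.\<close>

locale equicontinuous_orbit = Metric_space Y d
  for Y :: "'y set" and d +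
  fixes \<beta> :: "real^'n \<Rightarrow> 'y \<Rightarrow> 'y" and y0 :: 'y
  assumes y0: "y0 \<in> Y"
    and closed: "\<And>t y. y \<in> Y \<Longrightarrow> \<beta> t y \<in> Y"
    and act_zero: "\<And>y. y \<in> Y \<Longrightarrow> \<beta> 0 y = y"
    and act_add: "\<And>s t y. y \<in> Y \<Longrightarrow> \<beta> (s + t) y = \<beta> s (\<beta> t y)"
    and equi: "\<And>e. e > 0 \<Longrightarrow> \<exists>\<delta>>0. \<forall>x\<in>Y. \<forall>y\<in>Y. d x y < \<delta> \<longrightarrow> (\<forall>t. d (\<beta> t x) (\<beta> t y) < e)"
    and tot_bdd: "mtotally_bounded Y"
    and dense: "\<And>y e. y \<in> Y \<Longrightarrow> e > 0 \<Longrightarrow> \<exists>t. d y (\<beta> t y0) < e"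
    and cont: "\<And>y e. y \<in> Y \<Longrightarrow> e > 0 \<Longrightarrow> \<exists>\<delta>>0. \<forall>t. norm t < \<delta> \<longrightarrow> d y (\<beta> t y) < e"
begin

lemma act_commute: "y \<in> Y \<Longrightarrow> \<beta> s (\<beta> t y) = \<beta> t (\<beta> s y)"
  by (metis act_add add.commute)

lemma bounded_dist: "\<exists>C>0. \<forall>y\<in>Y. d y0 y \<le> C"
proof -
  have "mbounded Y" using tot_bdd by (rule mtotally_bounded_imp_mbounded)
  then obtain C where "\<forall>x\<in>Y. \<forall>y\<in>Y. d x y \<le> C" by (auto simp: mbounded_alt)
  then have "\<forall>y\<in>Y. d y0 y \<le> max C 1" using y0 by (auto simp: le_max_iff_disj)
  then show ?thesis by (intro exI[of _ "max C 1"]) simp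
qed

lemma dist_diff_le: "x \<in> Y \<Longrightarrow> y \<in> Y \<Longrightarrow> z \<in> Y \<Longrightarrow> \<bar>d z x - d z y\<bar> \<le> d x y"
  using triangle[of z x y] triangle[of z y x] by (simp add: commute abs_le_iff)

text \<open>Pigeonhole on a finite cover by balls of radius \<open>\<rho>/2\<close>.
  \<open>K\<close> is fixed before the finite family, so the proportion \<open>1 / K\<close> does
  not depend on the grid.\<close>

lemma large_close_class:
  assumes "\<rho> > 0"
  obtains K where "K > 0" "\<And>(G :: 'g set) f. finite G \<Longrightarrow> f ` G \<subseteq> Y \<Longrightarrow>
    \<exists>S\<subseteq>G. card G \<le> card S * K \<and> (\<forall>k\<in>S. \<forall>l\<in>S. d (f k) (f l) < \<rho>)"
proof -
  obtain K where K: "finite K" "K \<subseteq> Y" "Y \<subseteq> (\<Union>x\<in>K. mball x (\<rho>/2))"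
    using tot_bdd assms unfolding mtotally_bounded_def by (meson half_gt_zero)
  have Kne: "K \<noteq> {}" using K y0 by auto
  show ?thesis
  proof (rule that[of "card K"])
    show "card K > 0" using K Kne by (simp add: card_gt_0_iff)
    fix G :: "'g set" and f assume G: "finite G" "f ` G \<subseteq> Y"
    have "\<exists>k\<in>K. d k (f g) < \<rho>/2" if "g \<in> G" for g using K G that by (fastforce simp: in_mball)
    then obtain c where c: "\<And>g. g \<in> G \<Longrightarrow> c g \<in> K \<and> d (c g) (f g) < \<rho>/2" by metis
    obtain k where k: "k \<in> K" "card (c -` {k} \<inter> G) * card K \<ge> card G"
      using pigeonhole_card[of c G K] c K G Kne by auto
    have "d (f g) (f h) < \<rho>" if "g \<in> c -` {k} \<inter> G" "h \<in> c -` {k} \<inter> G" for g h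
    proof -
      have gh: "g \<in> G" "c g = k" "h \<in> G" "c h = k" using that by auto
      then have "d k (f g) < \<rho>/2" "d k (f h) < \<rho>/2" using c[of g] c[of h] by auto
      moreover have "d (f g) (f h) \<le> d k (f g) + d k (f h)"
        using triangle''[of "f g" k "f h"] triangle[of "f g" k "f h"] that G K k by (auto simp: commute)
      ultimately show ?thesis by linarith
    qed
    then show "\<exists>S\<subseteq>G. card G \<le> card S * card K \<and> (\<forall>k\<in>S. \<forall>l\<in>S. d (f k) (f l) < \<rho>)"
      using k by (intro exI[of _ "c -` {k} \<inter> G"]) auto
  qed
qed

text \<open>The Fourier coefficient at \<open>j\<close> of \<open>u\<close> along the orbit of
  \<open>y\<close>, over a box of side \<open>q\<close> in the grid of level \<open>n\<close>. The
  offset \<open>k'\<close> places time 0 inside the box, at an index from which many others look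
  like returns.\<close>

definition fourier_mean :: "int \<Rightarrow> nat \<Rightarrow> int^'n \<Rightarrow> int^'n \<Rightarrow> ('y \<Rightarrow> complex) \<Rightarrow> 'y \<Rightarrow> complex" where
  "fourier_mean q n k' j u y =
     (\<Sum>k\<in>cyc_box q. u (\<beta> (dyadic_point n (k - k')) y) * cnj (cyc_char q j k)) / card (cyc_box q :: (int^'n) set)"

text \<open>
  By total boundedness a fixed proportion of the grid returns \<open>y0\<close> to itself up to a small error,
  and a fixed proportion consists of almost periods, however fine the grid.
\<close>

lemma fourier_mean_lower_bound:
  assumes ne: "\<beta> s0 y0 \<noteq> y0"
  defines "\<psi> \<equiv> (\<lambda>y. complex_of_real (d y0 y - d y0 (\<beta> s0 y)))"
  shows "\<exists>w>0. \<exists>\<epsilon>>0. \<forall>n. \<exists>k' j. norm (fourier_mean (w * 4 ^ n) n k' j \<psi> y0) \<ge> \<epsilon>"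
proof -
  define c where "c = d y0 (\<beta> s0 y0)"
  have c: "c > 0" unfolding c_def using ne y0 closed by (metis mdist_pos_eq)
  obtain C where C: "C > 0" "\<And>y. y \<in> Y \<Longrightarrow> d y0 y \<le> C" using bounded_dist by blast
  have psi_le: "norm (\<psi> y) \<le> C" if "y \<in> Y" for y
    unfolding \<psi>_def norm_of_real using C(2)[OF that] C(2)[OF closed[OF that, of s0]] nonneg[of y0 y] nonneg[of y0 "\<beta> s0 y"]
    unfolding abs_le_iff by linarith
  have equi_psi: "\<exists>\<rho>>0. \<forall>x\<in>Y. \<forall>y\<in>Y. d x y < \<rho> \<longrightarrow> (\<forall>t. norm (\<psi> (\<beta> t x) - \<psi> (\<beta> t y)) < e)" if "e > 0" for e
  proof -
    obtain \<rho> where \<rho>: "\<rho> > 0" "\<And>x y t. x \<in> Y \<Longrightarrow> y \<in> Y \<Longrightarrow> d x y < \<rho> \<Longrightarrow> d (\<beta> t x) (\<beta> t y) < e/2"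
      using equi[of "e/2"] \<open>e > 0\<close> by auto
    have "norm (\<psi> (\<beta> t x) - \<psi> (\<beta> t y)) < e" if xy: "x \<in> Y" "y \<in> Y" "d x y < \<rho>" for x y t
    proof -
      have "\<bar>d y0 (\<beta> t x) - d y0 (\<beta> t y)\<bar> < e/2"
        using dist_diff_le[of "\<beta> t x" "\<beta> t y" y0] \<rho>(2)[OF xy, of t] xy closed y0 by fastforce
      moreover have "\<bar>d y0 (\<beta> s0 (\<beta> t x)) - d y0 (\<beta> s0 (\<beta> t y))\<bar> < e/2"
        using dist_diff_le[of "\<beta> s0 (\<beta> t x)" "\<beta> s0 (\<beta> t y)" y0] \<rho>(2)[OF xy, of "s0 + t"] xy closed y0
        by (fastforce simp: act_add)
      moreover have "norm (\<psi> (\<beta> t x) - \<psi> (\<beta> t y)) =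
         \<bar>(d y0 (\<beta> t x) - d y0 (\<beta> t y)) - (d y0 (\<beta> s0 (\<beta> t x)) - d y0 (\<beta> s0 (\<beta> t y)))\<bar>"
        unfolding \<psi>_def of_real_diff[symmetric] norm_of_real by (simp add: algebra_simps)
      ultimately show ?thesis by linarith
    qed
    then show ?thesis using \<rho>(1) by blast
  qed
  obtain \<rho>1 where \<rho>1: "\<rho>1 > 0" "\<And>x y t. x \<in> Y \<Longrightarrow> y \<in> Y \<Longrightarrow> d x y < \<rho>1 \<Longrightarrow> norm (\<psi> (\<beta> t x) - \<psi> (\<beta> t y)) < c/2"
    using equi_psi[of "c/2"] c by auto
  obtain K1 where K1: "K1 > 0" "\<And>(G :: (int^'n) set) f. finite G \<Longrightarrow> f ` G \<subseteq> Y \<Longrightarrow>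
    (\<exists>S\<subseteq>G. card G \<le> card S * K1 \<and> (\<forall>k\<in>S. \<forall>l\<in>S. d (f k) (f l) < \<rho>1))"
    by (rule large_close_class[OF \<rho>1(1), where 'g = "int^'n"]) blast
  \<comment> \<open>At least the fraction \<open>1 / K1\<close> of the indices will have modulus at
    least \<open>c / 2\<close>, which gives this mean square.\<close>
  define m where "m = c\<^sup>2 / (4 * K1)"
  have m: "m > 0" using c K1 by (simp add: m_def)
  \<comment> \<open>Half of the tolerance \<open>m / (2 * C)\<close> for almost periods; the other
    half pays for wrap-around.\<close>
  define e where "e = m / (4 * C)"
  have e: "e > 0" using m C by (simp add: e_def)
  obtain \<rho>2 where \<rho>2: "\<rho>2 > 0" "\<And>x y t. x \<in> Y \<Longrightarrow> y \<in> Y \<Longrightarrow> d x y < \<rho>2 \<Longrightarrow> norm (\<psi> (\<beta> t x) - \<psi> (\<beta> t y)) < e"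
    using equi_psi[OF e] by blast
  obtain K2 where K2: "K2 > 0" "\<And>(G :: (int^'n) set) f. finite G \<Longrightarrow> f ` G \<subseteq> Y \<Longrightarrow>
    (\<exists>S\<subseteq>G. card G \<le> card S * K2 \<and> (\<forall>k\<in>S. \<forall>l\<in>S. d (f k) (f l) < \<rho>2))"
    by (rule large_close_class[OF \<rho>2(1), where 'g = "int^'n"]) blast
  define N where "N = real CARD('n)"
  \<comment> \<open>Almost periods have coordinates up to \<open>4 ^ n\<close>. In a box
    \<open>w\<close> times as wide the wrap-around costs at most \<open>2 * C * N / w\<close>, and
    this choice keeps that within \<open>m / (4 * C)\<close>.\<close>
  define w where "w = \<lceil>8 * C\<^sup>2 * N / m\<rceil> + 1"
  have w: "w > 0" "real_of_int w \<ge> 8 * C\<^sup>2 * N / m"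
  proof -
    have "0 \<le> 8 * C\<^sup>2 * N / m" using m by (simp add: N_def)
    then have "0 \<le> \<lceil>8 * C\<^sup>2 * N / m\<rceil>" by simp
    then show "w > 0" unfolding w_def by linarith
    show "real_of_int w \<ge> 8 * C\<^sup>2 * N / m" unfolding w_def by linarith
  qed
  \<comment> \<open>The box of side \<open>4 ^ n\<close> is the fraction
    \<open>1 / w ^ CARD('n)\<close> of the large one, and at least \<open>1 / K2\<close> of it
    yields almost periods.\<close>
  define \<theta> where "\<theta> = 1 / (K2 * real_of_int w ^ CARD('n))"
  have \<theta>: "\<theta> > 0" using K2 w by (simp add: \<theta>_def)
  have "\<exists>k' j. norm (fourier_mean (w * 4 ^ n) n k' j \<psi> y0) \<ge> sqrt (\<theta> * m / 4)" for n
  proof -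
    define q where "q = w * 4 ^ n"
    have q: "q > 0" using w by (simp add: q_def)
    define Q where "Q = (cyc_box q :: (int^'n) set)"
    have Q: "finite Q" "Q \<noteq> {}" using zero_in_cyc_box[OF q, where 'n = 'n] by (auto simp: Q_def)
    have cQ: "card Q > 0" using Q by (simp add: card_gt_0_iff)
    define p :: "int^'n \<Rightarrow> real^'n" where "p = dyadic_point n"
    have in_Y: "\<beta> t y0 \<in> Y" for t using closed y0 by blast
    obtain S1 where S1: "S1 \<subseteq> Q" "card Q \<le> card S1 * K1"
      "\<And>k l. k \<in> S1 \<Longrightarrow> l \<in> S1 \<Longrightarrow> d (\<beta> (p k) y0) (\<beta> (p l) y0) < \<rho>1"
      using K1(2)[OF Q(1), of "\<lambda>k. \<beta> (p k) y0"] in_Y by blast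
    have "S1 \<noteq> {}" using S1(2) cQ by auto
    \<comment> \<open>Seen from one member of a class of mutually close orbit points, the other
      members are returns to \<open>y0\<close> as far as \<open>\<psi>\<close> can tell, by
      equicontinuity.\<close>
    then obtain k' where k': "k' \<in> S1" by blast
    define a where "a k = \<psi> (\<beta> (p (k - k')) y0)" for k
    have aC: "norm (a k) \<le> C" for k unfolding a_def by (rule psi_le) (rule in_Y)
    have "norm (a k) \<ge> c/2" if "k \<in> S1" for k
    proof -
      have "norm (\<psi> (\<beta> (- p k') (\<beta> (p k) y0)) - \<psi> (\<beta> (- p k') (\<beta> (p k') y0))) < c/2"
        by (rule \<rho>1(2)[OF in_Y in_Y S1(3)[OF that k']])
      moreover have "\<beta> (- p k') (\<beta> (p k) y0) = \<beta> (p (k - k')) y0" "\<beta> (- p k') (\<beta> (p k') y0) = y0"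
        using y0 by (simp_all add: act_add[symmetric] act_zero p_def dyadic_point_diff)
      moreover have "norm (\<psi> y0) = c" using y0 by (simp add: \<psi>_def c_def)
      moreover have "norm (\<psi> y0) \<le> norm (a k) + norm (a k - \<psi> y0)"
        using norm_triangle_ineq4[of "a k" "a k - \<psi> y0"] by simp
      ultimately show ?thesis by (simp add: a_def)
    qed
    then have "(\<Sum>k\<in>S1. (c/2)\<^sup>2) \<le> (\<Sum>k\<in>S1. (norm (a k))\<^sup>2)"
      using c by (intro sum_mono power_mono) auto
    also have "\<dots> \<le> (\<Sum>k\<in>Q. (norm (a k))\<^sup>2)" using S1 Q by (intro sum_mono2) auto
    finally have sum_ge: "card S1 * (c/2)\<^sup>2 \<le> (\<Sum>k\<in>Q. (norm (a k))\<^sup>2)" by simp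
    have mean_ge: "(\<Sum>k\<in>Q. (norm (a k))\<^sup>2) / card Q \<ge> m"
    proof -
      have "real (card Q) \<le> card S1 * K1" using S1(2) by (metis of_nat_le_iff of_nat_mult)
      then have "m * card Q \<le> m * (card S1 * K1)" using m by (intro mult_left_mono) auto
      also have "\<dots> = card S1 * (c/2)\<^sup>2" using K1 by (simp add: m_def power2_eq_square)
      finally show ?thesis using sum_ge cQ by (simp add: le_divide_eq)
    qed
    \<comment> \<open>Almost periods are sought in the small box only: translation by a difference
      of two of its members wraps around for few indices of \<open>Q\<close>.\<close>
    define G where "G = (cyc_box (4 ^ n) :: (int^'n) set)"
    have GQ: "G \<subseteq> Q"
    proof -
      have "4 ^ n \<le> q" unfolding q_def using w by simp
      then show ?thesis unfolding G_def Q_def cyc_box_def by (auto intro: less_le_trans)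
    qed
    obtain S2 where S2: "S2 \<subseteq> G" "card G \<le> card S2 * K2"
      "\<And>k l. k \<in> S2 \<Longrightarrow> l \<in> S2 \<Longrightarrow> d (\<beta> (p k) y0) (\<beta> (p l) y0) < \<rho>2"
    proof -
      have "finite G" by (simp add: G_def)
      from K2(2)[OF this, of "\<lambda>k. \<beta> (p k) y0"] show ?thesis using in_Y that by blast
    qed
    have cG: "card G = 4 ^ (n * CARD('n))"
      by (simp add: G_def card_cyc_box nat_power_eq power_mult)
    have "S2 \<noteq> {}" using S2(2) cG by auto
    then obtain l' where l': "l' \<in> S2" by blast
    define P where "P = (\<lambda>l. cyc_mod q (l - l')) ` S2"
    have inj: "inj_on (\<lambda>l. cyc_mod q (l - l')) S2"
      using cyc_mod_add_bij[OF q, of "- l'"] S2(1) GQ unfolding bij_betw_def Q_def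
      by (auto intro: inj_on_subset)
    have PQ: "P \<subseteq> Q" using cyc_mod_in_box[OF q] by (auto simp: P_def Q_def)
    have cP: "real (card P) \<ge> \<theta> * card Q"
    proof -
      have "real (card G) \<le> card S2 * K2" using S2(2) by (metis of_nat_le_iff of_nat_mult)
      moreover have "card P = card S2" unfolding P_def by (rule card_image[OF inj])
      moreover have "real (card Q) = real_of_int w ^ CARD('n) * card G"
      proof -
        have "nat q = nat w * 4 ^ n" unfolding q_def using w by (simp add: nat_mult_distrib nat_power_eq)
        then show ?thesis using w by (simp add: Q_def card_cyc_box cG power_mult power_mult_distrib)
      qed
      ultimately show ?thesis using K2 w by (simp add: \<theta>_def field_simps)
    qed
    have ap: "(\<Sum>k\<in>Q. norm (a (cyc_mod q (k + x)) - a k)) / card Q \<le> m / (2 * C)" if xP: "x \<in> P" for x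
    proof -
      obtain l where l: "l \<in> S2" "x = cyc_mod q (l - l')" using xP by (auto simp: P_def)
      define z where "z = l - l'"
      have kx: "cyc_mod q (k + x) = cyc_mod q (k + z)" for k
        unfolding l z_def by (simp add: cyc_mod_def vec_eq_iff mod_simps)
      have zb: "\<bar>z $ i\<bar> \<le> 4 ^ n" for i
      proof -
        have "l \<in> G" "l' \<in> G" using l l' S2 by auto
        then have "0 \<le> l $ i" "l $ i < 4 ^ n" "0 \<le> l' $ i" "l' $ i < 4 ^ n" by (auto simp: G_def cyc_box_def)
        then show ?thesis by (simp add: z_def)
      qed
      define W where "W = {k \<in> Q. cyc_mod q (k + z) \<noteq> k + z}"
      have W: "real (card W) \<le> N * (4 ^ n / q) * card Q"
        using cyc_wrap_card[OF q zb] by (simp add: W_def Q_def N_def)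
      have near: "norm (a (k + z) - a k) \<le> e" for k
      proof -
        \<comment> \<open>The common time that carries the orbit points of \<open>l\<close> and
          \<open>l'\<close> to those compared in \<open>a (k + z)\<close> and
          \<open>a k\<close>.\<close>
        define t where "t = p (k - k' - l')"
        have "a (k + z) = \<psi> (\<beta> t (\<beta> (p l) y0))" "a k = \<psi> (\<beta> t (\<beta> (p l') y0))"
          using y0 by (simp_all add: a_def t_def p_def z_def act_add[symmetric] dyadic_point_add[symmetric] algebra_simps)
        then show ?thesis using \<rho>2(2)[OF in_Y in_Y S2(3)[OF l(1) l'], of t] by simp
      qed
      have "(\<Sum>k\<in>Q. norm (a (cyc_mod q (k + x)) - a k)) \<le> (\<Sum>k\<in>Q. e + (if k \<in> W then 2 * C else 0))"
      proof (intro sum_mono)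
        fix k assume k: "k \<in> Q"
        show "norm (a (cyc_mod q (k + x)) - a k) \<le> e + (if k \<in> W then 2 * C else 0)"
        proof (cases "k \<in> W")
          case True
          have "norm (a (cyc_mod q (k + x)) - a k) \<le> C + C"
            by (intro order_trans[OF norm_triangle_ineq4] add_mono aC)
          then show ?thesis using True e by simp
        next
          case False
          then have "cyc_mod q (k + x) = k + z" using k by (simp add: kx W_def)
          then show ?thesis using near[of k] False by simp
        qed
      qed
      also have "\<dots> = card Q * e + 2 * C * card W"
      proof -
        have "Q \<inter> W = W" by (auto simp: W_def)
        then show ?thesis using Q by (simp add: sum.distrib sum.If_cases)
      qed
      also have "\<dots> \<le> card Q * e + 2 * C * (N * (4 ^ n / q) * card Q)"
        using W C by (intro add_left_mono mult_left_mono) auto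
      also have "\<dots> = card Q * (e + 2 * C * N / w)"
        using w by (simp add: q_def field_simps)
      also have "\<dots> \<le> card Q * (m / (2 * C))"
      proof (intro mult_left_mono)
        have "2 * C * N / w \<le> m / (4 * C)"
          using w m C by (simp add: field_simps power2_eq_square)
        then have "e + 2 * C * N / w \<le> m / (4 * C) + m / (4 * C)" unfolding e_def by simp
        also have "\<dots> = m / (2 * C)" using C by (simp add: field_simps)
        finally show "e + 2 * C * N / w \<le> m / (2 * C)" .
      qed simp
      finally show ?thesis using cQ by (simp add: divide_le_eq mult.commute)
    qed
    have "\<exists>j\<in>Q. (norm ((\<Sum>k\<in>Q. a k * cnj (cyc_char q j k)) / card Q))\<^sup>2 \<ge> \<theta> * m / 4"
    proof (rule finite_fourier_large_coefficient[where ad = "\<lambda>k l. cyc_mod q (k + l)" and P = P and C = C])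
      show "(\<Sum>j\<in>Q. cyc_char q j k * cnj (cyc_char q j l)) = (if k = l then of_nat (card Q) else 0)"
        if "k \<in> Q" "l \<in> Q" for k l
        using that unfolding Q_def by (rule cyc_char_orth[OF q])
      show "bij_betw (\<lambda>l. cyc_mod q (k + l)) Q Q" for k
        using cyc_mod_add_bij[OF q, of k] by (simp add: Q_def add.commute)
      show "cyc_char q j (cyc_mod q (k + l)) = cyc_char q j k * cyc_char q j l" for j k l
        by (simp add: cyc_char_mod[OF q] cyc_char_add)
    qed (use Q aC C PQ cP \<theta> mean_ge m ap in auto)
    then obtain j where "(norm (fourier_mean q n k' j \<psi> y0))\<^sup>2 \<ge> \<theta> * m / 4"
      by (auto simp: fourier_mean_def Q_def a_def p_def)
    then have "norm (fourier_mean q n k' j \<psi> y0) \<ge> sqrt (\<theta> * m / 4)"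
      by (intro real_le_lsqrt) auto
    then show ?thesis unfolding q_def by blast
  qed
  then show ?thesis using w(1) \<theta> m by (intro exI[of _ w] conjI exI[of _ "sqrt (\<theta> * m / 4)"] allI) auto
qed

lemma fourier_mean_bound:
  assumes "q > 0" "\<And>y. y \<in> Y \<Longrightarrow> norm (u y) \<le> C" "y \<in> Y"
  shows "norm (fourier_mean q n k' j u y) \<le> C"
proof -
  have c: "card (cyc_box q :: (int^'n) set) > 0" using assms(1) by (simp add: card_cyc_box)
  have "norm (\<Sum>k\<in>cyc_box q. u (\<beta> (dyadic_point n (k - k')) y) * cnj (cyc_char q j k)) \<le> (\<Sum>k\<in>(cyc_box q :: (int^'n) set). C)"
    using assms closed by (intro order_trans[OF norm_sum] sum_mono) (simp add: norm_mult)
  then show ?thesis using c by (simp add: fourier_mean_def norm_divide divide_le_eq mult.commute)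
qed

lemma fourier_mean_diff:
  "fourier_mean q n k' j (\<lambda>y. u y - v y) y = fourier_mean q n k' j u y - fourier_mean q n k' j v y"
  by (simp add: fourier_mean_def left_diff_distrib sum_subtractf diff_divide_distrib)

lemma fourier_mean_equi:
  assumes "q > 0" "\<And>t. norm (u (\<beta> t x) - u (\<beta> t y)) \<le> e"
  shows "norm (fourier_mean q n k' j u x - fourier_mean q n k' j u y) \<le> e"
proof -
  have c: "card (cyc_box q :: (int^'n) set) > 0" using assms(1) by (simp add: card_cyc_box)
  have eq: "fourier_mean q n k' j u x - fourier_mean q n k' j u y =
    (\<Sum>k\<in>cyc_box q. (u (\<beta> (dyadic_point n (k - k')) x) - u (\<beta> (dyadic_point n (k - k')) y)) * cnj (cyc_char q j k)) / card (cyc_box q :: (int^'n) set)"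
    by (simp add: fourier_mean_def left_diff_distrib sum_subtractf diff_divide_distrib)
  have "norm (\<Sum>k\<in>cyc_box q. (u (\<beta> (dyadic_point n (k - k')) x) - u (\<beta> (dyadic_point n (k - k')) y)) * cnj (cyc_char q j k)) \<le> (\<Sum>k\<in>(cyc_box q :: (int^'n) set). e)"
    using assms by (intro order_trans[OF norm_sum] sum_mono) (simp add: norm_mult)
  then show ?thesis using c unfolding eq by (simp add: norm_divide divide_le_eq mult.commute)
qed

text \<open>A cyclic translation would multiply the mean exactly by the character value. True and
  cyclic translation differ only at wrapped indices, each of which changes the sum by at most
  \<open>2 * C\<close>.\<close>

lemma fourier_mean_translate:
  assumes q: "q > 0" and u: "\<And>y. y \<in> Y \<Longrightarrow> norm (u y) \<le> C" and y: "y \<in> Y" and h: "\<And>i. \<bar>z $ i\<bar> \<le> h"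
  shows "norm (fourier_mean q n k' j u (\<beta> (dyadic_point n z) y) - cyc_char q j z * fourier_mean q n k' j u y)
     \<le> 2 * C * (CARD('n) * (h / q))"
proof -
  define Q where "Q = (cyc_box q :: (int^'n) set)"
  have c: "card Q > 0" using assms(1) by (simp add: Q_def card_cyc_box)
  have C: "C \<ge> 0" using u[OF y] norm_ge_zero order_trans by blast
  define v where "v k = u (\<beta> (dyadic_point n (k - k')) y)" for k
  have v: "norm (v k) \<le> C" for k using u closed y by (simp add: v_def)
  have 1: "fourier_mean q n k' j u (\<beta> (dyadic_point n z) y) = (\<Sum>k\<in>Q. v (k + z) * cnj (cyc_char q j k)) / card Q"
    using y by (simp add: fourier_mean_def Q_def v_def act_add[symmetric] dyadic_point_add[symmetric] algebra_simps)
  have "(\<Sum>k\<in>Q. v k * cnj (cyc_char q j k)) = (\<Sum>k\<in>Q. v (cyc_mod q (k + z)) * cnj (cyc_char q j (cyc_mod q (k + z))))"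
    unfolding Q_def by (rule sum.reindex_bij_betw[OF cyc_mod_add_bij[OF q], symmetric])
  also have "\<dots> = (\<Sum>k\<in>Q. v (cyc_mod q (k + z)) * cnj (cyc_char q j k)) * cnj (cyc_char q j z)"
    by (simp add: cyc_char_mod[OF q] cyc_char_add sum_distrib_left mult_ac)
  finally have "cyc_char q j z * (\<Sum>k\<in>Q. v k * cnj (cyc_char q j k)) =
     (\<Sum>k\<in>Q. v (cyc_mod q (k + z)) * cnj (cyc_char q j k)) * (cyc_char q j z * cnj (cyc_char q j z))"
    by (simp add: mult_ac)
  also have "cyc_char q j z * cnj (cyc_char q j z) = 1" by (simp add: complex_norm_square[symmetric])
  finally have 2: "cyc_char q j z * fourier_mean q n k' j u y = (\<Sum>k\<in>Q. v (cyc_mod q (k + z)) * cnj (cyc_char q j k)) / card Q"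
    by (simp add: fourier_mean_def Q_def v_def)
  define W where "W = {k \<in> Q. cyc_mod q (k + z) \<noteq> k + z}"
  have QW: "Q \<inter> W = W" by (auto simp: W_def)
  have "norm (\<Sum>k\<in>Q. (v (k + z) - v (cyc_mod q (k + z))) * cnj (cyc_char q j k)) \<le> (\<Sum>k\<in>Q. if k \<in> W then 2 * C else 0)"
  proof (intro order_trans[OF norm_sum] sum_mono)
    fix k assume k: "k \<in> Q"
    have "norm (v (k + z) - v (cyc_mod q (k + z))) \<le> C + C"
      by (intro order_trans[OF norm_triangle_ineq4] add_mono v)
    then show "norm ((v (k + z) - v (cyc_mod q (k + z))) * cnj (cyc_char q j k)) \<le> (if k \<in> W then 2 * C else 0)"
      using k by (auto simp: norm_mult W_def)
  qed
  also have "\<dots> = 2 * C * card W" using QW by (simp add: sum.If_cases Q_def)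
  also have "\<dots> \<le> 2 * C * (CARD('n) * (h / q) * card Q)"
    using cyc_wrap_card[OF q h] C by (intro mult_left_mono) (auto simp: W_def Q_def)
  finally have "norm (\<Sum>k\<in>Q. (v (k + z) - v (cyc_mod q (k + z))) * cnj (cyc_char q j k)) / card Q \<le> 2 * C * (CARD('n) * (h / q))"
    using c by (simp add: divide_le_eq mult_ac)
  moreover have "fourier_mean q n k' j u (\<beta> (dyadic_point n z) y) - cyc_char q j z * fourier_mean q n k' j u y =
    (\<Sum>k\<in>Q. (v (k + z) - v (cyc_mod q (k + z))) * cnj (cyc_char q j k)) / card Q"
    unfolding 1 2 by (simp add: left_diff_distrib sum_subtractf diff_divide_distrib)
  ultimately show ?thesis by (simp add: norm_divide)
qed

text \<open>The twists vary with the level, and nothing is known about convergence of the character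
  values themselves. Their products with the means do converge, and the eigenvalue is recovered as a
  quotient of values of \<open>F\<close>.\<close>

theorem eigenfunction_exists:
  assumes ne: "\<beta> s0 y0 \<noteq> y0"
  obtains F \<gamma> where "\<gamma> \<in> carrier dual_group" "\<And>t y. y \<in> Y \<Longrightarrow> F (\<beta> t y) = \<gamma> t * F y"
    "\<And>e. e > 0 \<Longrightarrow> \<exists>\<delta>>0. \<forall>x\<in>Y. \<forall>y\<in>Y. d x y < \<delta> \<longrightarrow> norm (F x - F y :: complex) < e"
    "F y0 \<noteq> 0" "\<gamma> s0 \<noteq> 1"
proof -
  define \<phi> where "\<phi> y = complex_of_real (d y0 y)" for y
  obtain C where C: "C > 0" "\<And>y. y \<in> Y \<Longrightarrow> norm (\<phi> y) \<le> C" using bounded_dist by (auto simp: \<phi>_def)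
  obtain w \<epsilon> where w: "w > 0" and \<epsilon>: "\<epsilon> > 0"
    and ex: "\<And>n. \<exists>k' j. norm (fourier_mean (w * 4 ^ n) n k' j (\<lambda>y. complex_of_real (d y0 y - d y0 (\<beta> s0 y))) y0) \<ge> \<epsilon>"
    using fourier_mean_lower_bound[OF ne] by blast
  have psi: "(\<lambda>y. complex_of_real (d y0 y - d y0 (\<beta> s0 y))) = (\<lambda>y. \<phi> y - \<phi> (\<beta> s0 y))"
    by (simp add: \<phi>_def)
  obtain k' j where kj: "\<And>n. norm (fourier_mean (w * 4 ^ n) n (k' n) (j n) (\<lambda>y. \<phi> y - \<phi> (\<beta> s0 y)) y0) \<ge> \<epsilon>"
    using ex unfolding psi by metis
  define q where "q n = w * 4 ^ n" for n :: nat
  have q: "q n > 0" for n using w by (simp add: q_def)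
  define A where "A n = fourier_mean (q n) n (k' n) (j n) \<phi>" for n
  have A_bound: "norm (A n y) \<le> C" if "y \<in> Y" for n y
    unfolding A_def by (rule fourier_mean_bound[OF q C(2) that])
  have A_equi: "\<exists>\<delta>>0. \<forall>x\<in>Y. \<forall>y\<in>Y. d x y < \<delta> \<longrightarrow> (\<forall>n. norm (A n x - A n y) \<le> e)" if e: "e > 0" for e
  proof -
    obtain \<delta> where \<delta>: "\<delta> > 0" "\<And>x y t. x \<in> Y \<Longrightarrow> y \<in> Y \<Longrightarrow> d x y < \<delta> \<Longrightarrow> d (\<beta> t x) (\<beta> t y) < e"
      using equi[OF e] by blast
    have "norm (A n x - A n y) \<le> e" if xy: "x \<in> Y" "y \<in> Y" "d x y < \<delta>" for x y n
      unfolding A_def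
    proof (rule fourier_mean_equi[OF q])
      fix t
      have "\<bar>d y0 (\<beta> t x) - d y0 (\<beta> t y)\<bar> < e"
        using dist_diff_le[of "\<beta> t x" "\<beta> t y" y0] \<delta>(2)[OF xy, of t] xy closed y0 by fastforce
      then show "norm (\<phi> (\<beta> t x) - \<phi> (\<beta> t y)) \<le> e"
        unfolding \<phi>_def of_real_diff[symmetric] norm_of_real by simp
    qed
    then show ?thesis using \<delta>(1) by blast
  qed
  obtain D0 :: "(real^'n) set" where D0: "countable D0" "\<And>X. open X \<Longrightarrow> X \<noteq> {} \<Longrightarrow> \<exists>d\<in>D0. d \<in> X"
    by (rule countable_dense_setE) blast
  \<comment> \<open>A countable dense set for the diagonal subsequence; equicontinuity, uniform in
    the level, spreads convergence from it to all of \<open>Y\<close>.\<close>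
  define D where "D = (\<lambda>t. \<beta> t y0) ` D0"
  have DY: "D \<subseteq> Y" using y0 closed by (auto simp: D_def)
  have D_dense: "\<exists>x\<in>D. d y x < e" if yY: "y \<in> Y" and e: "e > 0" for y e
  proof -
    obtain t where t: "d y (\<beta> t y0) < e/2" using dense[OF yY, of "e/2"] e by auto
    have tY: "\<beta> t y0 \<in> Y" using y0 closed by simp
    obtain \<delta> where \<delta>: "\<delta> > 0" "\<And>s. norm s < \<delta> \<Longrightarrow> d (\<beta> t y0) (\<beta> s (\<beta> t y0)) < e/2"
      using cont[OF tY, of "e/2"] e by auto
    obtain t' where t': "t' \<in> D0" "t' \<in> ball t \<delta>" using D0(2)[of "ball t \<delta>"] \<delta>(1) by auto
    have "d (\<beta> t y0) (\<beta> (t' - t) (\<beta> t y0)) < e/2" using t' by (intro \<delta>(2)) (simp add: dist_norm norm_minus_commute)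
    also have "\<beta> (t' - t) (\<beta> t y0) = \<beta> t' y0" using y0 by (simp add: act_add[symmetric])
    finally have "d y (\<beta> t' y0) < e"
      using t triangle[of y "\<beta> t y0" "\<beta> t' y0"] yY y0 closed by fastforce
    then show ?thesis using t'(1) by (auto simp: D_def)
  qed
  have "countable D" using D0(1) by (simp add: D_def)
  then obtain r where r: "strict_mono (r :: nat \<Rightarrow> nat)" "\<And>x. x \<in> D \<Longrightarrow> \<exists>l. (\<lambda>n. A (r n) x) \<longlonglongrightarrow> l"
    by (rule function_convergent_subsequence[where f = A and M = C]) (use A_bound DY in auto)
  have "Cauchy (\<lambda>n. A (r n) y)" if y: "y \<in> Y" for y
  proof (rule metric_CauchyI)
    fix e :: real assume e: "e > 0"
    obtain \<delta> where \<delta>: "\<delta> > 0" "\<And>x y n. x \<in> Y \<Longrightarrow> y \<in> Y \<Longrightarrow> d x y < \<delta> \<Longrightarrow> norm (A n x - A n y) \<le> e/4"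
      using A_equi[of "e/4"] e by auto
    obtain x where x: "x \<in> D" "d y x < \<delta>" using D_dense[OF y \<delta>(1)] by blast
    have "Cauchy (\<lambda>n. A (r n) x)" using r(2)[OF x(1)] by (auto intro: LIMSEQ_imp_Cauchy)
    then obtain M where M: "\<And>m n. m \<ge> M \<Longrightarrow> n \<ge> M \<Longrightarrow> dist (A (r m) x) (A (r n) x) < e/4"
      using e by (meson metric_CauchyD zero_less_divide_iff zero_less_numeral)
    have "dist (A (r m) y) (A (r n) y) < e" if mn: "m \<ge> M" "n \<ge> M" for m n
    proof -
      have "norm (A (r m) y - A (r m) x) \<le> e/4" "norm (A (r n) y - A (r n) x) \<le> e/4"
        using \<delta>(2)[OF y _ x(2)] x DY by auto
      moreover have "norm (A (r m) y - A (r n) y) \<le> norm (A (r m) y - A (r m) x) + norm (A (r m) x - A (r n) x) + norm (A (r n) y - A (r n) x)"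
        using norm_triangle_ineq[of "A (r m) y - A (r m) x" "A (r m) x - A (r n) x"]
          norm_triangle_ineq4[of "A (r m) y - A (r n) x" "A (r n) y - A (r n) x"] by simp
      ultimately show ?thesis using M[OF mn] e by (simp add: dist_norm)
    qed
    then show "\<exists>M. \<forall>m\<ge>M. \<forall>n\<ge>M. dist (A (r m) y) (A (r n) y) < e" by blast
  qed
  then have "convergent (\<lambda>n. A (r n) y)" if "y \<in> Y" for y using that by (simp add: Cauchy_convergent_iff)
  then obtain F where F: "\<And>y. y \<in> Y \<Longrightarrow> (\<lambda>n. A (r n) y) \<longlonglongrightarrow> F y" unfolding convergent_def by metis
  have F_uc: "\<exists>\<delta>>0. \<forall>x\<in>Y. \<forall>y\<in>Y. d x y < \<delta> \<longrightarrow> norm (F x - F y) < e" if e: "e > 0" for e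
  proof -
    obtain \<delta> where \<delta>: "\<delta> > 0" "\<And>x y n. x \<in> Y \<Longrightarrow> y \<in> Y \<Longrightarrow> d x y < \<delta> \<Longrightarrow> norm (A n x - A n y) \<le> e/2"
      using A_equi[of "e/2"] e by auto
    have "norm (F x - F y) \<le> e/2" if xy: "x \<in> Y" "y \<in> Y" "d x y < \<delta>" for x y
      by (rule LIMSEQ_le_const2[OF tendsto_norm[OF tendsto_diff[OF F[OF xy(1)] F[OF xy(2)]]]]) (use \<delta>(2)[OF xy] in auto)
    then show ?thesis using \<delta>(1) e by (intro exI[of _ \<delta>]) fastforce
  qed
  \<comment> \<open>As the action is commutative, the mean of
    \<open>\<phi> y - \<phi> (\<beta> s0 y)\<close> at \<open>y0\<close> is the difference of the
    means of \<open>\<phi>\<close> at \<open>y0\<close> and at its translate, so the lower bound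
    survives as a gap between two values of \<open>F\<close>.\<close>
  have F_gap: "norm (F y0 - F (\<beta> s0 y0)) \<ge> \<epsilon>"
  proof (rule LIMSEQ_le_const[OF tendsto_norm[OF tendsto_diff[OF F F]]])
    have "\<epsilon> \<le> norm (A n y0 - A n (\<beta> s0 y0))" for n
    proof -
      have "fourier_mean (q n) n (k' n) (j n) (\<lambda>y. \<phi> (\<beta> s0 y)) y0 = A n (\<beta> s0 y0)"
        unfolding fourier_mean_def A_def using act_commute[OF y0] by simp
      then show ?thesis using kj[of n] fourier_mean_diff[of "q n" n "k' n" "j n" \<phi> "\<lambda>y. \<phi> (\<beta> s0 y)" y0]
        by (simp add: q_def A_def)
    qed
    then show "\<exists>N. \<forall>n\<ge>N. \<epsilon> \<le> norm (A (r n) y0 - A (r n) (\<beta> s0 y0))" by blast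
  qed (use y0 closed in auto)
  have F_cont: "continuous_on UNIV (\<lambda>t. F (\<beta> t y))" if y: "y \<in> Y" for y
  proof (unfold continuous_on_iff, intro ballI allI impI)
    fix t and e :: real assume e: "e > 0"
    obtain \<delta> where \<delta>: "\<delta> > 0" "\<And>x y. x \<in> Y \<Longrightarrow> y \<in> Y \<Longrightarrow> d x y < \<delta> \<Longrightarrow> norm (F x - F y) < e"
      using F_uc[OF e] by blast
    have tY: "\<beta> t y \<in> Y" using y closed by simp
    obtain \<eta> where \<eta>: "\<eta> > 0" "\<And>s. norm s < \<eta> \<Longrightarrow> d (\<beta> t y) (\<beta> s (\<beta> t y)) < \<delta>"
      using cont[OF tY \<delta>(1)] by blast
    have "dist (F (\<beta> t' y)) (F (\<beta> t y)) < e" if "dist t' t < \<eta>" for t'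
    proof -
      have "d (\<beta> t y) (\<beta> (t' - t) (\<beta> t y)) < \<delta>" using \<eta>(2) that by (simp add: dist_norm)
      then have "d (\<beta> t y) (\<beta> t' y) < \<delta>" using y by (simp add: act_add[symmetric])
      then show ?thesis using \<delta>(2)[OF tY closed[OF y], of t'] by (simp add: dist_norm norm_minus_commute)
    qed
    then show "\<exists>\<eta>>0. \<forall>t'\<in>UNIV. dist t' t < \<eta> \<longrightarrow> dist (F (\<beta> t' y)) (F (\<beta> t y)) < e" using \<eta>(1) by blast
  qed
  \<comment> \<open>At level \<open>n\<close> a time of level \<open>m\<close> has its index
    multiplied by \<open>2 ^ (n - m)\<close>. Against a box side of order \<open>4 ^ n\<close> the
    wrap-around error is of order \<open>(1/2) ^ n\<close>.\<close>
  define c where "c m z n = cyc_char (q n) (j n) (\<chi> i. 2 ^ (n - m) * z $ i)" for m z n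
  have translate: "(\<lambda>n. A (r n) (\<beta> (dyadic_point m z) y) - c m z (r n) * A (r n) y) \<longlonglongrightarrow> 0" if y: "y \<in> Y" for m z y
  proof -
    define B where "B = 2 * C * (CARD('n) * ((\<Sum>i\<in>UNIV. \<bar>z $ i\<bar>) / w))"
    have "(\<lambda>n. B * (1/2) ^ n) \<longlonglongrightarrow> B * 0" by (intro tendsto_intros LIMSEQ_realpow_zero) auto
    then have lim: "(\<lambda>n. B * (1/2) ^ r n) \<longlonglongrightarrow> 0" using LIMSEQ_subseq_LIMSEQ[OF _ r(1)] by (fastforce simp: o_def)
    show ?thesis
    proof (rule Lim_null_comparison[OF _ lim], rule eventually_sequentiallyI[of m])
      fix n assume "n \<ge> m"
      then have mr: "m \<le> r n" using r(1) seq_suble le_trans by blast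
      define z' where "z' = (\<chi> i. 2 ^ (r n - m) * z $ i)"
      have "\<bar>z' $ i\<bar> \<le> 2 ^ r n * (\<Sum>i\<in>UNIV. \<bar>z $ i\<bar>)" for i
      proof -
        have "\<bar>z $ i\<bar> \<le> (\<Sum>i\<in>UNIV. \<bar>z $ i\<bar>)" by (rule member_le_sum) auto
        moreover have "(2::int) ^ (r n - m) \<le> 2 ^ r n" by (rule power_increasing) auto
        ultimately show ?thesis by (simp add: z'_def abs_mult mult_mono)
      qed
      from fourier_mean_translate[OF q C(2) y this, where n = "r n" and k' = "k' (r n)" and j = "j (r n)"]
      have "norm (A (r n) (\<beta> (dyadic_point (r n) z') y) - c m z (r n) * A (r n) y)
          \<le> 2 * C * (CARD('n) * ((2 ^ r n * (\<Sum>i\<in>UNIV. \<bar>z $ i\<bar>)) / q (r n)))"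
        by (simp add: A_def c_def z'_def)
      also have "\<dots> = B * (1/2) ^ r n"
      proof -
        have "(4::real) ^ r n = 2 ^ r n * 2 ^ r n" by (simp add: power_mult_distrib[symmetric])
        then show ?thesis using w by (simp add: B_def q_def field_simps)
      qed
      finally show "norm (A (r n) (\<beta> (dyadic_point m z) y) - c m z (r n) * A (r n) y) \<le> B * (1/2) ^ r n"
        using dyadic_point_refine[OF mr, of z] by (simp add: z'_def)
    qed
  qed
  have translate_F: "(\<lambda>n. c m z (r n) * A (r n) y) \<longlonglongrightarrow> F (\<beta> (dyadic_point m z) y)" if y: "y \<in> Y" for m z y
    using tendsto_diff[OF F[OF closed[OF y, of "dyadic_point m z"]] translate[OF y, of m z]] by simp
  have norm_c: "norm (c m z n) = 1" for m z n by (simp add: c_def)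
  have norm_F_dyadic: "norm (F (\<beta> (dyadic_point m z) y)) = norm (F y)" if y: "y \<in> Y" for m z y
    using tendsto_norm[OF translate_F[OF y, of m z]] tendsto_norm[OF F[OF y]]
    by (auto simp: norm_mult norm_c intro: LIMSEQ_unique)
  have closed_level: "closed {t. norm (F (\<beta> t y)) = a}" if "y \<in> Y" for y a
    by (intro closed_Collect_eq continuous_intros F_cont that)
  have norm_F: "norm (F (\<beta> t y)) = norm (F y)" if y: "y \<in> Y" for t y
    using closed_dyadic_all[OF closed_level[OF y, of "norm (F y)"]] norm_F_dyadic[OF y] by blast
  \<comment> \<open>The norm of \<open>F\<close> is constant along orbits, so a zero at
    \<open>y0\<close> would force one at the translate and close the gap.\<close>
  have F0: "F y0 \<noteq> 0"
  proof
    assume "F y0 = 0"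
    then have "F (\<beta> s0 y0) = 0" using norm_F[OF y0, of s0] by simp
    then show False using F_gap \<epsilon> \<open>F y0 = 0\<close> by simp
  qed
  define \<gamma> where "\<gamma> t = F (\<beta> t y0) / F y0" for t
  have eigen_dyadic: "F (\<beta> (dyadic_point m z) y) = \<gamma> (dyadic_point m z) * F y" if y: "y \<in> Y" for m z y
  proof -
    have "(\<lambda>n. c m z (r n) * A (r n) y0 / A (r n) y0 * A (r n) y) \<longlonglongrightarrow> \<gamma> (dyadic_point m z) * F y"
      unfolding \<gamma>_def by (intro tendsto_mult tendsto_divide translate_F F y y0 F0)
    moreover have "\<forall>\<^sub>F n in sequentially. A (r n) y0 \<noteq> 0"
      using tendsto_imp_eventually_ne[OF F[OF y0] F0] .
    then have "\<forall>\<^sub>F n in sequentially. c m z (r n) * A (r n) y0 / A (r n) y0 * A (r n) y = c m z (r n) * A (r n) y"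
      by eventually_elim simp
    ultimately have "(\<lambda>n. c m z (r n) * A (r n) y) \<longlonglongrightarrow> \<gamma> (dyadic_point m z) * F y"
      by (rule Lim_transform_eventually)
    then show ?thesis using translate_F[OF y] LIMSEQ_unique by blast
  qed
  have chi_cont: "continuous_on UNIV \<gamma>"
    unfolding \<gamma>_def using F0 by (intro continuous_on_divide F_cont y0 continuous_on_const) auto
  have eigen: "F (\<beta> t y) = \<gamma> t * F y" if y: "y \<in> Y" for t y
  proof -
    have "closed {t. F (\<beta> t y) = \<gamma> t * F y}"
      by (intro closed_Collect_eq continuous_intros F_cont y chi_cont)
    from closed_dyadic_all[OF this] show ?thesis using eigen_dyadic[OF y] by blast
  qed
  have "\<gamma> \<in> carrier dual_group"
  proof -
    have "norm (\<gamma> t) = 1" for t using norm_F[OF y0, of t] F0 by (simp add: \<gamma>_def norm_divide)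
    moreover have "\<gamma> (s + t) = \<gamma> s * \<gamma> t" for s t
      using eigen[OF closed[OF y0], of s t] y0 by (simp add: \<gamma>_def act_add)
    ultimately show ?thesis using chi_cont by (simp add: dual_group_def)
  qed
  moreover have "\<gamma> s0 \<noteq> 1"
    using F_gap \<epsilon> F0 by (auto simp: \<gamma>_def)
  ultimately show thesis using that eigen F_uc F0 by blast
qed

end

section \<open>Characters of \<open>\<real>\<^sup>n\<close>\<close>

lemma norm_cis_diff_le: "norm (cis x - cis y) \<le> \<bar>x - y\<bar>"
proof -
  have "cis x - cis y = cis y * (cis (x - y) - 1)"
    by (simp add: right_diff_distrib cis_mult)
  then have "norm (cis x - cis y) = norm (exp (\<i> * of_real (x - y)) - 1)"
    by (simp add: norm_mult cis_conv_exp)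
  also have "\<dots> = 2 * \<bar>sin ((x - y) / 2)\<bar>" by (rule dist_exp_i_1)
  also have "\<dots> \<le> \<bar>x - y\<bar>" using abs_sin_x_le_abs_x[of "(x - y) / 2"] by simp
  finally show ?thesis .
qed

lemma cis_inner_in_dual_group: "(\<lambda>t. cis (b \<bullet> t)) \<in> carrier (dual_group :: (real^'n \<Rightarrow> complex) monoid)"
  by (auto simp: dual_group_def inner_add_right cis_mult intro!: continuous_intros)

text \<open>Additivity alone gives homogeneity over the rationals, and the set of admissible scalars
  is closed.\<close>

lemma additive_continuous_imp_linear:
  fixes f :: "'a::real_normed_vector \<Rightarrow> 'b::real_normed_vector"
  assumes cont: "continuous_on UNIV f" and add: "\<And>x y. f (x + y) = f x + f y"
  shows "linear f"
proof (rule linearI[OF add])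
  fix r :: real and x
  have f0: "f 0 = 0" using add[of 0 0] by simp
  have fm: "f (- y) = - f y" for y using add[of y "- y"] f0 by (simp add: eq_neg_iff_add_eq_0 add.commute)
  have nat: "f (real n *\<^sub>R y) = real n *\<^sub>R f y" for n y
    by (induction n) (simp_all add: f0 scaleR_left_distrib add)
  have int: "f (real_of_int z *\<^sub>R y) = real_of_int z *\<^sub>R f y" for z y
  proof (cases z)
    case (nonneg n) then show ?thesis using nat[of n y] by simp
  next
    case (neg n) then show ?thesis using nat[of "Suc n" "- y"] by (simp add: fm del: of_nat_Suc)
  qed
  have "\<rat> \<subseteq> {r. f (r *\<^sub>R x) = r *\<^sub>R f x}"
  proof
    fix r :: real assume "r \<in> \<rat>"
    then obtain a b where b: "b > 0" "r = of_int a / of_int b" by (rule Rats_cases')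
    have "of_int b *\<^sub>R f (r *\<^sub>R x) = of_int a *\<^sub>R f x"
      using b int[of b "r *\<^sub>R x"] int[of a x] by simp
    then have "(1 / of_int b) *\<^sub>R (of_int b *\<^sub>R f (r *\<^sub>R x)) = (1 / of_int b) *\<^sub>R (of_int a *\<^sub>R f x)" by simp
    then show "r \<in> {r. f (r *\<^sub>R x) = r *\<^sub>R f x}" using b by simp
  qed
  moreover have "closed {r. f (r *\<^sub>R x) = r *\<^sub>R f x}"
    by (intro closed_Collect_eq continuous_intros continuous_on_compose2[OF cont]) auto
  ultimately have "closure \<rat> \<subseteq> {r. f (r *\<^sub>R x) = r *\<^sub>R f x}" by (rule closure_minimal)
  then show "f (r *\<^sub>R x) = r *\<^sub>R f x" unfolding Rats_closure_real by blast
qed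

text \<open>On a contractible space the character has a continuous logarithm \<open>g\<close>. The
  increments \<open>g (s + t) - g t\<close> are, as functions of \<open>t\<close>, continuous
  logarithms of the single number \<open>\<eta> s\<close>, hence constant; so \<open>g - g 0\<close>
  is additive.\<close>

lemma dual_group_character:
  fixes \<eta> :: "real^'n \<Rightarrow> complex"
  assumes "\<eta> \<in> carrier dual_group"
  obtains b where "\<eta> = (\<lambda>t. cis (b \<bullet> t))"
proof -
  have cont: "continuous_on UNIV \<eta>" and norm: "\<And>t. norm (\<eta> t) = 1" and add: "\<And>s t. \<eta> (s + t) = \<eta> s * \<eta> t"
    using assms by (auto simp: dual_group_def)
  have nz: "\<eta> t \<noteq> 0" for t using norm[of t] by auto
  have "contractible (UNIV :: (real^'n) set)" by (intro convex_imp_contractible convex_UNIV)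
  then obtain g where g: "continuous_on UNIV g" "\<And>x. \<eta> x = exp (g x)"
    using continuous_logarithm_on_contractible[OF cont] nz by auto
  have g_add: "g (s + t) - g t = g s - g 0" for s t
  proof -
    have "(\<lambda>t. g (s + t) - g t) constant_on UNIV"
    proof (rule continuous_discrete_range_constant)
      show "continuous_on UNIV (\<lambda>t. g (s + t) - g t)"
        by (intro continuous_intros g(1) continuous_on_compose2[OF g(1)]) auto
      fix x
      \<comment> \<open>Distinct logarithms of one number are at least \<open>2 * pi\<close>
        apart.\<close>
      have "2 * pi \<le> norm (g (s + y) - g y - (g (s + x) - g x))" if "g (s + y) - g y \<noteq> g (s + x) - g x" for y
      proof (rule ccontr)
        assume "\<not> ?thesis"
        then have "norm (g (s + y) - g y - (g (s + x) - g x)) < 2 * pi" by simp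
        moreover have "exp (g (s + y) - g y) = exp (g (s + x) - g x)"
          using nz by (simp add: exp_diff g(2)[symmetric] add)
        moreover have "\<bar>Im (g (s + y) - g y) - Im (g (s + x) - g x)\<bar> \<le> norm (g (s + y) - g y - (g (s + x) - g x))"
          using abs_Im_le_cmod[of "g (s + y) - g y - (g (s + x) - g x)"] by simp
        ultimately have "g (s + y) - g y = g (s + x) - g x" using exp_complex_eqI by force
        then show False using that by simp
      qed
      then show "\<exists>e>0. \<forall>y. y \<in> UNIV \<and> g (s + y) - g y \<noteq> g (s + x) - g x \<longrightarrow> e \<le> norm (g (s + y) - g y - (g (s + x) - g x))"
        by (intro exI[of _ "2 * pi"]) auto
    qed auto
    then obtain c where "\<And>t. g (s + t) - g t = c" by (auto simp: constant_on_def)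
    from this[of t] this[of 0] show ?thesis by simp
  qed
  define f where "f t = Im (g t - g 0)" for t
  have "linear f"
  proof (rule additive_continuous_imp_linear)
    show "continuous_on UNIV f" unfolding f_def by (intro continuous_intros g(1))
    show "f (x + y) = f x + f y" for x y using arg_cong[OF g_add[of x y], of Im] by (simp add: f_def)
  qed
  define b where "b = (\<chi> i. f (axis i 1))"
  have fb: "f t = b \<bullet> t" for t
  proof -
    have "f t = f (\<Sum>i\<in>UNIV. (t $ i) *\<^sub>R axis i 1)" using basis_expansion[of t] by (simp add: scalar_mult_eq_scaleR)
    also have "\<dots> = (\<Sum>i\<in>UNIV. (t $ i) *\<^sub>R f (axis i 1))"
      using \<open>linear f\<close> by (simp add: linear_sum linear_cmul)
    finally show ?thesis by (simp add: b_def inner_vec_def mult.commute)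
  qed
  have "\<eta> 0 = 1" using add[of 0 0] nz[of 0] by simp
  have "\<eta> t = cis (b \<bullet> t)" for t
  proof -
    have "exp (g t - g 0) = \<eta> t" using \<open>\<eta> 0 = 1\<close> by (simp add: exp_diff g(2)[symmetric])
    moreover have "norm (exp (g t - g 0)) = exp (Re (g t - g 0))" by (rule norm_exp_eq_Re)
    ultimately have "Re (g t - g 0) = 0" using norm[of t] by simp
    then have "g t - g 0 = \<i> * of_real (f t)" by (simp add: complex_eq_iff f_def)
    then show ?thesis using \<open>exp (g t - g 0) = \<eta> t\<close> by (simp add: fb cis_conv_exp)
  qed
  then show ?thesis using that by blast
qed

lemma group_dual_group: "group (dual_group :: (real^'n \<Rightarrow> complex) monoid)"
proof (rule groupI)
  fix x :: "real^'n \<Rightarrow> complex" assume x: "x \<in> carrier dual_group"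
  have "cnj (x t) * x t = 1" for t
    using x complex_norm_square[of "x t"] by (simp add: dual_group_def mult.commute)
  then show "\<exists>y\<in>carrier dual_group. y \<otimes>\<^bsub>dual_group\<^esub> x = \<one>\<^bsub>dual_group\<^esub>"
    using x by (intro bexI[of _ "\<lambda>t. cnj (x t)"]) (auto simp: dual_group_def intro!: continuous_intros)
qed (auto simp: dual_group_def norm_mult mult_ac intro!: continuous_intros)

lemma inv_dual_group:
  assumes x: "x \<in> carrier (dual_group :: (real^'n \<Rightarrow> complex) monoid)"
  shows "inv\<^bsub>dual_group\<^esub> x = (\<lambda>t. cnj (x t))"
proof -
  have "cnj (x t) * x t = 1" for t
    using x complex_norm_square[of "x t"] by (simp add: dual_group_def mult.commute)
  then show ?thesis
    using x by (intro group.inv_equality[OF group_dual_group]) (auto simp: dual_group_def intro!: continuous_intros)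
qed

text \<open>
  Let \<open>V\<close> be spanned by the arbitrarily small elements of \<open>H\<close>. Then \<open>H\<close> is dense in \<open>V\<close>,
  and its projection \<open>D\<close> to the orthogonal complement of \<open>V\<close> is discrete.
\<close>

lemma nondense_subgroup_annihilator:
  fixes H :: "'a::euclidean_space set"
  assumes H0: "0 \<in> H" and Hdiff: "\<And>x y. x \<in> H \<Longrightarrow> y \<in> H \<Longrightarrow> x - y \<in> H"
    and nd: "e0 > 0" "\<And>h. h \<in> H \<Longrightarrow> norm (b0 - h) \<ge> e0"
  shows "\<exists>t. t \<noteq> 0 \<and> (\<forall>h\<in>H. h \<bullet> t \<in> \<int>)"
proof -
  have Hneg: "- x \<in> H" if "x \<in> H" for x using Hdiff[OF H0 that] by simp
  have Hadd: "x + y \<in> H" if "x \<in> H" "y \<in> H" for x y using Hdiff[OF that(1) Hneg[OF that(2)]] by simp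
  \<comment> \<open>Stated for an arbitrary subgroup, since both \<open>H\<close> and its projection
    \<open>D\<close> will need it.\<close>
  have multiples: "of_int z *\<^sub>R x \<in> G"
    if G: "0 \<in> G" "\<And>x y. x \<in> G \<Longrightarrow> y \<in> G \<Longrightarrow> x - y \<in> G" and x: "x \<in> G" for G :: "'a set" and z x
  proof -
    have neg: "- y \<in> G" if "y \<in> G" for y using G(2)[OF G(1) that] by simp
    have nat: "of_nat n *\<^sub>R x \<in> G" for n
    proof (induction n)
      case (Suc n)
      then show ?case using G(2)[OF Suc neg[OF x]] by (simp add: scaleR_left_distrib add.commute)
    qed (use G in simp)
    show ?thesis
    proof (cases z)
      case (nonneg n) then show ?thesis using nat[of n] by simp
    next
      case (neg n) then show ?thesis using \<open>\<And>y. y \<in> G \<Longrightarrow> - y \<in> G\<close>[OF nat[of "Suc n"]] by (simp del: of_nat_Suc)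
    qed
  qed
  have combos: "(\<Sum>b\<in>B. of_int (z b) *\<^sub>R b) \<in> G"
    if G: "0 \<in> G" "\<And>x y. x \<in> G \<Longrightarrow> y \<in> G \<Longrightarrow> x - y \<in> G" and B: "finite B" "B \<subseteq> G" for G :: "'a set" and z B
    using B
  proof (induction B rule: finite_induct)
    case (insert b B)
    have "of_int (- z b) *\<^sub>R b \<in> G" using insert by (intro multiples[OF G]) auto
    then show ?case using G(2)[OF _ \<open>of_int (- z b) *\<^sub>R b \<in> G\<close>, of "\<Sum>b\<in>B. of_int (z b) *\<^sub>R b"] insert
      by (simp add: add.commute)
  qed (use G in simp)
  define V where "V e = span (H \<inter> ball 0 e)" for e
  \<comment> \<open>A radius of minimal dimension: shrinking it further no longer changes the span,
    so \<open>V \<epsilon>\<close> is spanned by arbitrarily short elements of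
    \<open>H\<close>.\<close>
  obtain \<epsilon> where \<epsilon>: "\<epsilon> > 0" "\<And>e. e > 0 \<Longrightarrow> dim (V \<epsilon>) \<le> dim (V e)"
    using ex_has_least_nat[of "\<lambda>e. e > (0::real)" 1 "\<lambda>e. dim (V e)"] by auto
  have Veq: "V e = V \<epsilon>" if "e > 0" "e \<le> \<epsilon>" for e
  proof (rule subspace_dim_equal)
    show "V e \<subseteq> V \<epsilon>" using that unfolding V_def by (intro span_mono) auto
  qed (use \<epsilon>(2) that in \<open>auto simp: V_def\<close>)
  have Vsub: "subspace (V \<epsilon>)" by (simp add: V_def)
  have dense: "\<exists>h\<in>H \<inter> V \<epsilon>. norm (v - h) < e" if v: "v \<in> V \<epsilon>" and e: "e > 0" for v e
  proof -
    \<comment> \<open>Rounding the coordinates of \<open>v\<close> in a basis of vectors shorter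
      than \<open>\<delta>\<close> costs at most \<open>DIM('a) * \<delta> < e\<close>.\<close>
    define \<delta> where "\<delta> = min \<epsilon> (e / (DIM('a) + 1))"
    have \<delta>: "\<delta> > 0" "\<delta> \<le> \<epsilon>" using \<epsilon> e by (auto simp: \<delta>_def)
    obtain B where B: "B \<subseteq> H \<inter> ball 0 \<delta>" "independent B" "H \<inter> ball 0 \<delta> \<subseteq> span B"
      by (meson maximal_independent_subset)
    have fB: "finite B" and cB: "card B \<le> DIM('a)" using independent_bound[OF B(2)] by auto
    have "span B = V \<epsilon>"
      using B \<delta> Veq[OF \<delta>] unfolding V_def by (metis span_eq span_superset subset_trans)
    then obtain c where c: "v = (\<Sum>b\<in>B. c b *\<^sub>R b)" using v span_finite[OF fB] by auto
    define h where "h = (\<Sum>b\<in>B. of_int \<lfloor>c b\<rfloor> *\<^sub>R b)"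
    have "h \<in> H" unfolding h_def by (rule combos[OF H0 Hdiff fB]) (use B in auto)
    moreover have "h \<in> V \<epsilon>"
      unfolding h_def \<open>span B = V \<epsilon>\<close>[symmetric] by (intro span_sum span_scale span_base)
    moreover have "norm (v - h) < e"
    proof -
      have "v - h = (\<Sum>b\<in>B. (c b - of_int \<lfloor>c b\<rfloor>) *\<^sub>R b)"
        by (simp add: c h_def scaleR_left_diff_distrib sum_subtractf)
      also have "norm \<dots> \<le> (\<Sum>b\<in>B. \<delta>)"
      proof (intro order_trans[OF norm_sum] sum_mono)
        fix b assume "b \<in> B"
        then have "norm b \<le> \<delta>" using B(1) by auto
        moreover have "\<bar>c b - of_int \<lfloor>c b\<rfloor>\<bar> \<le> 1" by linarith
        ultimately have "\<bar>c b - of_int \<lfloor>c b\<rfloor>\<bar> * norm b \<le> 1 * \<delta>" by (intro mult_mono) auto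
        then show "norm ((c b - of_int \<lfloor>c b\<rfloor>) *\<^sub>R b) \<le> \<delta>" by simp
      qed
      also have "\<dots> \<le> DIM('a) * \<delta>" using cB \<delta> by (simp add: mult_right_mono)
      also have "\<dots> \<le> DIM('a) * (e / (DIM('a) + 1))" by (intro mult_left_mono) (auto simp: \<delta>_def)
      also have "\<dots> < e" using e by (simp add: field_simps)
      finally show ?thesis .
    qed
    ultimately show ?thesis by blast
  qed
  have VU: "V \<epsilon> \<noteq> UNIV"
  proof
    assume "V \<epsilon> = UNIV"
    then obtain h where "h \<in> H" "norm (b0 - h) < e0" using dense[of b0 e0] nd(1) by auto
    then show False using nd(2) by fastforce
  qed
  define D where "D = {z. (\<forall>v\<in>V \<epsilon>. v \<bullet> z = 0) \<and> (\<exists>y\<in>V \<epsilon>. y + z \<in> H)}"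
  have D0: "0 \<in> D" using H0 subspace_0[OF Vsub] by (auto simp: D_def)
  have Ddiff: "x - y \<in> D" if xy: "x \<in> D" "y \<in> D" for x y
  proof -
    obtain a b where ab: "a \<in> V \<epsilon>" "a + x \<in> H" "b \<in> V \<epsilon>" "b + y \<in> H" using xy by (auto simp: D_def)
    then have "(a - b) + (x - y) \<in> H" "a - b \<in> V \<epsilon>"
      using Hdiff[OF ab(2) ab(4)] subspace_diff[OF Vsub] by (auto simp: algebra_simps)
    then show ?thesis using xy by (auto simp: D_def inner_diff_right)
  qed
  \<comment> \<open>Density of \<open>H\<close> in \<open>V \<epsilon>\<close> replaces the lift of
    a short \<open>z\<close> by one shorter than \<open>\<epsilon>\<close>, which lies in
    \<open>V \<epsilon>\<close> by construction. Then \<open>z\<close> lies in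
    \<open>V \<epsilon>\<close> and is orthogonal to it.\<close>
  have Ddisc: "z = 0" if z: "z \<in> D" "norm z < \<epsilon> / 2" for z
  proof -
    obtain y where y: "y \<in> V \<epsilon>" "y + z \<in> H" using z by (auto simp: D_def)
    obtain k where k: "k \<in> H" "k \<in> V \<epsilon>" "norm (y - k) < \<epsilon> / 2" using dense[OF y(1), of "\<epsilon> / 2"] \<epsilon>(1) by auto
    have "norm ((y - k) + z) < \<epsilon>" using k z norm_triangle_ineq[of "y - k" z] by simp
    moreover have "(y + z) - k \<in> H" using Hdiff[OF y(2) k(1)] .
    moreover have "(y + z) - k = (y - k) + z" by simp
    ultimately have "(y - k) + z \<in> V \<epsilon>" unfolding V_def by (intro span_base) simp
    then have "z \<in> V \<epsilon>" using subspace_diff[OF Vsub _ subspace_diff[OF Vsub y(1) k(2)]] by fastforce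
    then show ?thesis using z by (auto simp: D_def)
  qed
  have Dorth: "v \<bullet> x = 0" if "v \<in> V \<epsilon>" "x \<in> span D" for v x
    using that(2)
  proof (induction rule: span_induct)
    case base
    show ?case by (auto simp: subspace_def inner_add_right)
  next
    case (step x)
    then show ?case using that(1) by (auto simp: D_def)
  qed
  have reduce: "\<forall>h\<in>H. h \<bullet> t \<in> \<int>" if t: "\<And>v. v \<in> V \<epsilon> \<Longrightarrow> v \<bullet> t = 0" "\<And>z. z \<in> D \<Longrightarrow> z \<bullet> t \<in> \<int>" for t
  proof
    fix h assume h: "h \<in> H"
    obtain y z where yz: "y \<in> span (V \<epsilon>)" "\<And>w. w \<in> span (V \<epsilon>) \<Longrightarrow> orthogonal z w" "h = y + z"
      by (rule orthogonal_subspace_decomp_exists[of "V \<epsilon>" h]) auto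
    have sV: "span (V \<epsilon>) = V \<epsilon>" using Vsub by simp
    have "z \<in> D" using yz h unfolding D_def sV by (auto simp: orthogonal_def inner_commute)
    then show "h \<bullet> t \<in> \<int>" using t yz(1) unfolding yz(3) sV by (simp add: inner_add_left)
  qed
  show ?thesis
  proof (cases "D = {0}")
    case True
    have sV: "span (V \<epsilon>) = V \<epsilon>" using Vsub by simp
    have "span (V \<epsilon>) \<subset> span UNIV" unfolding sV span_UNIV using VU by blast
    then obtain t where "t \<noteq> 0" "\<And>v. v \<in> V \<epsilon> \<Longrightarrow> t \<bullet> v = 0"
      using orthogonal_to_subspace_exists_gen[of "V \<epsilon>" UNIV] span_base by (metis orthogonal_def)
    then show ?thesis using reduce[of t] True by (auto simp: inner_commute)
  next
    case False
    obtain B where B: "B \<subseteq> D" "independent B" "D \<subseteq> span B" by (meson maximal_independent_subset)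
    have fB: "finite B" using independent_bound[OF B(2)] by auto
    have "B \<noteq> {}" using B(3) False D0 by auto
    then obtain b1 where b1: "b1 \<in> B" by auto
    obtain y z where yz: "y \<in> span (B - {b1})" "\<And>w. w \<in> span (B - {b1}) \<Longrightarrow> orthogonal z w" "b1 = y + z"
      by (rule orthogonal_subspace_decomp_exists[of "B - {b1}" b1]) auto
    have z0: "z \<noteq> 0" using B(2) b1 yz by (auto simp: dependent_def)
    \<comment> \<open>The vector dual to \<open>b1\<close>: its product with \<open>b1\<close> is 1
      and with the rest of \<open>B\<close> is 0.\<close>
    define t where "t = (1 / (z \<bullet> z)) *\<^sub>R z"
    have "y \<bullet> z = 0" using yz(2)[OF yz(1)] by (simp add: orthogonal_def inner_commute)
    then have t1: "b1 \<bullet> t = 1" using z0 by (subst yz(3)) (simp add: t_def inner_add_left)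
    have t2: "b \<bullet> t = 0" if "b \<in> B" "b \<noteq> b1" for b
      using yz(2)[of b] that by (simp add: t_def span_base orthogonal_def inner_commute)
    have "z = b1 - y" using yz(3) by simp
    moreover have "y \<in> span D" using yz(1) B(1) span_mono[of "B - {b1}" D] by auto
    ultimately have zD: "z \<in> span D" using b1 B(1) span_base span_diff by blast
    have tV: "v \<bullet> t = 0" if "v \<in> V \<epsilon>" for v using Dorth[OF that zD] by (simp add: t_def)
    define R where "R = (\<Sum>b\<in>B. norm b)"
    define F where "F = D \<inter> cball 0 R"
    have fF: "finite F"
    proof -
      have "uniform_discrete F"
        unfolding uniform_discrete_def
      proof (intro exI[of _ "\<epsilon> / 2"] conjI ballI impI)
        fix x y assume "x \<in> F" "y \<in> F" "dist x y < \<epsilon> / 2"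
        then show "x = y" using Ddisc[OF Ddiff, of x y] by (auto simp: F_def dist_norm)
      qed (use \<epsilon> in simp)
      moreover have "bounded F" by (auto simp: F_def bounded_Int)
      ultimately show ?thesis using uniform_discrete_finite_iff by blast
    qed
    define K where "K = card F"
    \<comment> \<open>\<open>B\<close> is a basis of the span but need not generate the group
      \<open>D\<close>, so \<open>x \<bullet> t\<close> is only shown to be rational. The multiples
      of \<open>x\<close> reduced modulo \<open>B\<close> fall into the finite set \<open>F\<close>;
      two of them coincide, which bounds the denominator by \<open>K\<close>.\<close>
    have frac: "\<exists>j\<in>{1..K}. of_nat j * (x \<bullet> t) \<in> \<int>" if x: "x \<in> D" for x
    proof -
      obtain r where r: "x = (\<Sum>b\<in>B. r b *\<^sub>R b)" using x B(3) span_finite[OF fB] by auto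
      define I where "I i = (\<Sum>b\<in>B. of_int \<lfloor>of_nat i * r b\<rfloor> *\<^sub>R b)" for i :: nat
      have ID: "I i \<in> D" for i unfolding I_def by (rule combos[OF D0 Ddiff fB B(1)])
      have It: "I i \<bullet> t = of_int \<lfloor>of_nat i * r b1\<rfloor>" for i
      proof -
        have "I i \<bullet> t = (\<Sum>b\<in>B. of_int \<lfloor>of_nat i * r b\<rfloor> * (b \<bullet> t))" by (simp add: I_def inner_sum_left)
        also have "\<dots> = (\<Sum>b\<in>B. if b = b1 then of_int \<lfloor>of_nat i * r b\<rfloor> else 0)"
          by (intro sum.cong) (auto simp: t1 t2)
        also have "\<dots> = of_int \<lfloor>of_nat i * r b1\<rfloor>" using fB b1 by simp
        finally show ?thesis .
      qed
      define y where "y i = of_nat i *\<^sub>R x - I i" for i :: nat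
      have "y i \<in> F" for i
      proof -
        have "of_int (int i) *\<^sub>R x \<in> D" by (rule multiples[OF D0 Ddiff x])
        then have "y i \<in> D" unfolding y_def using Ddiff ID by simp
        moreover have "norm (y i) \<le> R"
        proof -
          have "y i = (\<Sum>b\<in>B. (of_nat i * r b - of_int \<lfloor>of_nat i * r b\<rfloor>) *\<^sub>R b)"
            by (simp add: y_def I_def r scaleR_sum_right scaleR_left_diff_distrib sum_subtractf)
          also have "norm \<dots> \<le> (\<Sum>b\<in>B. norm b)"
          proof (intro order_trans[OF norm_sum] sum_mono)
            fix b
            have "\<bar>of_nat i * r b - of_int \<lfloor>of_nat i * r b\<rfloor>\<bar> \<le> 1" by linarith
            then show "norm ((of_nat i * r b - of_int \<lfloor>of_nat i * r b\<rfloor>) *\<^sub>R b) \<le> norm b"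
              by (simp add: mult_left_le_one_le)
          qed
          finally show ?thesis by (simp add: R_def)
        qed
        ultimately show ?thesis by (simp add: F_def)
      qed
      then have "card (y ` {0..K}) \<le> K" unfolding K_def using fF by (intro card_mono) auto
      then have "\<not> inj_on y {0..K}" by (intro pigeonhole) simp
      then obtain i i' where ii: "i \<le> K" "i' \<le> K" "i < i'" "y i = y i'"
        unfolding inj_on_def by (metis atLeastAtMost_iff linorder_neqE_nat)
      have "of_nat (i' - i) *\<^sub>R x = I i' - I i"
        using ii by (simp add: y_def of_nat_diff scaleR_left_diff_distrib algebra_simps)
      then have "of_nat (i' - i) * (x \<bullet> t) = I i' \<bullet> t - I i \<bullet> t"
        by (metis inner_diff_left inner_scaleR_left)
      then have "of_nat (i' - i) * (x \<bullet> t) \<in> \<int>" by (simp add: It)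
      then show ?thesis using ii by (intro bexI[of _ "i' - i"]) auto
    qed
    \<comment> \<open>The factorial clears all denominators up to \<open>K\<close> at once.\<close>
    define s where "s = of_nat (fact K) *\<^sub>R t"
    have "x \<bullet> s \<in> \<int>" if x: "x \<in> D" for x
    proof -
      obtain j where j: "j \<in> {1..K}" "of_nat j * (x \<bullet> t) \<in> \<int>" using frac[OF x] by blast
      then obtain k where "(fact K :: nat) = j * k" using dvd_fact[of j K] by (auto simp: dvd_def)
      then have "x \<bullet> s = of_nat k * (of_nat j * (x \<bullet> t))" by (simp add: s_def)
      then show ?thesis using j(2) by simp
    qed
    moreover have "s \<noteq> 0" using z0 by (simp add: s_def t_def)
    moreover have "v \<bullet> s = 0" if "v \<in> V \<epsilon>" for v using tV[OF that] by (simp add: s_def)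
    ultimately show ?thesis using reduce[of s] by blast
  qed
qed

text \<open>On a compact set characters are close if their frequencies are, so density can be asked
  of the frequencies. If it fails, some \<open>t \<noteq> 0\<close> has integer products with all of
  them, and every element of \<open>E\<close> is 1 at \<open>(2 * pi) *\<^sub>R t\<close>.\<close>

lemma dual_subgroup_dense:
  fixes E :: "(real^'n \<Rightarrow> complex) set"
  assumes E: "subgroup E dual_group" and sep: "\<And>t. t \<noteq> 0 \<Longrightarrow> \<exists>\<eta>\<in>E. \<eta> t \<noteq> 1"
  shows "dual_topology closure_of E = carrier dual_group"
proof
  show "dual_topology closure_of E \<subseteq> carrier dual_group"
    using closure_of_subset_topspace[of dual_topology E] by (simp add: topspace_dual_topology)
  define H where "H = {b. (\<lambda>t. cis (b \<bullet> t)) \<in> E}"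
  have H0: "0 \<in> H" using subgroup.one_closed[OF E] by (simp add: H_def dual_group_def)
  have Hdiff: "x - y \<in> H" if "x \<in> H" "y \<in> H" for x y
  proof -
    have "(\<lambda>t. cis (x \<bullet> t)) \<otimes>\<^bsub>dual_group\<^esub> inv\<^bsub>dual_group\<^esub> (\<lambda>t. cis (y \<bullet> t)) \<in> E"
      using that E unfolding H_def by (intro subgroup.m_closed[OF E] subgroup.m_inv_closed[OF E]) auto
    then show ?thesis
      by (simp add: H_def inv_dual_group[OF cis_inner_in_dual_group])
        (simp add: dual_group_def cis_cnj cis_mult inner_diff_left)
  qed
  have dense: "\<exists>h\<in>H. norm (b - h) < e" if "e > 0" for b e
  proof (rule ccontr)
    assume "\<not> ?thesis"
    then have "\<And>h. h \<in> H \<Longrightarrow> norm (b - h) \<ge> e" by force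
    from nondense_subgroup_annihilator[OF H0 Hdiff \<open>e > 0\<close> this]
    obtain t where t: "t \<noteq> 0" "\<forall>h\<in>H. h \<bullet> t \<in> \<int>" by blast
    then obtain \<eta> where \<eta>: "\<eta> \<in> E" "\<eta> ((2 * pi) *\<^sub>R t) \<noteq> 1" using sep[of "(2 * pi) *\<^sub>R t"] by auto
    then have "\<eta> \<in> carrier dual_group" using subgroup.subset[OF E] by blast
    then obtain h where h: "\<eta> = (\<lambda>t. cis (h \<bullet> t))" by (rule dual_group_character)
    then have "h \<bullet> t \<in> \<int>" using t \<eta> by (auto simp: H_def)
    then have "cis (2 * pi * (h \<bullet> t)) = 1" by (rule cis_multiple_2pi)
    then show False using \<eta> h by simp
  qed
  show "carrier dual_group \<subseteq> dual_topology closure_of E"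
  proof
    fix \<eta> :: "real^'n \<Rightarrow> complex" assume \<eta>: "\<eta> \<in> carrier dual_group"
    then obtain b where b: "\<eta> = (\<lambda>t. cis (b \<bullet> t))" by (rule dual_group_character)
    show "\<eta> \<in> dual_topology closure_of E"
      unfolding in_closure_of topspace_dual_topology
    proof (intro conjI allI impI \<eta>)
      fix T assume "\<eta> \<in> T \<and> openin dual_topology T"
      then obtain K e where K: "compact K" "e > 0"
        "\<And>\<psi>. \<psi> \<in> carrier dual_group \<Longrightarrow> (\<forall>t\<in>K. dist (\<eta> t) (\<psi> t) < e) \<Longrightarrow> \<psi> \<in> T"
        unfolding openin_dual_topology by blast
      obtain R where R: "R > 0" "\<And>t. t \<in> K \<Longrightarrow> norm t \<le> R"
        using compact_imp_bounded[OF K(1)] by (auto simp: bounded_pos)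
      obtain h where h: "h \<in> H" "norm (b - h) < e / R" using dense[of "e / R" b] K R by auto
      have "(\<lambda>t. cis (h \<bullet> t)) \<in> T"
      proof (intro K(3) cis_inner_in_dual_group ballI)
        fix t assume "t \<in> K"
        have "dist (\<eta> t) (cis (h \<bullet> t)) \<le> \<bar>b \<bullet> t - h \<bullet> t\<bar>" unfolding b dist_norm by (rule norm_cis_diff_le)
        also have "\<dots> = \<bar>(b - h) \<bullet> t\<bar>" by (simp add: inner_diff_left)
        also have "\<dots> \<le> norm (b - h) * norm t" by (rule Cauchy_Schwarz_ineq2)
        also have "\<dots> \<le> norm (b - h) * R" using R(2)[OF \<open>t \<in> K\<close>] by (intro mult_left_mono) auto
        also have "\<dots> < e" using h R by (simp add: pos_less_divide_eq)
        finally show "dist (\<eta> t) (cis (h \<bullet> t)) < e" .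
      qed
      then show "\<exists>y. y \<in> E \<and> y \<in> T" using h(1) by (auto simp: H_def)
    qed
  qed
qed

section \<open>The hull of a repetitive Delone set\<close>

lemma mem_shift [simp]: "w \<in> shift t L \<longleftrightarrow> w + t \<in> L"
  by (force simp: shift_def image_iff algebra_simps)

lemma shift_shift: "shift s (shift t L) = shift (s + t) L"
  by (auto simp: add.assoc)

lemma shift_zero [simp]: "shift 0 L = L"
  by auto

text \<open>One translation vector replaces the two in \<open>delone_dist\<close>, so that it can be
  composed and compared across scales. The price is asymmetry: inverting or composing costs a factor
  2.\<close>

definition near :: "real \<Rightarrow> (real^'n) set \<Rightarrow> (real^'n) set \<Rightarrow> bool" where
  "near \<epsilon> x y \<longleftrightarrow> (\<exists>v. norm v < \<epsilon> \<and> (\<forall>w. norm w < 1 / \<epsilon> \<longrightarrow> (w \<in> x \<longleftrightarrow> w + v \<in> y)))"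

lemma near_mono:
  assumes "near \<epsilon> x y" "0 < \<epsilon>" "\<epsilon> \<le> \<epsilon>'"
  shows "near \<epsilon>' x y"
proof -
  have "1 / \<epsilon>' \<le> 1 / \<epsilon>" using assms by (intro frac_le) auto
  then show ?thesis using assms unfolding near_def by (meson order_less_le_trans)
qed

text \<open>A ball of radius \<open>1 / (2 * \<epsilon>)\<close> moved by less than
  \<open>\<epsilon>\<close> stays in the window of radius \<open>1 / \<epsilon>\<close>: the room
  used whenever translations are inverted or composed.\<close>

lemma half_scale: "0 < \<epsilon> \<Longrightarrow> \<epsilon> \<le> 1/2 \<Longrightarrow> 1 / (2 * \<epsilon>) + \<epsilon> \<le> 1 / (\<epsilon> :: real)"
  using mult_mono[of \<epsilon> "1/2" \<epsilon> 1] by (simp add: field_simps)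

lemma near_sym:
  assumes "near \<epsilon> x y" "0 < \<epsilon>" "\<epsilon> \<le> 1/2"
  shows "near (2 * \<epsilon>) y x"
proof -
  obtain v where v: "norm v < \<epsilon>" "\<And>w. norm w < 1 / \<epsilon> \<Longrightarrow> w \<in> x \<longleftrightarrow> w + v \<in> y"
    using assms(1) by (auto simp: near_def)
  have e: "1 / (2 * \<epsilon>) + \<epsilon> \<le> 1 / \<epsilon>"
    using assms by (intro half_scale)
  have "w \<in> y \<longleftrightarrow> w + (- v) \<in> x" if w: "norm w < 1 / (2 * \<epsilon>)" for w
  proof -
    have "norm (w - v) < 1 / \<epsilon>" using norm_triangle_ineq4[of w v] w v(1) e by linarith
    then show ?thesis using v(2)[of "w - v"] by simp
  qed
  moreover have "norm (- v) < 2 * \<epsilon>" using v(1) assms(2) by simp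
  ultimately show ?thesis unfolding near_def by blast
qed

lemma near_trans:
  assumes "near \<epsilon> x y" "near \<epsilon> y z" "0 < \<epsilon>" "\<epsilon> \<le> 1/2"
  shows "near (2 * \<epsilon>) x z"
proof -
  obtain u where u: "norm u < \<epsilon>" "\<And>w. norm w < 1 / \<epsilon> \<Longrightarrow> w \<in> x \<longleftrightarrow> w + u \<in> y"
    using assms(1) by (auto simp: near_def)
  obtain v where v: "norm v < \<epsilon>" "\<And>w. norm w < 1 / \<epsilon> \<Longrightarrow> w \<in> y \<longleftrightarrow> w + v \<in> z"
    using assms(2) by (auto simp: near_def)
  have e: "1 / (2 * \<epsilon>) + \<epsilon> \<le> 1 / \<epsilon>"
    using assms by (intro half_scale)
  have "w \<in> x \<longleftrightarrow> w + (u + v) \<in> z" if w: "norm w < 1 / (2 * \<epsilon>)" for w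
  proof -
    have "norm w < 1 / \<epsilon>" using w e assms by linarith
    moreover have "norm (w + u) < 1 / \<epsilon>" using norm_triangle_ineq[of w u] w u e by linarith
    ultimately show ?thesis using u(2) v(2) by (simp add: add.assoc)
  qed
  moreover have "norm (u + v) < 2 * \<epsilon>" using norm_triangle_ineq[of u v] u v by linarith
  ultimately show ?thesis unfolding near_def by blast
qed

text \<open>Moving the origin by at most \<open>T\<close> consumes at most that much of the
  window.\<close>

lemma near_shift:
  assumes "near \<epsilon> x y" "norm t \<le> T" "1 / \<epsilon>' + T \<le> 1 / \<epsilon>" "\<epsilon> \<le> \<epsilon>'"
  shows "near \<epsilon>' (shift t x) (shift t y)"
proof -
  obtain v where v: "norm v < \<epsilon>" "\<And>w. norm w < 1 / \<epsilon> \<Longrightarrow> w \<in> x \<longleftrightarrow> w + v \<in> y"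
    using assms(1) by (auto simp: near_def)
  have "w \<in> shift t x \<longleftrightarrow> w + v \<in> shift t y" if "norm w < 1 / \<epsilon>'" for w
    using v(2)[of "w + t"] norm_triangle_ineq[of w t] that assms by (simp add: algebra_simps)
  then show ?thesis unfolding near_def using v(1) assms(4) by (intro exI[of _ v]) auto
qed

text \<open>At two small scales the translation vectors carry one fixed point of \<open>A\<close> to
  points of \<open>B\<close> closer than the separation of \<open>B\<close>, so they agree. A
  nonzero vector would then violate the bound at a scale not exceeding its length.\<close>

lemma near_imp_eq:
  fixes A B :: "(real^'n) set"
  assumes "\<And>\<epsilon>. \<epsilon> > 0 \<Longrightarrow> near \<epsilon> A B" "A \<noteq> {}" "uniform_discrete B"
  shows "A = B"
proof -
  obtain s where s: "s > 0" "\<And>x y. x \<in> B \<Longrightarrow> y \<in> B \<Longrightarrow> dist x y < s \<Longrightarrow> x = y"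
    using assms(3) by (auto simp: uniform_discrete_def)
  obtain a where a: "a \<in> A" using assms(2) by blast
  have agree: "\<exists>\<epsilon>0>0. \<forall>\<epsilon> v. 0 < \<epsilon> \<and> \<epsilon> \<le> \<epsilon>0 \<and> norm v < \<epsilon> \<and> (\<forall>w. norm w < 1 / \<epsilon> \<longrightarrow> (w \<in> A \<longleftrightarrow> w + v \<in> B)) \<longrightarrow> v = 0"
  proof -
    define \<epsilon>0 where "\<epsilon>0 = min (s / 2) (1 / (norm a + 1))"
    have e0: "\<epsilon>0 > 0" using s by (auto simp: \<epsilon>0_def intro!: divide_pos_pos add_nonneg_pos)
    have mem: "a + v \<in> B" if "0 < \<epsilon>" "\<epsilon> \<le> \<epsilon>0" "\<forall>w. norm w < 1 / \<epsilon> \<longrightarrow> (w \<in> A \<longleftrightarrow> w + v \<in> B)" for \<epsilon> v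
    proof -
      have "norm a + 1 > 0" by (rule add_nonneg_pos) auto
      moreover have "\<epsilon> \<le> 1 / (norm a + 1)" using that by (simp add: \<epsilon>0_def)
      ultimately have "norm a + 1 \<le> 1 / \<epsilon>" using that(1) by (simp add: field_simps)
      then show ?thesis using that(3) a by auto
    qed
    have "v = 0" if v: "0 < \<epsilon>" "\<epsilon> \<le> \<epsilon>0" "norm v < \<epsilon>" "\<forall>w. norm w < 1 / \<epsilon> \<longrightarrow> (w \<in> A \<longleftrightarrow> w + v \<in> B)" for \<epsilon> v
    proof (rule ccontr)
      assume "v \<noteq> 0"
      define \<delta> where "\<delta> = min \<epsilon> (norm v)"
      have d: "\<delta> > 0" "\<delta> \<le> \<epsilon>" using v \<open>v \<noteq> 0\<close> by (auto simp: \<delta>_def)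
      then obtain u where u: "norm u < \<delta>" "\<forall>w. norm w < 1 / \<delta> \<longrightarrow> (w \<in> A \<longleftrightarrow> w + u \<in> B)"
        using assms(1)[of \<delta>] by (auto simp: near_def)
      have "a + v \<in> B" "a + u \<in> B" using mem[OF v(1,2,4)] mem[OF d(1) _ u(2)] d v by auto
      moreover have "dist (a + v) (a + u) < s"
        using norm_triangle_ineq4[of v u] u v d by (auto simp: dist_norm \<epsilon>0_def)
      ultimately have "v = u" using s(2) by fastforce
      then show False using u by (simp add: \<delta>_def)
    qed
    then show ?thesis using e0 by blast
  qed
  then obtain \<epsilon>0 where e0: "\<epsilon>0 > 0" "\<And>\<epsilon> v. 0 < \<epsilon> \<Longrightarrow> \<epsilon> \<le> \<epsilon>0 \<Longrightarrow> norm v < \<epsilon> \<Longrightarrow>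
     (\<forall>w. norm w < 1 / \<epsilon> \<longrightarrow> (w \<in> A \<longleftrightarrow> w + v \<in> B)) \<Longrightarrow> v = 0" by blast
  show ?thesis
  proof (rule Set.set_eqI)
    fix w :: "real^'n"
    define \<epsilon> where "\<epsilon> = min \<epsilon>0 (1 / (norm w + 1))"
    have n1: "norm w + 1 > 0" by (rule add_nonneg_pos) auto
    have e: "\<epsilon> > 0" "\<epsilon> \<le> \<epsilon>0" using e0 n1 by (auto simp: \<epsilon>_def)
    have "\<epsilon> \<le> 1 / (norm w + 1)" by (simp add: \<epsilon>_def)
    then have "norm w + 1 \<le> 1 / \<epsilon>" using e n1 by (simp add: field_simps)
    moreover obtain v where v: "norm v < \<epsilon>" "\<forall>w. norm w < 1 / \<epsilon> \<longrightarrow> (w \<in> A \<longleftrightarrow> w + v \<in> B)"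
      using assms(1)[OF e(1)] by (auto simp: near_def)
    moreover have "v = 0" by (rule e0(2)[OF e v])
    ultimately show "w \<in> A \<longleftrightarrow> w \<in> B" by auto
  qed
qed

lemma delone_dist_le:
  assumes "near \<epsilon> x y" "\<epsilon> > 0"
  shows "delone_dist x y \<le> \<epsilon> / (\<epsilon> + 1)"
  unfolding delone_dist_def
proof (rule cInf_lower)
  obtain v where v: "norm v < \<epsilon>" "\<And>w. norm w < 1 / \<epsilon> \<Longrightarrow> w \<in> x \<longleftrightarrow> w + v \<in> y"
    using assms(1) by (auto simp: near_def)
  then have "shift 0 x \<inter> ball 0 (1 / \<epsilon>) = shift v y \<inter> ball 0 (1 / \<epsilon>)" by auto
  moreover have v0: "0 \<in> ball 0 \<epsilon>" "v \<in> ball 0 \<epsilon>" using v(1) assms(2) by auto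
  ultimately show "\<epsilon> / (\<epsilon> + 1) \<in> {\<epsilon> / (\<epsilon> + 1) |\<epsilon>. \<epsilon> > 0 \<and> (\<exists>t\<in>ball 0 \<epsilon>. \<exists>t'\<in>ball 0 \<epsilon>.
        shift t x \<inter> ball 0 (1/\<epsilon>) = shift t' y \<inter> ball 0 (1/\<epsilon>))}"
    unfolding mem_Collect_eq using v0 assms(2) by blast
qed (auto intro!: bdd_belowI[of _ 0])

lemma uniform_discrete_gap:
  fixes A :: "(real^'n) set"
  assumes "uniform_discrete A"
  shows "\<exists>t r. r > 0 \<and> ball t r \<inter> A = {}"
proof -
  obtain s where s: "s > 0" "\<And>x y. x \<in> A \<Longrightarrow> y \<in> A \<Longrightarrow> dist x y < s \<Longrightarrow> x = y"
    using assms by (auto simp: uniform_discrete_def)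
  define u :: "real^'n" where "u = (s / 2) *\<^sub>R axis undefined 1"
  have "norm u = s / 2" using s by (simp add: u_def)
  then have "\<not> (0 \<in> A \<and> u \<in> A)" using s(1) s(2)[of 0 u] by auto
  then have "- A \<noteq> {}" by auto
  moreover have "open (- A)" using uniform_discrete_imp_closed[OF assms] by (simp add: open_Compl)
  ultimately obtain t r where "r > 0" "ball t r \<subseteq> - A" by (metis ex_in_conv open_contains_ball)
  then show ?thesis by blast
qed

text \<open>
  The infimum defining the distance is taken over a nonempty set, since both Delone sets
  leave out some ball.
\<close>

lemma near_of_delone_dist:
  assumes "delone_dist x y < \<epsilon> / (\<epsilon> + 1)" "0 < \<epsilon>" "\<epsilon> \<le> 1/2" "uniform_discrete x" "uniform_discrete y"
  shows "near (2 * \<epsilon>) x y"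
proof -
  define S where "S = {\<epsilon> / (\<epsilon> + 1) |\<epsilon>. \<epsilon> > (0::real) \<and> (\<exists>t\<in>ball 0 \<epsilon>. \<exists>t'\<in>ball 0 \<epsilon>.
        shift t x \<inter> ball 0 (1/\<epsilon>) = shift t' y \<inter> ball 0 (1/\<epsilon>))}"
  have "S \<noteq> {}"
  proof -
    obtain t r where tr: "r > 0" "ball t r \<inter> x = {}" using uniform_discrete_gap[OF assms(4)] by blast
    obtain t' r' where tr': "r' > 0" "ball t' r' \<inter> y = {}" using uniform_discrete_gap[OF assms(5)] by blast
    \<comment> \<open>Large enough to admit both translation vectors, and with \<open>1 / e\<close>
      at most both radii, so that both windows are empty.\<close>
    define e where "e = 1 + norm t + norm t' + 1 / r + 1 / r'"
    have e: "e > 0" "e > norm t" "e > norm t'" "e \<ge> 1 / r" "e \<ge> 1 / r'"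
      using tr tr' by (auto simp: e_def add_pos_nonneg add_nonneg_pos less_eq_real_def intro!: add_pos_nonneg add_nonneg_nonneg)
    then have "1 / e \<le> r" "1 / e \<le> r'" using tr tr' by (auto simp: field_simps)
    then have "w + t \<notin> x" "w + t' \<notin> y" if "norm w < 1 / e" for w
    proof -
      have "w + t \<in> ball t r" "w + t' \<in> ball t' r'" using that \<open>1 / e \<le> r\<close> \<open>1 / e \<le> r'\<close> by (auto simp: dist_norm)
      then show "w + t \<notin> x" "w + t' \<notin> y" using tr tr' by blast+
    qed
    then have "shift t x \<inter> ball 0 (1 / e) = shift t' y \<inter> ball 0 (1 / e)" by auto
    moreover have "t \<in> ball 0 e" "t' \<in> ball 0 e" using e by auto
    ultimately have "e / (e + 1) \<in> S" using e(1) unfolding S_def mem_Collect_eq by blast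
    then show ?thesis by blast
  qed
  moreover have "Inf S < \<epsilon> / (\<epsilon> + 1)" using assms(1) by (simp add: S_def delone_dist_def)
  ultimately obtain e where e: "e > 0" "e / (e + 1) < \<epsilon> / (\<epsilon> + 1)"
    and ex: "\<exists>t\<in>ball 0 e. \<exists>t'\<in>ball 0 e. shift t x \<inter> ball 0 (1/e) = shift t' y \<inter> ball 0 (1/e)"
    using cInf_lessD[of S "\<epsilon> / (\<epsilon> + 1)"] unfolding S_def by blast
  obtain t t' where t: "norm t < e" "norm t' < e" "shift t x \<inter> ball 0 (1/e) = shift t' y \<inter> ball 0 (1/e)"
    using ex by (auto simp: dist_norm)
  have agree: "u + t \<in> x \<longleftrightarrow> u + t' \<in> y" if "norm u < 1 / e" for u
  proof -
    have "u \<in> shift t x \<inter> ball 0 (1/e) \<longleftrightarrow> u \<in> shift t' y \<inter> ball 0 (1/e)" unfolding t(3) ..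
    then show ?thesis using that by simp
  qed
  have ee: "e < \<epsilon>" using e assms(2) by (simp add: field_simps)
  have eps: "1 / (2 * \<epsilon>) + \<epsilon> \<le> 1 / \<epsilon>"
    using assms by (intro half_scale)
  have inv: "1 / \<epsilon> < 1 / e" using ee e by (simp add: field_simps)
  have "w \<in> x \<longleftrightarrow> w + (t' - t) \<in> y" if "norm w < 1 / (2 * \<epsilon>)" for w
  proof -
    have "norm (w - t) < 1 / e" using norm_triangle_ineq4[of w t] that t ee eps inv by linarith
    then have "w - t + t \<in> x \<longleftrightarrow> w - t + t' \<in> y" by (rule agree)
    then show ?thesis by (simp add: algebra_simps)
  qed
  moreover have "norm (t' - t) < 2 * \<epsilon>" using norm_triangle_ineq4[of t' t] t ee by linarith
  ultimately show ?thesis unfolding near_def by blast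
qed

lemma delone_hull_uniform_discrete: "x \<in> delone_hull L \<Longrightarrow> uniform_discrete x"
  by (simp add: delone_hull_def delone_def)

text \<open>Frees the topological arguments from the infimum: neighbourhoods are described by
  \<open>near\<close>, where the translation vector is explicit.\<close>

lemma openin_hull_near:
  "openin (hull_topology L) U \<longleftrightarrow>
     U \<subseteq> delone_hull L \<and> (\<forall>A\<in>U. \<exists>\<epsilon>>0. \<forall>B\<in>delone_hull L. near \<epsilon> A B \<longrightarrow> B \<in> U)"
proof -
  have eq: "(\<exists>e>0. \<forall>B\<in>delone_hull L. delone_dist A B < e \<longrightarrow> B \<in> U) \<longleftrightarrow>
      (\<exists>\<epsilon>>0. \<forall>B\<in>delone_hull L. near \<epsilon> A B \<longrightarrow> B \<in> U)" (is "?l \<longleftrightarrow> ?r") if A: "A \<in> delone_hull L" for A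
  proof
    assume ?l
    then obtain e where e: "e > 0" "\<And>B. B \<in> delone_hull L \<Longrightarrow> delone_dist A B < e \<Longrightarrow> B \<in> U" by blast
    have "B \<in> U" if "B \<in> delone_hull L" "near (e / 2) A B" for B
    proof (rule e(2)[OF that(1)])
      have "(e / 2) / (e / 2 + 1) < e" using e(1) by (simp add: field_simps add_strict_increasing)
      then show "delone_dist A B < e" using delone_dist_le[OF that(2)] e(1) by simp
    qed
    then show ?r using e(1) by (intro exI[of _ "e / 2"]) auto
  next
    assume ?r
    then obtain e where e: "e > 0" "\<And>B. B \<in> delone_hull L \<Longrightarrow> near e A B \<Longrightarrow> B \<in> U" by blast
    define \<eta> where "\<eta> = min (e / 2) (1 / 2)"
    have h: "0 < \<eta>" "\<eta> \<le> 1 / 2" "2 * \<eta> \<le> e" using e(1) by (auto simp: \<eta>_def)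
    have "B \<in> U" if B: "B \<in> delone_hull L" "delone_dist A B < \<eta> / (\<eta> + 1)" for B
    proof (rule e(2)[OF B(1)])
      have "near (2 * \<eta>) A B"
        using near_of_delone_dist[OF B(2) h(1,2)] A B(1) delone_hull_uniform_discrete by blast
      then show "near e A B" by (rule near_mono) (use h in auto)
    qed
    then show ?l using h(1) by (intro exI[of _ "\<eta> / (\<eta> + 1)"]) auto
  qed
  show ?thesis
    unfolding openin_hull_topology
  proof (rule conj_cong[OF refl], rule ball_cong[OF refl])
    fix A assume "U \<subseteq> delone_hull L" "A \<in> U"
    then have "A \<in> delone_hull L" by blast
    then show "(\<exists>e>0. \<forall>B\<in>delone_hull L. delone_dist A B < e \<longrightarrow> B \<in> U) \<longleftrightarrow>
      (\<exists>\<epsilon>>0. \<forall>B\<in>delone_hull L. near \<epsilon> A B \<longrightarrow> B \<in> U)" by (rule eq)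
  qed
qed

section \<open>Elements of the hull and their patches\<close>

lemma delone_nonempty: "delone L \<Longrightarrow> L \<noteq> {}"
  by (auto simp: delone_def relatively_dense_def) 

lemma delone_hull_lookup:
  assumes "x \<in> delone_hull L" "p \<in> x"
  obtains q where "q \<in> L" "\<And>w. norm w \<le> R \<Longrightarrow> p + w \<in> x \<longleftrightarrow> q + w \<in> L"
proof -
  have "shift p x \<inter> cball 0 R \<in> patches (cball 0 R) x" using assms(2) by (auto simp: patches_def)
  moreover have "patches (cball 0 R) x \<subseteq> patches (cball 0 R) L" using assms(1) compact_cball by (simp add: delone_hull_def)
  ultimately have "shift p x \<inter> cball 0 R \<in> patches (cball 0 R) L" by blast
  then obtain q where q: "q \<in> L" "shift p x \<inter> cball 0 R = shift q L \<inter> cball 0 R" by (auto simp: patches_def)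
  have "p + w \<in> x \<longleftrightarrow> q + w \<in> L" if "norm w \<le> R" for w
  proof -
    have "w \<in> shift p x \<inter> cball 0 R \<longleftrightarrow> w \<in> shift q L \<inter> cball 0 R" using q(2) by simp
    then show ?thesis using that by (simp add: add.commute)
  qed
  then show ?thesis using that q(1) by blast
qed

text \<open>Balls suffice as windows: every compact window lies in one, and agreement on the ball
  restricts to it.\<close>

lemma delone_hullI:
  assumes "delone x" "\<And>p R. p \<in> x \<Longrightarrow> \<exists>q\<in>L. \<forall>w. norm w \<le> R \<longrightarrow> (p + w \<in> x \<longleftrightarrow> q + w \<in> L)"
  shows "x \<in> delone_hull L"
proof -
  have "patches K x \<subseteq> patches K L" if K: "compact K" for K
  proof
    fix P assume "P \<in> patches K x"
    then obtain p where p: "p \<in> x" "P = shift p x \<inter> K" by (auto simp: patches_def)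
    obtain R where R: "\<And>w. w \<in> K \<Longrightarrow> norm w \<le> R" using compact_imp_bounded[OF K] by (auto simp: bounded_iff)
    obtain q where q: "q \<in> L" "\<And>w. norm w \<le> R \<Longrightarrow> p + w \<in> x \<longleftrightarrow> q + w \<in> L" using assms(2)[OF p(1)] by blast
    have "P = shift q L \<inter> K" using p(2) q(2) R by (auto simp: add.commute)
    then show "P \<in> patches K L" using q(1) by (auto simp: patches_def)
  qed
  then show ?thesis using assms(1) by (simp add: delone_hull_def)
qed

lemma self_in_delone_hull: "delone L \<Longrightarrow> L \<in> delone_hull L"
  by (simp add: delone_hull_def)

lemma uniform_discrete_shift: "uniform_discrete L \<Longrightarrow> uniform_discrete (shift t L)"
proof -
  assume "uniform_discrete L"
  then obtain e where e: "e > 0" "\<And>x y. x \<in> L \<Longrightarrow> y \<in> L \<Longrightarrow> dist x y < e \<Longrightarrow> x = y" by (auto simp: uniform_discrete_def)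
  have "x = y" if "x \<in> shift t L" "y \<in> shift t L" "dist x y < e" for x y
    using e(2)[of "x + t" "y + t"] that by simp
  then show ?thesis using e(1) unfolding uniform_discrete_def by blast
qed

lemma delone_shift:
  assumes "delone L" shows "delone (shift t L)"
proof -
  obtain R where R: "R > 0" "\<And>x. \<exists>y\<in>L. dist x y \<le> R" using assms by (auto simp: delone_def relatively_dense_def)
  have "\<exists>y\<in>shift t L. dist x y \<le> R" for x
  proof -
    obtain y where "y \<in> L" "dist (x + t) y \<le> R" using R(2) by blast
    then show ?thesis by (intro bexI[of _ "y - t"]) (auto simp: dist_norm algebra_simps)
  qed
  then show ?thesis using assms R(1) by (auto simp: delone_def relatively_dense_def uniform_discrete_shift)
qed

lemma shift_in_delone_hull:
  assumes "x \<in> delone_hull L" shows "shift t x \<in> delone_hull L"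
proof (rule delone_hullI)
  show "delone (shift t x)" using assms by (simp add: delone_hull_def delone_shift)
  fix p R assume "p \<in> shift t x"
  then have "p + t \<in> x" by simp
  then obtain q where "q \<in> L" "\<And>w. norm w \<le> R \<Longrightarrow> p + t + w \<in> x \<longleftrightarrow> q + w \<in> L"
    using delone_hull_lookup[OF assms] by metis
  then show "\<exists>q\<in>L. \<forall>w. norm w \<le> R \<longrightarrow> (p + w \<in> shift t x \<longleftrightarrow> q + w \<in> L)"
    by (intro bexI[of _ q]) (auto simp: algebra_simps)
qed

section \<open>Uniformity and compactness of the hull\<close>

locale repetitive_delone =
  fixes L :: "(real^'n) set"
  assumes delone: "delone L" and flc: "finite_local_complexity L" and repetitive: "repetitive L"
begin

abbreviation \<Omega> :: "(real^'n) set set" where "\<Omega> \<equiv> delone_hull L"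

text \<open>This and \<open>rad\<close> are chosen once as constants of \<open>L\<close>. Since
  every ball pattern in the hull occurs in \<open>L\<close>, they serve for the whole hull.\<close>

definition sep :: real where
  "sep = (SOME s. s > 0 \<and> (\<forall>x\<in>L. \<forall>y\<in>L. dist x y < s \<longrightarrow> x = y))"

definition rad :: real where
  "rad = (SOME R. R > 0 \<and> (\<forall>x. \<exists>y\<in>L. dist x y \<le> R))"

lemma sep: "sep > 0" "\<And>x y. x \<in> L \<Longrightarrow> y \<in> L \<Longrightarrow> dist x y < sep \<Longrightarrow> x = y"
proof -
  have "\<exists>s. s > 0 \<and> (\<forall>x\<in>L. \<forall>y\<in>L. dist x y < s \<longrightarrow> x = y)"
    using delone by (auto simp: delone_def uniform_discrete_def)
  from someI_ex[OF this] show "sep > 0" "\<And>x y. x \<in> L \<Longrightarrow> y \<in> L \<Longrightarrow> dist x y < sep \<Longrightarrow> x = y"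
    unfolding sep_def by blast+
qed

lemma rad: "rad > 0" "\<exists>y\<in>L. dist x y \<le> rad"
proof -
  have "\<exists>R. R > 0 \<and> (\<forall>x. \<exists>y\<in>L. dist x y \<le> R)"
    using delone by (auto simp: delone_def relatively_dense_def)
  from someI_ex[OF this] show "rad > 0" "\<exists>y\<in>L. dist x y \<le> rad"
    unfolding rad_def by blast+
qed

lemma L_in: "L \<in> \<Omega>"
  using delone by (rule self_in_delone_hull)

lemma hull_nonempty: "x \<in> \<Omega> \<Longrightarrow> x \<noteq> {}"
  by (simp add: delone_hull_def delone_nonempty)

lemma hull_sep:
  assumes "x \<in> \<Omega>" "p \<in> x" "p' \<in> x" "dist p p' < sep"
  shows "p = p'"
proof -
  obtain q where q: "q \<in> L" "\<And>w. norm w \<le> sep \<Longrightarrow> p + w \<in> x \<longleftrightarrow> q + w \<in> L"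
    using delone_hull_lookup[OF assms(1,2), of sep] by blast
  have "q + (p' - p) \<in> L" using q(2)[of "p' - p"] assms by (simp add: dist_norm norm_minus_commute)
  then have "q = q + (p' - p)" using q(1) assms(4) by (intro sep(2)) (auto simp: dist_norm norm_minus_commute)
  then show ?thesis by simp
qed

lemma hull_rad:
  assumes "x \<in> \<Omega>" shows "\<exists>y\<in>x. dist c y \<le> rad"
proof -
  obtain p where p: "p \<in> x" using hull_nonempty[OF assms] by blast
  obtain q where q: "q \<in> L" "\<And>w. norm w \<le> norm (c - p) + rad \<Longrightarrow> p + w \<in> x \<longleftrightarrow> q + w \<in> L"
    using delone_hull_lookup[OF assms p, of "norm (c - p) + rad"] by blast
  obtain y where y: "y \<in> L" "dist (q + (c - p)) y \<le> rad" using rad(2) by blast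
  define w where "w = y - q"
  have "norm w \<le> norm (c - p) + rad"
    using norm_triangle_ineq4[of "c - p" "(q + (c - p)) - y"] y(2) by (simp add: w_def dist_norm algebra_simps)
  then have "p + w \<in> x" using q(2) y(1) by (simp add: w_def)
  moreover have "dist c (p + w) \<le> rad" using y(2) by (simp add: w_def dist_norm algebra_simps)
  ultimately show ?thesis by blast
qed

text \<open>A bounded difference is a point of a patch of \<open>L\<close>; there are finitely many
  patches for that window, and each is finite.\<close>

lemma finite_differences:
  obtains D where "finite D" "\<And>x p q. x \<in> \<Omega> \<Longrightarrow> p \<in> x \<Longrightarrow> q \<in> x \<Longrightarrow> norm (q - p) \<le> R \<Longrightarrow> q - p \<in> D"
proof
  have "finite (shift x L \<inter> cball 0 R)" for x
  proof -
    have "uniform_discrete (shift x L \<inter> cball 0 R)"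
      using delone uniform_discrete_shift[of L x] by (auto simp: delone_def)
    then show ?thesis using uniform_discrete_finite_iff by (metis bounded_Int bounded_cball)
  qed
  moreover have "finite (patches (cball 0 R) L)" using flc by (simp add: finite_local_complexity_def)
  ultimately show "finite (\<Union>(patches (cball 0 R) L))" by (intro finite_Union) (auto simp: patches_def)
  fix x p q assume x: "x \<in> \<Omega>" "p \<in> x" "q \<in> x" "norm (q - p) \<le> R"
  obtain p' where p': "p' \<in> L" "\<And>w. norm w \<le> R \<Longrightarrow> p + w \<in> x \<longleftrightarrow> p' + w \<in> L"
    using delone_hull_lookup[OF x(1,2), of R] by blast
  have "q - p \<in> shift p' L \<inter> cball 0 R" using p'(2)[OF x(4)] x by (simp add: add.commute)
  then show "q - p \<in> \<Union>(patches (cball 0 R) L)" using p'(1) unfolding patches_def by blast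
qed

text \<open>\<open>T\<close> comes from repetitivity of \<open>L\<close>: the part of
  \<open>x\<close> to be searched occurs somewhere in \<open>L\<close>. Hence one \<open>T\<close>
  serves all elements of the hull and all centres.\<close>

lemma hull_repetitive:
  assumes z: "z \<in> \<Omega>" "a \<in> z"
  obtains T where "T > 0" "\<And>x c. x \<in> \<Omega> \<Longrightarrow> \<exists>b\<in>x. dist c b \<le> T \<and> (\<forall>w. norm w \<le> R \<longrightarrow> (b + w \<in> x \<longleftrightarrow> a + w \<in> z))"
proof -
  \<comment> \<open>A nonnegative radius puts 0 into the patch, and repetitivity speaks of nonempty
    patches.\<close>
  define R' where "R' = max R 0"
  obtain p where p: "p \<in> L" "\<And>w. norm w \<le> R' \<Longrightarrow> a + w \<in> z \<longleftrightarrow> p + w \<in> L"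
    using delone_hull_lookup[OF z, of R'] by blast
  define P where "P = shift p L \<inter> cball 0 R'"
  have "0 \<in> P" using p(1) by (simp add: P_def R'_def)
  moreover have "P \<in> patches (cball 0 R') L" using p(1) by (auto simp: P_def patches_def)
  ultimately have "relatively_dense (occurrences (cball 0 R') P L)"
    using repetitive compact_cball unfolding repetitive_def by blast
  then obtain T where T: "T > 0" "\<And>c. \<exists>y\<in>occurrences (cball 0 R') P L. dist c y \<le> T"
    by (auto simp: relatively_dense_def)
  have "\<exists>b\<in>x. dist c b \<le> T \<and> (\<forall>w. norm w \<le> R \<longrightarrow> (b + w \<in> x \<longleftrightarrow> a + w \<in> z))" if x: "x \<in> \<Omega>" for x c
  proof -
    obtain p' where p': "p' \<in> x" using hull_nonempty[OF x] by blast
    obtain q where q: "q \<in> L" "\<And>w. norm w \<le> norm (c - p') + T + R' \<Longrightarrow> p' + w \<in> x \<longleftrightarrow> q + w \<in> L"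
      using delone_hull_lookup[OF x p', of "norm (c - p') + T + R'"] by blast
    obtain y where y: "y \<in> L" "shift y L \<inter> cball 0 R' = P" "dist (q + (c - p')) y \<le> T"
      using T(2)[of "q + (c - p')"] by (auto simp: occurrences_def)
    have ny: "norm (y - q) \<le> norm (c - p') + T"
      using norm_triangle_ineq4[of "c - p'" "(q + (c - p')) - y"] y(3) by (simp add: dist_norm algebra_simps)
    define b where "b = p' + (y - q)"
    have "b \<in> x" using q(2)[of "y - q"] ny y(1) by (simp add: b_def R'_def)
    moreover have "dist c b \<le> T" using y(3) by (simp add: b_def dist_norm algebra_simps)
    moreover have "b + w \<in> x \<longleftrightarrow> a + w \<in> z" if w: "norm w \<le> R" for w
    proof -
      have wR: "norm w \<le> R'" using w by (simp add: R'_def)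
      have "b + w \<in> x \<longleftrightarrow> q + (y - q + w) \<in> L"
        using q(2)[of "y - q + w"] ny wR norm_triangle_ineq[of "y - q" w] by (simp add: b_def algebra_simps)
      also have "\<dots> \<longleftrightarrow> w \<in> P" using wR y(2) by (auto simp: algebra_simps)
      also have "\<dots> \<longleftrightarrow> p + w \<in> L" using wR by (simp add: P_def add.commute)
      also have "\<dots> \<longleftrightarrow> a + w \<in> z" using p(2)[OF wR] by simp
      finally show ?thesis .
    qed
    ultimately show ?thesis by blast
  qed
  then show ?thesis using that T(1) by blast
qed

text \<open>Minimality in quantitative form. The bound on the translation is independent of
  \<open>x\<close>, which will make continuity of eigenfunctions uniform on the hull.\<close>

lemma return_translations:
  assumes z: "z \<in> \<Omega>" and e: "\<epsilon> > 0"
  obtains T where "T > 0" "\<And>x. x \<in> \<Omega> \<Longrightarrow> \<exists>t. norm t \<le> T \<and> near \<epsilon> z (shift t x)"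
proof -
  obtain a where a: "a \<in> z" using hull_nonempty[OF z] by blast
  obtain T where T: "T > 0" "\<And>x c. x \<in> \<Omega> \<Longrightarrow> \<exists>b\<in>x. dist c b \<le> T \<and>
     (\<forall>w. norm w \<le> 1 / \<epsilon> + norm a \<longrightarrow> (b + w \<in> x \<longleftrightarrow> a + w \<in> z))"
    using hull_repetitive[OF z a, of "1 / \<epsilon> + norm a"] by blast
  have "\<exists>t. norm t \<le> T + norm a \<and> near \<epsilon> z (shift t x)" if x: "x \<in> \<Omega>" for x
  proof -
    obtain b where b: "b \<in> x" "dist 0 b \<le> T" "\<And>w. norm w \<le> 1 / \<epsilon> + norm a \<Longrightarrow> b + w \<in> x \<longleftrightarrow> a + w \<in> z"
      using T(2)[OF x, of 0] by blast
    have "w \<in> z \<longleftrightarrow> w + 0 \<in> shift (b - a) x" if "norm w < 1 / \<epsilon>" for w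
      using b(3)[of "w - a"] norm_triangle_ineq4[of w a] that by (simp add: algebra_simps)
    then have "near \<epsilon> z (shift (b - a) x)" unfolding near_def using e by (intro exI[of _ 0]) auto
    moreover have "norm (b - a) \<le> T + norm a" using norm_triangle_ineq4[of b a] b(2) by (simp add: dist_norm)
    ultimately show ?thesis by blast
  qed
  then show ?thesis using that[of "T + norm a"] T(1) by (simp add: add_pos_nonneg)
qed

lemma eigenfunction_near:
  assumes f: "continuous_map (hull_topology L) euclidean (f :: _ \<Rightarrow> complex)" and z: "z \<in> \<Omega>" and e: "e > 0"
  shows "\<exists>\<epsilon>>0. \<forall>x\<in>\<Omega>. near \<epsilon> z x \<longrightarrow> norm (f z - f x) < e"
proof -
  have "openin (hull_topology L) {x \<in> topspace (hull_topology L). f x \<in> ball (f z) e}"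
    by (rule openin_continuous_map_preimage[OF f]) simp
  then show ?thesis using z e unfolding openin_hull_near topspace_hull_topology
    by (auto simp: dist_norm)
qed

text \<open>The norm of \<open>f\<close> is continuous and constant on orbits, and every orbit comes
  near every point.\<close>

lemma eigenfunction_norm_const:
  assumes f: "continuous_map (hull_topology L) euclidean f"
    and eig: "\<And>t x. x \<in> \<Omega> \<Longrightarrow> f (shift t x) = \<eta> t * f x" and \<eta>: "\<And>t. norm (\<eta> t) = 1"
    and x: "x \<in> \<Omega>" "y \<in> \<Omega>"
  shows "norm (f x :: complex) = norm (f y)"
proof (rule ccontr)
  assume "norm (f x) \<noteq> norm (f y)"
  then have e: "\<bar>norm (f x) - norm (f y)\<bar> > 0" by simp
  obtain \<epsilon> where \<epsilon>: "\<epsilon> > 0" "\<And>z. z \<in> \<Omega> \<Longrightarrow> near \<epsilon> x z \<Longrightarrow> norm (f x - f z) < \<bar>norm (f x) - norm (f y)\<bar>"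
    using eigenfunction_near[OF f x(1) e] by blast
  obtain t where t: "near \<epsilon> x (shift t y)" using return_translations[OF x(1) \<epsilon>(1)] x(2) by blast
  have "norm (f x - f (shift t y)) < \<bar>norm (f x) - norm (f y)\<bar>" using \<epsilon>(2) t shift_in_delone_hull[OF x(2)] by blast
  moreover have "norm (f (shift t y)) = norm (f y)" using eig[OF x(2)] \<eta> by (simp add: norm_mult)
  ultimately show False using norm_triangle_ineq3[of "f x" "f (shift t y)"] by simp
qed

text \<open>
  Two elements of the hull that agree on a large ball have translates by a common small vector that
  are both close to \<open>L\<close>; so continuity at \<open>L\<close> suffices.
\<close>

lemma eigenfunction_uniformly_continuous:
  assumes f: "continuous_map (hull_topology L) euclidean f"
    and eig: "\<And>t x. x \<in> \<Omega> \<Longrightarrow> f (shift t x) = \<eta> t * f x" and \<eta>: "\<And>t. norm (\<eta> t) = 1"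
    and e: "e > 0"
  obtains \<epsilon> where "\<epsilon> > 0" "\<And>x y. x \<in> \<Omega> \<Longrightarrow> y \<in> \<Omega> \<Longrightarrow> near \<epsilon> x y \<Longrightarrow> norm (f x - f y :: complex) < e"
proof -
  obtain \<delta>0 where \<delta>0: "\<delta>0 > 0" "\<And>z. z \<in> \<Omega> \<Longrightarrow> near \<delta>0 L z \<Longrightarrow> norm (f L - f z) < e / 2"
    using eigenfunction_near[OF f L_in, of "e / 2"] e by auto
  define \<delta> where "\<delta> = min (\<delta>0 / 2) (1 / 2)"
  have \<delta>: "\<delta> > 0" "\<delta> \<le> 1 / 2" "2 * \<delta> \<le> \<delta>0" using \<delta>0(1) by (auto simp: \<delta>_def)
  obtain T where T: "T > 0" "\<And>x. x \<in> \<Omega> \<Longrightarrow> \<exists>t. norm t \<le> T \<and> near \<delta> L (shift t x)"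
    using return_translations[OF L_in \<delta>(1)] by blast
  \<comment> \<open>Leaves a window of radius \<open>1 / \<delta>\<close> after the origin has moved
    by at most \<open>T\<close>.\<close>
  define \<epsilon> where "\<epsilon> = 1 / (1 / \<delta> + T)"
  have pos: "1 / \<delta> + T > 0" using \<delta> T by (simp add: add_pos_pos)
  have \<epsilon>: "\<epsilon> > 0" "1 / \<delta> + T \<le> 1 / \<epsilon>" using pos by (auto simp: \<epsilon>_def)
  have "\<epsilon> \<le> 1 / (1 / \<delta>)" unfolding \<epsilon>_def using \<delta>(1) T(1) pos by (intro divide_left_mono mult_pos_pos) auto
  then have \<epsilon>\<delta>: "\<epsilon> \<le> \<delta>" by simp
  have "norm (f x - f y) < e" if xy: "x \<in> \<Omega>" "y \<in> \<Omega>" "near \<epsilon> x y" for x y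
  proof -
    obtain t where t: "norm t \<le> T" "near \<delta> L (shift t x)" using T(2)[OF xy(1)] by blast
    have "near \<delta> (shift t x) (shift t y)" by (rule near_shift[OF xy(3) t(1) \<epsilon>(2) \<epsilon>\<delta>])
    then have "near \<delta>0 L (shift t y)" using near_mono[OF near_trans[OF t(2) _ \<delta>(1,2)] _ \<delta>(3)] \<delta>(1) by simp
    moreover have "near \<delta>0 L (shift t x)" using near_mono[OF t(2) \<delta>(1)] \<delta> by simp
    ultimately have "norm (f L - f (shift t x)) < e / 2" "norm (f L - f (shift t y)) < e / 2"
      using \<delta>0(2) shift_in_delone_hull xy by blast+
    then have "norm (f (shift t x) - f (shift t y)) < e"
      using norm_triangle_ineq4[of "f L - f (shift t y)" "f L - f (shift t x)"] by simp
    moreover have "f (shift t x) - f (shift t y) = \<eta> t * (f x - f y)"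
      using eig xy by (simp add: right_diff_distrib)
    ultimately show ?thesis using \<eta>[of t] by (simp add: norm_mult)
  qed
  then show ?thesis using that \<epsilon>(1) by blast
qed

text \<open>Recentred at points near the origin, the sets show patches of \<open>L\<close>, finitely
  many for each window, and a diagonal subsequence becomes constant on every ball. The recentring
  vectors converge as well, and their error is the vector in \<open>near\<close>.\<close>

lemma hull_sequentially_compact:
  assumes z: "\<And>n. z n \<in> \<Omega>"
  obtains r y where "strict_mono (r :: nat \<Rightarrow> nat)" "y \<in> \<Omega>" "\<And>\<epsilon>. \<epsilon> > 0 \<Longrightarrow> \<forall>\<^sub>F n in sequentially. near \<epsilon> y (z (r n))"
proof -
  have "\<exists>p. p \<in> z n \<and> norm p \<le> rad" for n using hull_rad[OF z[of n], of 0] by auto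
  then obtain p where p: "\<And>n. p n \<in> z n" "\<And>n. norm (p n) \<le> rad" by metis
  have "\<forall>n. p n \<in> cball 0 rad" using p(2) by simp
  then obtain p0 r0 where r0: "strict_mono (r0 :: nat \<Rightarrow> nat)" "(p \<circ> r0) \<longlonglongrightarrow> p0"
    using compact_cball[of 0 rad] unfolding compact_def by blast
  define Z where "Z n = shift (p (r0 n)) (z (r0 n))" for n
  define P where "P m s \<longleftrightarrow> (\<exists>c. \<forall>n. Z (s n) \<inter> cball 0 (real m) = c)" for m and s :: "nat \<Rightarrow> nat"
  interpret subseqs P
  proof
    fix m and s :: "nat \<Rightarrow> nat" assume "strict_mono s"
    have "range (\<lambda>n. Z (s n) \<inter> cball 0 (real m)) \<subseteq> patches (cball 0 (real m)) L"
    proof safe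
      fix n
      have "Z (s n) \<inter> cball 0 (real m) \<in> patches (cball 0 (real m)) (z (r0 (s n)))"
        using p(1) by (auto simp: Z_def patches_def)
      then show "Z (s n) \<inter> cball 0 (real m) \<in> patches (cball 0 (real m)) L"
        using z[of "r0 (s n)"] compact_cball[of 0 "real m"] unfolding delone_hull_def by blast
    qed
    moreover have "finite (patches (cball 0 (real m)) L)" using flc by (simp add: finite_local_complexity_def)
    ultimately have "finite (range (\<lambda>n. Z (s n) \<inter> cball 0 (real m)))" by (rule finite_subset)
    then obtain c where "infinite {n. Z (s n) \<inter> cball 0 (real m) = c}"
      using pigeonhole_infinite[of UNIV "\<lambda>n. Z (s n) \<inter> cball 0 (real m)"] by auto
    then obtain r' where "strict_mono (r' :: nat \<Rightarrow> nat)" "\<And>n. Z (s (r' n)) \<inter> cball 0 (real m) = c"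
      using infinite_enumerate by blast
    then show "\<exists>r'. strict_mono r' \<and> P m (s \<circ> r')" by (auto simp: P_def)
  qed
  have "P m (diagseq \<circ> (+) (Suc m))" for m
    by (rule diagseq_holds) (auto simp: P_def)
  then have "\<exists>c. \<forall>n. Z (diagseq (Suc m + n)) \<inter> cball 0 (real m) = c" for m by (simp add: P_def)
  then obtain c where c: "\<And>m n. Z (diagseq (Suc m + n)) \<inter> cball 0 (real m) = c m" by metis
  define Y where "Y n = Z (diagseq n)" for n
  \<comment> \<open>The diagonal subsequence is known to be constant on the ball of radius
    \<open>m\<close> only beyond index \<open>m\<close>, whence \<open>n > m\<close>.\<close>
  have Yc: "w \<in> Y n \<longleftrightarrow> w \<in> c m" if "norm w \<le> real m" "n > m" for w n m
  proof -
    have n: "Suc m + (n - Suc m) = n" using that by simp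
    have "Z (diagseq (Suc m + (n - Suc m))) \<inter> cball 0 (real m) = c m" by (rule c)
    then have "Y n \<inter> cball 0 (real m) = c m" unfolding n Y_def .
    then have "w \<in> Y n \<inter> cball 0 (real m) \<longleftrightarrow> w \<in> c m" by (rule arg_cong)
    then show ?thesis using that(1) by simp
  qed
  have Y: "Y n \<in> \<Omega>" "0 \<in> Y n" for n
    unfolding Y_def Z_def using p(1) by (auto intro: shift_in_delone_hull[OF z])
  define y0 where "y0 = {w. \<exists>m. norm w \<le> real m \<and> w \<in> c m}"
  have y0: "w \<in> y0 \<longleftrightarrow> w \<in> Y n" if w: "norm w \<le> real m" "n > m" for w n m
  proof
    assume "w \<in> y0"
    then obtain m' where m': "norm w \<le> real m'" "w \<in> c m'" by (auto simp: y0_def)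
    define k where "k = Suc (m + m')"
    have "w \<in> Y k" using Yc[OF m'(1), of k] m'(2) by (simp add: k_def)
    then show "w \<in> Y n" using Yc[OF w(1), of k] Yc[OF w] by (simp add: k_def)
  qed (use Yc[OF w] w in \<open>auto simp: y0_def\<close>)
  have nat_bound: "\<exists>m. R \<le> real m" for R by (rule real_arch_simple)
  have "y0 \<in> \<Omega>"
  proof (rule delone_hullI)
    have "uniform_discrete y0"
      unfolding uniform_discrete_def
    proof (intro exI[of _ sep] conjI sep(1) ballI impI)
      fix a b assume ab: "a \<in> y0" "b \<in> y0" "dist a b < sep"
      obtain m where "max (norm a) (norm b) \<le> real m" using nat_bound by blast
      then have "a \<in> Y (Suc m)" "b \<in> Y (Suc m)" using y0[of a m "Suc m"] y0[of b m "Suc m"] ab by auto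
      then show "a = b" using hull_sep[OF Y(1)] ab(3) by blast
    qed
    moreover have "\<exists>a\<in>y0. dist x a \<le> rad" for x
    proof -
      obtain m where m: "norm x + rad \<le> real m" using nat_bound by blast
      obtain a where a: "a \<in> Y (Suc m)" "dist x a \<le> rad" using hull_rad[OF Y(1)] by blast
      have "norm a \<le> norm x + rad" using norm_triangle_ineq4[of x "x - a"] a(2) by (simp add: dist_norm)
      then have "a \<in> y0" using y0[of a m "Suc m"] a(1) m by auto
      then show ?thesis using a(2) by blast
    qed
    ultimately show "delone y0" using rad(1) by (auto simp: delone_def relatively_dense_def)
    fix a R assume a: "a \<in> y0"
    obtain m where m: "norm a + max R 0 \<le> real m" using nat_bound by blast
    have "a \<in> Y (Suc m)" using y0[of a m "Suc m"] a m by auto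
    then obtain q where q: "q \<in> L" "\<And>w. norm w \<le> R \<Longrightarrow> a + w \<in> Y (Suc m) \<longleftrightarrow> q + w \<in> L"
      using delone_hull_lookup[OF Y(1)] by metis
    have "a + w \<in> y0 \<longleftrightarrow> q + w \<in> L" if "norm w \<le> R" for w
      using y0[of "a + w" m "Suc m"] q(2)[OF that] norm_triangle_ineq[of a w] m that by auto
    then show "\<exists>q\<in>L. \<forall>w. norm w \<le> R \<longrightarrow> (a + w \<in> y0 \<longleftrightarrow> q + w \<in> L)" using q(1) by blast
  qed
  then have y_in: "shift (- p0) y0 \<in> \<Omega>" by (rule shift_in_delone_hull)
  define r where "r = r0 \<circ> diagseq"
  have r: "strict_mono r" unfolding r_def using r0(1) subseq_diagseq by (rule strict_mono_o)
  have plim: "(\<lambda>n. p (r n)) \<longlonglongrightarrow> p0"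
    using LIMSEQ_subseq_LIMSEQ[OF r0(2) subseq_diagseq] by (simp add: r_def o_def)
  have "\<forall>\<^sub>F n in sequentially. near \<epsilon> (shift (- p0) y0) (z (r n))" if e: "\<epsilon> > 0" for \<epsilon>
  proof -
    obtain m where m: "1 / \<epsilon> + norm p0 \<le> real m" using nat_bound by blast
    have "\<forall>\<^sub>F n in sequentially. dist (p (r n)) p0 < \<epsilon>" using plim e by (rule tendstoD)
    then show ?thesis using eventually_gt_at_top[of m]
    proof eventually_elim
      case (elim n)
      have "w \<in> shift (- p0) y0 \<longleftrightarrow> w + (p (r n) - p0) \<in> z (r n)" if "norm w < 1 / \<epsilon>" for w
      proof -
        have "norm (w - p0) \<le> real m" using norm_triangle_ineq4[of w p0] that m by simp
        then have "w - p0 \<in> y0 \<longleftrightarrow> w - p0 \<in> Y n" using y0 elim(2) by blast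
        then show ?thesis by (simp add: Y_def Z_def r_def algebra_simps)
      qed
      then show ?case using elim(1) by (auto simp: near_def dist_norm)
    qed
  qed
  then show ?thesis using that[OF r y_in] by blast
qed

end

section \<open>Periods and topological eigenvalues\<close>

lemma near_refl: "\<epsilon> > 0 \<Longrightarrow> near \<epsilon> x x"
  unfolding near_def by (intro exI[of _ 0]) auto

text \<open>The hypothesis \<open>near\<close> makes the set under the infimum nonempty.\<close>

lemma delone_dist_nonneg:
  assumes "near \<epsilon> x y" "\<epsilon> > 0"
  shows "delone_dist x y \<ge> 0"
  unfolding delone_dist_def
proof (rule cInf_greatest)
  obtain v where v: "norm v < \<epsilon>" "\<And>w. norm w < 1 / \<epsilon> \<Longrightarrow> w \<in> x \<longleftrightarrow> w + v \<in> y"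
    using assms(1) by (auto simp: near_def)
  then have "shift 0 x \<inter> ball 0 (1 / \<epsilon>) = shift v y \<inter> ball 0 (1 / \<epsilon>)" by auto
  moreover have "0 \<in> ball 0 \<epsilon>" "v \<in> ball 0 \<epsilon>" using v(1) assms(2) by auto
  ultimately show "{\<epsilon> / (\<epsilon> + 1) |\<epsilon>. \<epsilon> > 0 \<and> (\<exists>t\<in>ball 0 \<epsilon>. \<exists>t'\<in>ball 0 \<epsilon>.
        shift t x \<inter> ball 0 (1/\<epsilon>) = shift t' y \<inter> ball 0 (1/\<epsilon>))} \<noteq> {}"
    using assms(2) by blast
qed auto

lemma delone_dist_commute: "delone_dist x y = delone_dist y x"
  unfolding delone_dist_def
  by (rule arg_cong[of _ _ Inf], rule Collect_cong) (metis (lifting))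

lemma delone_dist_self [simp]: "delone_dist y y = 0"
proof (rule antisym)
  show "delone_dist y y \<le> 0"
  proof (rule field_le_epsilon)
    fix e :: real assume e: "e > 0"
    have "delone_dist y y \<le> e / (e + 1)" by (rule delone_dist_le[OF near_refl[OF e] e])
    also have "\<dots> \<le> e" using e by (simp add: divide_le_eq)
    finally show "delone_dist y y \<le> 0 + e" by simp
  qed
  show "delone_dist y y \<ge> 0" using delone_dist_nonneg[OF near_refl[of 1 y]] by simp
qed

lemma proximal_self: "proximal delone_dist \<alpha> x x"
  by (simp add: proximal_def)

text \<open>Agreement up to a small translation is exact agreement, by finite local complexity.\<close>

lemma (in repetitive_delone) proximal_imp_period:
  assumes x: "x \<in> \<Omega>" and prox: "proximal delone_dist shift x (shift s x)"
  shows "shift s L = L"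
proof -
  have ex_near: "\<exists>z\<in>\<Omega>. near (2 * \<epsilon>) z (shift s z)" if e: "0 < \<epsilon>" "\<epsilon> \<le> 1 / 2" for \<epsilon>
  proof -
    have "(INF t. delone_dist (shift t x) (shift t (shift s x))) < \<epsilon> / (\<epsilon> + 1)"
      using prox e by (simp add: proximal_def)
    then obtain t where t: "delone_dist (shift t x) (shift t (shift s x)) < \<epsilon> / (\<epsilon> + 1)"
      using cInf_lessD[of "range (\<lambda>t. delone_dist (shift t x) (shift t (shift s x)))"] by blast
    have "shift t (shift s x) = shift s (shift t x)" by (simp add: shift_shift add.commute)
    then have "near (2 * \<epsilon>) (shift t x) (shift s (shift t x))"
      using near_of_delone_dist[OF t e] x shift_in_delone_hull delone_hull_uniform_discrete by metis
    then show ?thesis using shift_in_delone_hull[OF x] by blast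
  qed
  obtain D where D: "finite D" "\<And>x p q. x \<in> \<Omega> \<Longrightarrow> p \<in> x \<Longrightarrow> q \<in> x \<Longrightarrow> norm (q - p) \<le> norm s + 1 \<Longrightarrow> q - p \<in> D"
    using finite_differences[of "norm s + 1"] by blast
  \<comment> \<open>An element of \<open>D\<close> close enough to \<open>s\<close> is
    \<open>s\<close> itself. This will remove the small translation left over by
    \<open>near\<close>.\<close>
  obtain \<delta> where \<delta>: "\<delta> > 0" "\<And>d. d \<in> D \<Longrightarrow> d \<noteq> s \<Longrightarrow> \<delta> \<le> dist s d"
    using finite_set_avoid[OF D(1)] by metis
  obtain p where p: "p \<in> L" using hull_nonempty[OF L_in] by blast
  have period: "u \<in> L \<longleftrightarrow> u + s \<in> L" for u
  proof -
    define R where "R = norm (u - p) + norm s"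
    obtain T where T: "T > 0" "\<And>x c. x \<in> \<Omega> \<Longrightarrow> \<exists>b\<in>x. dist c b \<le> T \<and> (\<forall>w. norm w \<le> R \<longrightarrow> (b + w \<in> x \<longleftrightarrow> p + w \<in> L))"
      using hull_repetitive[OF L_in p, of R] by blast
    \<comment> \<open>The window must hold a point within \<open>rad\<close> of the origin, which
      forces the translation to vanish, and a copy, found within \<open>T\<close>, of the part of
      \<open>L\<close> around \<open>p\<close> containing the places \<open>u\<close> and
      \<open>u + s\<close>.\<close>
    define M where "M = T + R + rad + 1"
    have M: "M > 0" using T rad by (simp add: M_def R_def add_pos_nonneg)
    define \<epsilon> where "\<epsilon> = min (min 1 \<delta>) (1 / M)"
    have e: "\<epsilon> > 0" "\<epsilon> \<le> 1" "\<epsilon> \<le> \<delta>" using \<delta> M by (auto simp: \<epsilon>_def)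
    have "\<epsilon> \<le> 1 / M" by (simp add: \<epsilon>_def)
    then have "M \<le> 1 / \<epsilon>" using e M by (simp add: field_simps)
    obtain z where z: "z \<in> \<Omega>" "near \<epsilon> z (shift s z)" using ex_near[of "\<epsilon> / 2"] e by auto
    obtain v where v: "norm v < \<epsilon>" "\<And>w. norm w < 1 / \<epsilon> \<Longrightarrow> w \<in> z \<longleftrightarrow> w + v + s \<in> z"
      using z(2) by (auto simp: near_def)
    obtain a where a: "a \<in> z" "norm a \<le> rad" using hull_rad[OF z(1), of 0] by auto
    have "norm a < 1 / \<epsilon>"
      using a(2) \<open>M \<le> 1 / \<epsilon>\<close> T(1) norm_ge_zero[of "u - p"] norm_ge_zero[of s] unfolding M_def R_def by linarith
    then have "a + v + s \<in> z" using v(2) a(1) by blast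
    moreover have "norm ((a + v + s) - a) \<le> norm s + 1"
      using norm_triangle_ineq[of v s] v(1) e(2) by (simp add: algebra_simps)
    ultimately have "(a + v + s) - a \<in> D" by (rule D(2)[OF z(1) a(1)])
    moreover have "dist s ((a + v + s) - a) < \<delta>" using v(1) e(3) by (simp add: dist_norm)
    ultimately have "(a + v + s) - a = s" using \<delta>(2) by force
    then have "v = 0" by simp
    obtain b where b: "b \<in> z" "dist 0 b \<le> T" "\<And>w. norm w \<le> R \<Longrightarrow> b + w \<in> z \<longleftrightarrow> p + w \<in> L"
      using T(2)[OF z(1), of 0] by blast
    have "norm (b + (u - p)) < 1 / \<epsilon>"
    proof -
      have "norm b \<le> T" using b(2) by simp
      then show ?thesis
        using norm_triangle_ineq[of b "u - p"] \<open>M \<le> 1 / \<epsilon>\<close> rad(1) norm_ge_zero[of s]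
        unfolding M_def R_def by linarith
    qed
    then have "b + (u - p) \<in> z \<longleftrightarrow> b + (u - p) + s \<in> z" using v(2) \<open>v = 0\<close> by simp
    moreover have "b + (u - p) \<in> z \<longleftrightarrow> u \<in> L" using b(3)[of "u - p"] by (simp add: R_def)
    moreover have "b + (u - p) + s \<in> z \<longleftrightarrow> u + s \<in> L"
      using b(3)[of "u - p + s"] norm_triangle_ineq[of "u - p" s] by (simp add: R_def algebra_simps)
    ultimately show ?thesis by simp
  qed
  show ?thesis
    by (rule Set.set_eqI) (simp only: mem_shift period[symmetric])
qed

lemma continuous_map_from_uniformly_continuous:
  fixes F :: "'y \<Rightarrow> complex"
  assumes "Metric_space Y d"
    and uc: "\<And>e. e > 0 \<Longrightarrow> \<exists>\<delta>>0. \<forall>x\<in>Y. \<forall>y\<in>Y. d x y < \<delta> \<longrightarrow> norm (F x - F y) < e"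
  shows "continuous_map (Metric_space.mtopology Y d) euclidean F"
proof -
  interpret Metric_space Y d by fact
  show ?thesis
    unfolding continuous_map_def
  proof (intro conjI allI impI)
    fix U :: "complex set" assume "openin euclidean U"
    then have U: "open U" by simp
    show "openin mtopology {x \<in> topspace mtopology. F x \<in> U}"
      unfolding openin_mtopology
    proof (intro conjI allI impI)
      fix x assume x: "x \<in> {x \<in> topspace mtopology. F x \<in> U}"
      then obtain e where e: "e > 0" "ball (F x) e \<subseteq> U" using U openE by blast
      obtain \<delta> where \<delta>: "\<delta> > 0" "\<And>x y. x \<in> Y \<Longrightarrow> y \<in> Y \<Longrightarrow> d x y < \<delta> \<Longrightarrow> norm (F x - F y) < e"
        using uc[OF e(1)] by blast
      have "mball x \<delta> \<subseteq> {x \<in> topspace mtopology. F x \<in> U}"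
      proof
        fix y assume "y \<in> mball x \<delta>"
        then have "x \<in> Y" "y \<in> Y" "d x y < \<delta>" by (auto simp: in_mball)
        then show "y \<in> {x \<in> topspace mtopology. F x \<in> U}"
          using \<delta>(2)[of x y] e(2) by (auto simp: dist_norm subset_iff)
      qed
      then show "\<exists>r>0. mball x r \<subseteq> {x \<in> topspace mtopology. F x \<in> U}" using \<delta>(1) by blast
    qed auto
  qed auto
qed

lemma continuous_map_complex_mult:
  fixes f g :: "'a \<Rightarrow> complex"
  assumes "continuous_map X euclidean f" "continuous_map X euclidean g"
  shows "continuous_map X euclidean (\<lambda>x. f x * g x)"
proof -
  have "continuous_map X euclidean (\<lambda>x. (f x, g x))"
    unfolding prod_topology_euclidean[symmetric] by (intro continuous_map_pairedI assms)
  moreover have "continuous_map euclidean euclidean (\<lambda>z :: complex \<times> complex. fst z * snd z)"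
    by (simp add: continuous_intros)
  ultimately have "continuous_map X euclidean ((\<lambda>z. fst z * snd z) \<circ> (\<lambda>x. (f x, g x)))"
    by (rule continuous_map_compose)
  then show ?thesis by (simp add: o_def)
qed

section \<open>The group of topological eigenvalues\<close>

context repetitive_delone
begin

abbreviation eigenvalues :: "(real^'n \<Rightarrow> complex) set" where
  "eigenvalues \<equiv> topological_eigenvalues (hull_topology L) shift"

text \<open>Minimality makes the norm of an eigenfunction constant, so it can be divided out.
  Unimodular eigenfunctions stay nonzero under products and conjugation.\<close>

lemma eigenvalue_obtain:
  assumes "\<eta> \<in> eigenvalues"
  obtains f where "continuous_map (hull_topology L) euclidean f"
    "\<And>t x. x \<in> \<Omega> \<Longrightarrow> f (shift t x) = \<eta> t * f x" "\<And>x. x \<in> \<Omega> \<Longrightarrow> norm (f x) = 1" "\<eta> \<in> carrier dual_group"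
proof -
  have \<eta>: "\<eta> \<in> carrier dual_group" using assms by (simp add: topological_eigenvalues_def)
  then have norm: "norm (\<eta> t) = 1" for t by (simp add: dual_group_def)
  obtain f x0 where f: "continuous_map (hull_topology L) euclidean f" "x0 \<in> \<Omega>" "f x0 \<noteq> 0"
    "\<And>t x. x \<in> \<Omega> \<Longrightarrow> f (shift t x) = \<eta> t * f x"
    using assms by (auto simp: topological_eigenvalues_def topspace_hull_topology)
  define c where "c = norm (f x0)"
  have c: "c > 0" using f(3) by (simp add: c_def)
  have "norm (f x) = c" if "x \<in> \<Omega>" for x
    unfolding c_def using eigenfunction_norm_const[OF f(1,4) norm that f(2)] .
  moreover have "continuous_map (hull_topology L) euclidean (\<lambda>x. f x * complex_of_real (1 / c))"
    by (intro continuous_map_complex_mult f(1)) auto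
  ultimately show ?thesis
    using c f(4) \<eta> by (intro that[of "\<lambda>x. f x * complex_of_real (1 / c)"]) (auto simp: norm_mult norm_divide)
qed

lemma eigenvalues_subgroup: "subgroup eigenvalues dual_group"
proof
  show "eigenvalues \<subseteq> carrier dual_group" by (auto simp: topological_eigenvalues_def)
next
  fix \<eta> \<psi> assume "\<eta> \<in> eigenvalues" "\<psi> \<in> eigenvalues"
  then obtain f g where f: "continuous_map (hull_topology L) euclidean f"
    "\<And>t x. x \<in> \<Omega> \<Longrightarrow> f (shift t x) = \<eta> t * f x" "\<And>x. x \<in> \<Omega> \<Longrightarrow> norm (f x) = 1" "\<eta> \<in> carrier dual_group"
    and g: "continuous_map (hull_topology L) euclidean g"
    "\<And>t x. x \<in> \<Omega> \<Longrightarrow> g (shift t x) = \<psi> t * g x" "\<And>x. x \<in> \<Omega> \<Longrightarrow> norm (g x) = 1" "\<psi> \<in> carrier dual_group"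
    by (metis eigenvalue_obtain)
  have "continuous_map (hull_topology L) euclidean (\<lambda>x. f x * g x)"
    by (intro continuous_map_complex_mult f g)
  moreover have "f L * g L \<noteq> 0" using f(3)[OF L_in] g(3)[OF L_in] by auto
  moreover have "\<forall>t. \<forall>x\<in>\<Omega>. f (shift t x) * g (shift t x) = (\<eta> t * \<psi> t) * (f x * g x)"
    using f(2) g(2) by (simp add: mult_ac)
  moreover have "\<eta> \<otimes>\<^bsub>dual_group\<^esub> \<psi> = (\<lambda>t. \<eta> t * \<psi> t)" by (simp add: dual_group_def)
  moreover have "\<eta> \<otimes>\<^bsub>dual_group\<^esub> \<psi> \<in> carrier dual_group"
    by (intro group.is_monoid[OF group_dual_group, THEN monoid.m_closed] f(4) g(4))
  ultimately show "\<eta> \<otimes>\<^bsub>dual_group\<^esub> \<psi> \<in> eigenvalues"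
    using L_in unfolding topological_eigenvalues_def topspace_hull_topology
    by (intro CollectI conjI exI[of _ "\<lambda>x. f x * g x"] bexI[of _ L]) auto
next
  have "continuous_map (hull_topology L) euclidean (\<lambda>x. 1 :: complex)" by simp
  then show "\<one>\<^bsub>dual_group\<^esub> \<in> eigenvalues"
    using L_in group.is_monoid[OF group_dual_group, THEN monoid.one_closed] unfolding topological_eigenvalues_def topspace_hull_topology
    by (intro CollectI conjI exI[of _ "\<lambda>x. 1"] bexI[of _ L]) (auto simp: dual_group_def)
next
  fix \<eta> assume "\<eta> \<in> eigenvalues"
  then obtain f where f: "continuous_map (hull_topology L) euclidean f"
    "\<And>t x. x \<in> \<Omega> \<Longrightarrow> f (shift t x) = \<eta> t * f x" "\<And>x. x \<in> \<Omega> \<Longrightarrow> norm (f x) = 1" "\<eta> \<in> carrier dual_group"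
    by (metis eigenvalue_obtain)
  have "continuous_map (hull_topology L) euclidean (cnj \<circ> f)"
    by (rule continuous_map_compose[OF f(1)]) (auto intro!: continuous_intros)
  then have "continuous_map (hull_topology L) euclidean (\<lambda>x. cnj (f x))" by (simp add: o_def)
  moreover have "cnj (f L) \<noteq> 0" using f(3)[OF L_in] by auto
  moreover have "inv\<^bsub>dual_group\<^esub> \<eta> \<in> carrier dual_group" by (rule group.inv_closed[OF group_dual_group f(4)])
  ultimately show "inv\<^bsub>dual_group\<^esub> \<eta> \<in> eigenvalues"
    using L_in f(2) unfolding topological_eigenvalues_def topspace_hull_topology inv_dual_group[OF f(4)]
    by (intro CollectI conjI exI[of _ "\<lambda>x. cnj (f x)"] bexI[of _ L]) auto
qed

text \<open>
  A translation \<open>s\<close> killed by all eigenvalues acts trivially on the equicontinuous factor. So the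
  translates by multiples of \<open>s\<close> of a point lie in one fibre, and by finiteness of the
  coincidence rank two of them are proximal.
\<close>

lemma eigenvalue_annihilator_period:
  fixes X\<^sub>m\<^sub>a\<^sub>x :: "'y topology"
  assumes fac: "factor_map (hull_topology L) shift X\<^sub>m\<^sub>a\<^sub>x \<beta> \<pi>" and eq: "equicontinuous X\<^sub>m\<^sub>a\<^sub>x \<beta>"
    and \<xi>: "\<xi> \<in> topspace X\<^sub>m\<^sub>a\<^sub>x" and rank: "coincidence_rank (hull_topology L) delone_dist shift \<pi> \<xi> < \<infinity>"
  obtains K where "\<And>s. (\<And>\<eta>. \<eta> \<in> eigenvalues \<Longrightarrow> \<eta> s = 1) \<Longrightarrow> \<exists>k\<in>{1..K}. shift (real k *\<^sub>R s) L = L"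
proof -
  have dyn: "dynamical_system X\<^sub>m\<^sub>a\<^sub>x \<beta>" and \<pi>: "continuous_map (hull_topology L) X\<^sub>m\<^sub>a\<^sub>x \<pi>" "\<pi> ` \<Omega> = topspace X\<^sub>m\<^sub>a\<^sub>x"
    "\<And>t x. x \<in> \<Omega> \<Longrightarrow> \<pi> (shift t x) = \<beta> t (\<pi> x)"
    using fac by (auto simp: factor_map_def topspace_hull_topology)
  obtain d where d: "Metric_space (topspace X\<^sub>m\<^sub>a\<^sub>x) d" "Metric_space.mtopology (topspace X\<^sub>m\<^sub>a\<^sub>x) d = X\<^sub>m\<^sub>a\<^sub>x"
    and eqd: "\<And>e. e > 0 \<Longrightarrow> \<exists>\<delta>>0. \<forall>x\<in>topspace X\<^sub>m\<^sub>a\<^sub>x. \<forall>y\<in>topspace X\<^sub>m\<^sub>a\<^sub>x. d x y < \<delta> \<longrightarrow> (\<forall>t. d (\<beta> t x) (\<beta> t y) < e)"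
    using eq unfolding equicontinuous_def by blast
  interpret M: Metric_space "topspace X\<^sub>m\<^sub>a\<^sub>x" d by (rule d(1))
  have joint: "continuous_map (prod_topology euclidean X\<^sub>m\<^sub>a\<^sub>x) X\<^sub>m\<^sub>a\<^sub>x (\<lambda>(t, x). \<beta> t x)"
    using dyn by (simp add: dynamical_system_def)
  have orbit: "continuous_map euclidean X\<^sub>m\<^sub>a\<^sub>x (\<lambda>t. \<beta> t y)" if "y \<in> topspace X\<^sub>m\<^sub>a\<^sub>x" for y
  proof -
    have "continuous_map euclidean (prod_topology euclidean X\<^sub>m\<^sub>a\<^sub>x) (\<lambda>t. (t, y))"
      using that by (simp add: continuous_map_paired)
    from continuous_map_compose[OF this joint] show ?thesis by (simp add: o_def)
  qed
  have closed: "\<beta> t y \<in> topspace X\<^sub>m\<^sub>a\<^sub>x" if "y \<in> topspace X\<^sub>m\<^sub>a\<^sub>x" for t y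
    using continuous_map_funspace[OF orbit[OF that]] by auto
  have act0: "\<beta> 0 y = y" if "y \<in> topspace X\<^sub>m\<^sub>a\<^sub>x" for y using dyn that by (simp add: dynamical_system_def)
  have surj: "\<exists>x\<in>\<Omega>. \<pi> x = y" if "y \<in> topspace X\<^sub>m\<^sub>a\<^sub>x" for y
    using that unfolding \<pi>(2)[symmetric] by blast
  obtain x where x: "x \<in> \<Omega>" "\<pi> x = \<xi>" using surj[OF \<xi>] by metis
  \<comment> \<open>Total boundedness comes from compactness. Density of the orbit of
    \<open>\<xi>\<close> is pulled back along \<open>\<pi>\<close> to the hull, where every orbit is
    dense.\<close>
  interpret O: equicontinuous_orbit "topspace X\<^sub>m\<^sub>a\<^sub>x" d \<beta> \<xi>
  proof
    show "M.mtotally_bounded (topspace X\<^sub>m\<^sub>a\<^sub>x)"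
      using dyn M.compact_space_eq_mcomplete_mtotally_bounded d(2) by (simp add: dynamical_system_def)
    show "\<exists>t. d y (\<beta> t \<xi>) < e" if y: "y \<in> topspace X\<^sub>m\<^sub>a\<^sub>x" and e: "e > 0" for y e
    proof -
      obtain z where z: "z \<in> \<Omega>" "\<pi> z = y" using surj[OF y] by metis
      have "openin X\<^sub>m\<^sub>a\<^sub>x (M.mball y e)" using M.openin_mball[of y e] unfolding d(2) .
      then have "openin (hull_topology L) {u \<in> \<Omega>. \<pi> u \<in> M.mball y e}"
        using openin_continuous_map_preimage[OF \<pi>(1)] by (simp add: topspace_hull_topology del: M.in_mball)
      moreover have "z \<in> {u \<in> \<Omega>. \<pi> u \<in> M.mball y e}" using z y e by simp
      ultimately obtain \<epsilon> where \<epsilon>: "\<epsilon> > 0" "\<And>u. u \<in> \<Omega> \<Longrightarrow> near \<epsilon> z u \<Longrightarrow> u \<in> {u \<in> \<Omega>. \<pi> u \<in> M.mball y e}"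
        unfolding openin_hull_near by blast
      obtain t where "near \<epsilon> z (shift t x)" using return_translations[OF z(1) \<epsilon>(1)] x(1) by blast
      then have "\<pi> (shift t x) \<in> M.mball y e" using \<epsilon>(2) shift_in_delone_hull[OF x(1)] by blast
      then show ?thesis using \<pi>(3)[OF x(1)] x(2) by (auto simp: M.in_mball)
    qed
    show "\<exists>\<delta>>0. \<forall>t. norm t < \<delta> \<longrightarrow> d y (\<beta> t y) < e" if y: "y \<in> topspace X\<^sub>m\<^sub>a\<^sub>x" and e: "e > 0" for y e
    proof -
      have "openin X\<^sub>m\<^sub>a\<^sub>x (M.mball y e)" using M.openin_mball[of y e] unfolding d(2) .
      then have "open {t. \<beta> t y \<in> M.mball y e}"
        using openin_continuous_map_preimage[OF orbit[OF y]] by (simp del: M.in_mball)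
      moreover have "0 \<in> {t. \<beta> t y \<in> M.mball y e}" using act0 y e by simp
      ultimately obtain \<delta> where "\<delta> > 0" "ball 0 \<delta> \<subseteq> {t. \<beta> t y \<in> M.mball y e}" by (meson openE)
      then show ?thesis by (intro exI[of _ \<delta>]) (auto simp: subset_iff)
    qed
  qed (use \<xi> closed act0 eqd dyn in \<open>auto simp: dynamical_system_def\<close>)
  have trivial: "\<beta> s \<xi> = \<xi>" if s: "\<And>\<eta>. \<eta> \<in> eigenvalues \<Longrightarrow> \<eta> s = 1" for s
  proof (rule ccontr)
    assume "\<beta> s \<xi> \<noteq> \<xi>"
    then obtain F \<gamma> where F: "\<gamma> \<in> carrier dual_group" "\<And>t y. y \<in> topspace X\<^sub>m\<^sub>a\<^sub>x \<Longrightarrow> F (\<beta> t y) = \<gamma> t * F y"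
      "\<And>e. e > 0 \<Longrightarrow> \<exists>\<delta>>0. \<forall>x\<in>topspace X\<^sub>m\<^sub>a\<^sub>x. \<forall>y\<in>topspace X\<^sub>m\<^sub>a\<^sub>x. d x y < \<delta> \<longrightarrow> norm (F x - F y :: complex) < e"
      "F \<xi> \<noteq> 0" "\<gamma> s \<noteq> 1"
      by (rule O.eigenfunction_exists) blast
    have "continuous_map X\<^sub>m\<^sub>a\<^sub>x euclidean F"
      using continuous_map_from_uniformly_continuous[OF d(1) F(3)] unfolding d(2) .
    then have "continuous_map (hull_topology L) euclidean (\<lambda>x. F (\<pi> x))"
      using continuous_map_compose[OF \<pi>(1)] by (fastforce simp: o_def)
    then have "\<gamma> \<in> eigenvalues"
      using F(1,2,4) x \<pi> unfolding topological_eigenvalues_def topspace_hull_topology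
      by (intro CollectI conjI exI[of _ "\<lambda>x. F (\<pi> x)"] bexI[of _ x]) auto
    then show False using s F(5) by blast
  qed
  obtain K where K: "\<And>S. finite S \<Longrightarrow> S \<subseteq> {x \<in> \<Omega>. \<pi> x = \<xi>} \<Longrightarrow>
      pairwise (\<lambda>x y. \<not> proximal delone_dist shift x y) S \<Longrightarrow> card S \<le> K"
  proof -
    obtain K where K: "coincidence_rank (hull_topology L) delone_dist shift \<pi> \<xi> = enat K"
      using rank by (cases "coincidence_rank (hull_topology L) delone_dist shift \<pi> \<xi>") auto
    have "card S \<le> K" if "finite S" "S \<subseteq> {x \<in> \<Omega>. \<pi> x = \<xi>}" "pairwise (\<lambda>x y. \<not> proximal delone_dist shift x y) S" for S
    proof -
      have "enat (card S) \<le> coincidence_rank (hull_topology L) delone_dist shift \<pi> \<xi>"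
        unfolding coincidence_rank_def topspace_hull_topology by (rule SUP_upper) (use that in blast)
      then show ?thesis unfolding K by simp
    qed
    then show ?thesis using that by blast
  qed
  have "\<exists>k\<in>{1..K}. shift (real k *\<^sub>R s) L = L" if s: "\<And>\<eta>. \<eta> \<in> eigenvalues \<Longrightarrow> \<eta> s = 1" for s
  proof (rule ccontr)
    assume contra: "\<not> ?thesis"
    \<comment> \<open>The \<open>K + 1\<close> points with \<open>i \<le> K\<close> lie in the fibre
      over \<open>\<xi>\<close>; pairwise non-proximal, they would exceed the bound
      \<open>K\<close>.\<close>
    define u where "u i = shift (real i *\<^sub>R s) x" for i :: nat
    have uO: "u i \<in> \<Omega>" for i unfolding u_def by (rule shift_in_delone_hull[OF x(1)])
    have fix_mult: "\<beta> (real i *\<^sub>R s) \<xi> = \<xi>" for i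
    proof (induction i)
      case (Suc i)
      then show ?case using O.act_add[OF \<xi>, of s "real i *\<^sub>R s"] trivial[OF s] by (simp add: scaleR_left_distrib)
    qed (simp add: act0 \<xi>)
    have u_fibre: "\<pi> (u i) = \<xi>" for i using \<pi>(3)[OF x(1)] x(2) fix_mult by (simp add: u_def)
    have notprox: "\<not> proximal delone_dist shift (u i) (u j)" if ij: "i < j" "j \<le> K" for i j
    proof
      assume pr: "proximal delone_dist shift (u i) (u j)"
      have "u j = shift (real (j - i) *\<^sub>R s) (u i)"
        using ij by (simp add: u_def shift_shift of_nat_diff scaleR_left_distrib[symmetric])
      then have "shift (real (j - i) *\<^sub>R s) L = L" using pr proximal_imp_period[OF uO] by metis
      moreover have "j - i \<in> {1..K}" using ij by auto
      ultimately show False using contra by blast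
    qed
    have inj: "inj_on u {..K}"
    proof (rule linorder_inj_onI)
      fix i j assume "i < j" "i \<in> {..K}" "j \<in> {..K}"
      then show "u i \<noteq> u j" using notprox[of i j] proximal_self by (metis atMost_iff)
    qed auto
    have sym: "proximal delone_dist shift (u i) (u j) \<Longrightarrow> proximal delone_dist shift (u j) (u i)" for i j
      unfolding proximal_def by (simp add: delone_dist_commute)
    have "pairwise (\<lambda>x y. \<not> proximal delone_dist shift x y) (u ` {..K})"
    proof (rule pairwiseI)
      fix a b assume "a \<in> u ` {..K}" "b \<in> u ` {..K}" "a \<noteq> b"
      then obtain i j where ij: "i \<le> K" "j \<le> K" "a = u i" "b = u j" "i \<noteq> j" by auto
      then show "\<not> proximal delone_dist shift a b"
        using notprox[of i j] notprox[of j i] sym by (metis linorder_neqE_nat)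
    qed
    then have "card (u ` {..K}) \<le> K" using uO u_fibre by (intro K) auto
    then show False using card_image[OF inj] by simp
  qed
  then show ?thesis by (rule that)
qed

text \<open>If all frequencies were orthogonal to some \<open>t \<noteq> 0\<close>, all eigenvalues
  would be trivial at every multiple of \<open>t\<close>, and a bounded multiple of a tiny vector
  would be a nonzero period.\<close>

lemma eigenvalue_coordinates:
  assumes K: "\<And>s. (\<And>\<eta>. \<eta> \<in> eigenvalues \<Longrightarrow> \<eta> s = 1) \<Longrightarrow> \<exists>k\<in>{1..K}. shift (real k *\<^sub>R s) L = L"
  obtains b :: "'n \<Rightarrow> real^'n" where "\<And>i. (\<lambda>t. cis (b i \<bullet> t)) \<in> eigenvalues"
    "\<And>v. (\<And>i. b i \<bullet> v = 0) \<Longrightarrow> v = 0"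
proof -
  define H where "H = {b. (\<lambda>t. cis (b \<bullet> t)) \<in> eigenvalues}"
  have span: "span H = UNIV"
  proof (rule ccontr)
    assume "span H \<noteq> UNIV"
    then have "span H \<subset> span UNIV" by auto
    then obtain t where t: "t \<noteq> 0" "\<And>h. h \<in> H \<Longrightarrow> t \<bullet> h = 0"
      using orthogonal_to_subspace_exists_gen[of H UNIV] span_base by (metis orthogonal_def)
    have ann: "\<eta> (r *\<^sub>R t) = 1" if \<eta>: "\<eta> \<in> eigenvalues" for \<eta> r
    proof -
      have "\<eta> \<in> carrier dual_group" using \<eta> by (simp add: topological_eigenvalues_def)
      then obtain h where h: "\<eta> = (\<lambda>t. cis (h \<bullet> t))" by (rule dual_group_character)
      then have "h \<in> H" using \<eta> by (simp add: H_def)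
      then have "h \<bullet> t = 0" using t(2) by (simp add: inner_commute)
      then show ?thesis by (simp add: h)
    qed
    \<comment> \<open>Makes \<open>k\<close> times \<open>r *\<^sub>R t\<close> shorter than
      \<open>sep\<close> for all \<open>k \<le> K\<close>.\<close>
    define r where "r = sep / (2 * (real K + 1) * norm t)"
    have r: "r > 0" using sep(1) t(1) by (simp add: r_def)
    obtain k where k: "k \<in> {1..K}" "shift (real k *\<^sub>R r *\<^sub>R t) L = L" using K[of "r *\<^sub>R t"] ann by blast
    obtain p where p: "p \<in> L" using hull_nonempty[OF L_in] by blast
    have "p + real k *\<^sub>R r *\<^sub>R t \<in> L" using p k(2) mem_shift by blast
    moreover have "dist (p + real k *\<^sub>R r *\<^sub>R t) p < sep"
    proof -
      have "dist (p + real k *\<^sub>R r *\<^sub>R t) p = real k * (r * norm t)" using r by (simp add: dist_norm)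
      also have "r * norm t = sep / (2 * (real K + 1))" using t(1) by (simp add: r_def)
      also have "real k * (sep / (2 * (real K + 1))) = sep * (real k / (2 * (real K + 1)))" by simp
      also have "\<dots> < sep * 1" using k(1) sep(1) by (intro mult_strict_left_mono) auto
      finally show ?thesis by simp
    qed
    ultimately have "p + real k *\<^sub>R r *\<^sub>R t = p" using p sep(2) by blast
    then show False using k(1) r t(1) by simp
  qed
  obtain B where B: "B \<subseteq> H" "independent B" "H \<subseteq> span B" by (meson maximal_independent_subset)
  have "span B = UNIV" using span B(3) by (metis span_mono span_span top.extremum_uniqueI)
  then have "card B = CARD('n)" using dim_eq_card_independent[OF B(2)] by (metis dim_span dim_UNIV DIM_cart DIM_real mult.right_neutral)
  moreover have "finite B" using independent_bound[OF B(2)] by auto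
  ultimately obtain b where b: "bij_betw b (UNIV :: 'n set) B" using finite_same_card_bij[of "UNIV :: 'n set" B] by auto
  show ?thesis
  proof (rule that[of b])
    have "b i \<in> H" for i using b B(1) by (auto simp: bij_betw_def)
    then show "(\<lambda>t. cis (b i \<bullet> t)) \<in> eigenvalues" for i by (simp add: H_def)
    fix v assume v: "\<And>i. b i \<bullet> v = 0"
    have "x \<bullet> v = 0" if "x \<in> span B" for x
      using that
    proof (induction rule: span_induct)
      case base
      show ?case by (auto simp: subspace_def inner_add_left)
    next
      case (step x)
      then obtain i where "x = b i" using b by (auto simp: bij_betw_def)
      then show ?case using v by simp
    qed
    then have "v \<bullet> v = 0" using \<open>span B = UNIV\<close> by blast
    then show "v = 0" by simp
  qed
qed

lemma eigenvalues_dense: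
  assumes K: "\<And>s. (\<And>\<eta>. \<eta> \<in> eigenvalues \<Longrightarrow> \<eta> s = 1) \<Longrightarrow> \<exists>k\<in>{1..K}. shift (real k *\<^sub>R s) L = L"
    and nonper: "\<And>t. shift t L = L \<Longrightarrow> t = 0"
  shows "dual_topology closure_of eigenvalues = carrier dual_group"
proof (rule dual_subgroup_dense[OF eigenvalues_subgroup], rule ccontr)
  fix t :: "real^'n" assume t: "t \<noteq> 0" "\<not> (\<exists>\<eta>\<in>eigenvalues. \<eta> t \<noteq> 1)"
  then obtain k where k: "k \<in> {1..K}" "shift (real k *\<^sub>R t) L = L" using K[of t] by blast
  then show False using nonper[OF k(2)] t(1) by simp
qed

end

section \<open>Deformation into a Meyer set\<close>

text \<open>
  The point \<open>p\<close> of \<open>x\<close> is moved by \<open>cor (shift p x)\<close>, the discrepancy between the eigenfunctions at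
  \<open>shift p x\<close> and their values \<open>g\<close> at a representative of its local pattern. All points
  of the deformed set then lie in finitely many translates of the lattice \<open>{v. \<forall>i. cis (b i \<bullet> v) = 1}\<close>.
\<close>

locale meyer_deformation = repetitive_delone L for L :: "(real^'n) set" +
  fixes b :: "'n \<Rightarrow> real^'n" and f g :: "'n \<Rightarrow> (real^'n) set \<Rightarrow> complex"
    and cor :: "(real^'n) set \<Rightarrow> real^'n" and \<delta> R :: real and C :: "('n \<Rightarrow> complex) set"
  assumes f_shift: "\<And>i t x. x \<in> \<Omega> \<Longrightarrow> f i (shift t x) = cis (b i \<bullet> t) * f i x"
    and f_nz: "\<And>i x. x \<in> \<Omega> \<Longrightarrow> f i x \<noteq> 0"
    and f_near: "\<And>e. e > 0 \<Longrightarrow> \<exists>\<epsilon>>0. \<forall>x\<in>\<Omega>. \<forall>y\<in>\<Omega>. near \<epsilon> x y \<longrightarrow>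
      (\<exists>u. norm u < e \<and> (\<forall>i. f i y = cis (b i \<bullet> u) * f i x))"
    and cor_small: "\<And>y. y \<in> \<Omega> \<Longrightarrow> norm (cor y) \<le> \<delta>"
    and cor: "\<And>y i. y \<in> \<Omega> \<Longrightarrow> cis (b i \<bullet> cor y) * g i y = f i y"
    and g_local: "\<And>x y. x \<inter> cball 0 R = y \<inter> cball 0 R \<Longrightarrow> (\<lambda>i. g i x) = (\<lambda>i. g i y)"
    and C: "finite C" "\<And>y. y \<in> \<Omega> \<Longrightarrow> 0 \<in> y \<Longrightarrow> (\<lambda>i. g i y) \<in> C"
    and lattice: "\<And>v. (\<And>i. cis (b i \<bullet> v) = 1) \<Longrightarrow> norm v < 4 * \<delta> \<Longrightarrow> v = 0"
    and \<delta>: "\<delta> > 0" "8 * \<delta> < sep"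
    and R: "R \<ge> 0"
    and differences: "\<And>x y p q p' q'. x \<in> \<Omega> \<Longrightarrow> y \<in> \<Omega> \<Longrightarrow> p \<in> x \<Longrightarrow> q \<in> x \<Longrightarrow> p' \<in> y \<Longrightarrow> q' \<in> y \<Longrightarrow>
      norm (q - p) \<le> 2 * rad + 1 \<Longrightarrow> norm ((q' - p') - (q - p)) \<le> 4 * \<delta> \<Longrightarrow> q' - p' = q - p"
begin

text \<open>The correction is evaluated at the set seen from \<open>p\<close>, which makes the
  deformation commute with translations.\<close>

definition displace :: "(real^'n) set \<Rightarrow> real^'n \<Rightarrow> real^'n" where
  "displace x p = p - cor (shift p x)"

definition deform :: "(real^'n) set \<Rightarrow> (real^'n) set" where
  "deform x = displace x ` x"

lemma displace_near: "x \<in> \<Omega> \<Longrightarrow> norm (displace x p - p) \<le> \<delta>"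
  using cor_small[OF shift_in_delone_hull] by (simp add: displace_def)

text \<open>The purpose of the correction: at a moved point of \<open>x\<close> the characters take,
  up to the factor \<open>f i x\<close>, values that depend on the local pattern alone, hence
  finitely many.\<close>

lemma displace_char:
  assumes "x \<in> \<Omega>"
  shows "cis (b i \<bullet> displace x p) * f i x = g i (shift p x)"
proof -
  have "cis (b i \<bullet> cor (shift p x)) * g i (shift p x) = cis (b i \<bullet> p) * f i x"
    using cor[OF shift_in_delone_hull[OF assms]] f_shift[OF assms] by simp
  then have "cis (- (b i \<bullet> cor (shift p x))) * (cis (b i \<bullet> cor (shift p x)) * g i (shift p x)) =
      cis (- (b i \<bullet> cor (shift p x))) * (cis (b i \<bullet> p) * f i x)" by simp
  then show ?thesis
    by (simp add: mult.assoc[symmetric] cis_mult displace_def inner_diff_right)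
qed

lemma deform_shift: "deform (shift t x) = shift t (deform x)"
proof -
  have d: "displace (shift t x) p = displace x (p + t) - t" for p
    by (simp add: displace_def shift_shift)
  have mem: "w \<in> deform (shift t x) \<longleftrightarrow> w + t \<in> deform x" for w
  proof
    assume "w \<in> deform (shift t x)"
    then obtain p where p: "p + t \<in> x" "w = displace x (p + t) - t" unfolding deform_def d by auto
    have "w + t = displace x (p + t)" unfolding p(2) by simp
    then show "w + t \<in> deform x" unfolding deform_def using p(1) by (rule image_eqI)
  next
    assume "w + t \<in> deform x"
    then obtain p where p: "p \<in> x" "w + t = displace x p" unfolding deform_def by blast
    have "w = displace (shift t x) (p - t)" unfolding d using p(2) by (simp add: eq_diff_eq)
    moreover have "p - t \<in> shift t x" using p(1) by simp
    ultimately show "w \<in> deform (shift t x)" unfolding deform_def by (rule image_eqI)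
  qed
  show ?thesis by (rule Set.set_eqI) (simp only: mem_shift mem)
qed

text \<open>Each point moves by at most \<open>\<delta>\<close>, which is below
  \<open>sep / 8\<close>, so distances change by less than \<open>sep / 4\<close>.\<close>

lemma displace_sep:
  assumes "x \<in> \<Omega>" "p \<in> x" "q \<in> x" "dist (displace x p) (displace x q) < sep / 2"
  shows "p = q"
proof (rule hull_sep[OF assms(1-3)])
  have "norm (p - q) \<le> norm (displace x p - displace x q) + norm (displace x p - p) + norm (displace x q - q)"
    using norm_triangle_ineq4[of "displace x p - displace x q" "(displace x p - p) - (displace x q - q)"]
      norm_triangle_ineq4[of "displace x p - p" "displace x q - q"] by simp
  then show "dist p q < sep"
    using displace_near[OF assms(1), of p] displace_near[OF assms(1), of q] assms(4) \<delta> by (simp add: dist_norm)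
qed

lemma deform_rad:
  assumes "x \<in> \<Omega>" shows "\<exists>m\<in>deform x. norm (c - m) \<le> rad + \<delta>"
proof -
  obtain p where p: "p \<in> x" "dist c p \<le> rad" using hull_rad[OF assms] by blast
  have "norm (c - displace x p) \<le> rad + \<delta>"
    using norm_triangle_ineq4[of "c - p" "displace x p - p"] displace_near[OF assms, of p] p(2) by (simp add: dist_norm)
  then show ?thesis using p(1) by (auto simp: deform_def)
qed

lemma deform_delone:
  assumes "x \<in> \<Omega>" shows "delone (deform x)"
  unfolding delone_def
proof
  show "uniform_discrete (deform x)"
    unfolding uniform_discrete_def
  proof (intro exI[of _ "sep / 2"] conjI ballI impI)
    fix a c assume ac: "a \<in> deform x" "c \<in> deform x" "dist a c < sep / 2"
    then obtain p q where "p \<in> x" "q \<in> x" "a = displace x p" "c = displace x q" by (auto simp: deform_def)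
    then show "a = c" using displace_sep[OF assms, of p q] ac(3) by simp
  qed (use sep in simp)
  show "relatively_dense (deform x)"
    unfolding relatively_dense_def
    using deform_rad[OF assms] rad(1) \<delta>(1) by (intro exI[of _ "rad + \<delta>"]) (auto simp: dist_norm)
qed

text \<open>Two members of a coset differ by a lattice vector, and \<open>lattice\<close> keeps
  these from being short.\<close>

lemma finite_lattice_coset_ball: "finite {v. norm v \<le> r \<and> (\<lambda>i. cis (b i \<bullet> v)) = c}"
proof -
  define S where "S = {v. norm v \<le> r \<and> (\<lambda>i. cis (b i \<bullet> v)) = c}"
  have "uniform_discrete S"
    unfolding uniform_discrete_def
  proof (intro exI[of _ "4 * \<delta>"] conjI ballI impI)
    fix v w assume vw: "v \<in> S" "w \<in> S" "dist v w < 4 * \<delta>"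
    have "cis (b i \<bullet> (v - w)) = 1" for i
    proof -
      have "(\<lambda>i. cis (b i \<bullet> v)) = (\<lambda>i. cis (b i \<bullet> w))" using vw by (simp add: S_def)
      then have "cis (b i \<bullet> v) = cis (b i \<bullet> w)" by (rule fun_cong)
      then show ?thesis by (simp add: inner_diff_right cis_divide[symmetric])
    qed
    then show "v = w" using lattice[of "v - w"] vw(3) by (simp add: dist_norm)
  qed (use \<delta> in simp)
  moreover have "bounded S" unfolding S_def by (rule boundedI[of _ r]) auto
  ultimately show ?thesis unfolding S_def[symmetric] using uniform_discrete_finite_iff by blast
qed

text \<open>A difference \<open>m1 - m2\<close> has a point \<open>m3\<close> of the set within
  \<open>rad + \<delta>\<close>. The character values of the three points come from
  \<open>C\<close>, so \<open>m1 - m2 - m3\<close> lies in bounded parts of finitely many lattice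
  cosets.\<close>

lemma deform_meyer: "meyer (deform L)"
proof -
  \<comment> \<open>Each of the three values carries one factor \<open>f i L\<close>; in the
    quotient one of them survives, in the numerator.\<close>
  define V where "V = (\<lambda>(c1, c2, c3). (\<lambda>i. c1 i / c2 i * f i L / c3 i)) ` (C \<times> C \<times> C)"
  define F where "F = (\<Union>c\<in>V. {v. norm v \<le> rad + \<delta> \<and> (\<lambda>i. cis (b i \<bullet> v)) = c})"
  have "finite V" unfolding V_def using C(1) by simp
  then have "finite F" unfolding F_def using finite_lattice_coset_ball by blast
  have char: "\<exists>c\<in>C. \<forall>i. cis (b i \<bullet> m) * f i L = c i" if m: "m \<in> deform L" for m
  proof -
    obtain p where p: "p \<in> L" "m = displace L p" using m by (auto simp: deform_def)
    have "(\<lambda>i. g i (shift p L)) \<in> C" using p(1) by (intro C(2) shift_in_delone_hull L_in) auto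
    then show ?thesis using displace_char[OF L_in] p(2) by (intro bexI[of _ "\<lambda>i. g i (shift p L)"]) auto
  qed
  have "{x - y |x y. x \<in> deform L \<and> y \<in> deform L} \<subseteq> {z + f |z f. z \<in> deform L \<and> f \<in> F}"
  proof
    fix d assume "d \<in> {x - y |x y. x \<in> deform L \<and> y \<in> deform L}"
    then obtain m1 m2 where m: "m1 \<in> deform L" "m2 \<in> deform L" "d = m1 - m2" by blast
    obtain m3 where m3: "m3 \<in> deform L" "norm (d - m3) \<le> rad + \<delta>" using deform_rad[OF L_in] by blast
    obtain c1 where c1: "c1 \<in> C" "\<And>i. cis (b i \<bullet> m1) * f i L = c1 i" using char[OF m(1)] by blast
    obtain c2 where c2: "c2 \<in> C" "\<And>i. cis (b i \<bullet> m2) * f i L = c2 i" using char[OF m(2)] by blast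
    obtain c3 where c3: "c3 \<in> C" "\<And>i. cis (b i \<bullet> m3) * f i L = c3 i" using char[OF m3(1)] by blast
    have "cis (b i \<bullet> (d - m3)) = c1 i / c2 i * f i L / c3 i" for i
      using f_nz[OF L_in, of i] unfolding c1(2)[symmetric] c2(2)[symmetric] c3(2)[symmetric] m(3)
      by (simp add: inner_diff_right cis_divide[symmetric])
    then have "d - m3 \<in> F"
      using m3(2) c1(1) c2(1) c3(1) unfolding F_def V_def
      by (intro UN_I[of "\<lambda>i. c1 i / c2 i * f i L / c3 i"]) (auto intro!: image_eqI[of _ _ "(c1, c2, c3)"])
    moreover have "d = m3 + (d - m3)" by simp
    ultimately show "d \<in> {z + f |z f. z \<in> deform L \<and> f \<in> F}" using m3(1) by blast
  qed
  then show ?thesis using deform_delone[OF L_in] \<open>finite F\<close> unfolding meyer_def by blast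
qed

text \<open>
  Where two elements of the hull agree, their deformations differ by the common small
  translation read off from the eigenfunctions.
\<close>

lemma displace_eq:
  assumes "x \<in> \<Omega>" "y \<in> \<Omega>" and u: "norm u < \<delta>" "\<And>i. f i y = cis (b i \<bullet> u) * f i x"
    and agree: "\<And>w. norm w < M \<Longrightarrow> w \<in> x \<longleftrightarrow> w \<in> y" and p: "norm p + R < M"
  shows "displace x p = displace y p + u"
proof -
  have "w \<in> shift p x \<inter> cball 0 R \<longleftrightarrow> w \<in> shift p y \<inter> cball 0 R" for w
    using agree[of "w + p"] norm_triangle_ineq[of w p] p by auto
  then have "shift p x \<inter> cball 0 R = shift p y \<inter> cball 0 R" by blast
  then have "g i (shift p x) = g i (shift p y)" for i using g_local by (meson fun_cong)
  then have e: "cis (b i \<bullet> displace x p) * f i x = cis (b i \<bullet> displace y p) * f i y" for i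
    using displace_char[OF assms(1)] displace_char[OF assms(2)] by simp
  have "cis (b i \<bullet> (displace x p - (displace y p + u))) = 1" for i
  proof -
    have "cis (b i \<bullet> displace x p) * f i x = cis (b i \<bullet> (displace y p + u)) * f i x"
      using e[of i] unfolding u(2) by (simp add: inner_add_right cis_mult[symmetric] mult_ac)
    then have "cis (b i \<bullet> displace x p) = cis (b i \<bullet> (displace y p + u))" using f_nz[OF assms(1)] by simp
    then show ?thesis by (simp add: inner_diff_right cis_divide[symmetric])
  qed
  \<comment> \<open>Two corrections of size at most \<open>\<delta>\<close> and the vector
    \<open>u\<close> together stay below \<open>4 * \<delta>\<close>, where 0 is the only lattice
    vector.\<close>
  moreover have "norm (displace x p - (displace y p + u)) < 4 * \<delta>"
    using norm_triangle_ineq4[of "displace x p - p" "(displace y p - p) + u"] norm_triangle_ineq[of "displace y p - p" u]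
      displace_near[OF assms(1), of p] displace_near[OF assms(2), of p] u(1) \<delta>(1) by (simp add: algebra_simps)
  ultimately have "displace x p - (displace y p + u) = 0" by (rule lattice)
  then show ?thesis by simp
qed

text \<open>Translating \<open>y\<close> by the vector \<open>v\<close> of \<open>near\<close> makes
  it agree with \<open>x\<close> on a ball. There all displaced points differ by one vector
  \<open>u\<close>, so the deformations agree up to the translation \<open>v - u\<close>.\<close>

lemma deform_near:
  assumes e: "e > 0"
  obtains \<epsilon> where "\<epsilon> > 0" "\<And>x y. x \<in> \<Omega> \<Longrightarrow> y \<in> \<Omega> \<Longrightarrow> near \<epsilon> x y \<Longrightarrow> near e (deform x) (deform y)"
proof -
  define e' where "e' = min e \<delta> / 2"
  have e': "e' > 0" "e' \<le> e / 2" "e' < \<delta>" using e \<delta>(1) by (auto simp: e'_def)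
  obtain \<epsilon>1 where \<epsilon>1: "\<epsilon>1 > 0" "\<And>x y. x \<in> \<Omega> \<Longrightarrow> y \<in> \<Omega> \<Longrightarrow> near \<epsilon>1 x y \<Longrightarrow>
      \<exists>u. norm u < e' \<and> (\<forall>i. f i y = cis (b i \<bullet> u) * f i x)"
    using f_near[OF e'(1)] by blast
  \<comment> \<open>A relevant deformed point comes from a point of norm less than
    \<open>1 / e + 2 * \<delta>\<close>, whose pattern of radius \<open>R\<close> must lie in the
    window of agreement.\<close>
  define M where "M = 1 / e + 2 * \<delta> + R + 1"
  have M: "M > 0" using e \<delta>(1) R by (simp add: M_def add_pos_nonneg)
  define \<epsilon> where "\<epsilon> = min (min \<epsilon>1 e') (1 / M)"
  have \<epsilon>: "\<epsilon> > 0" "\<epsilon> \<le> \<epsilon>1" "\<epsilon> \<le> e'" using \<epsilon>1(1) e'(1) M by (auto simp: \<epsilon>_def)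
  have "\<epsilon> \<le> 1 / M" by (simp add: \<epsilon>_def)
  then have M\<epsilon>: "M \<le> 1 / \<epsilon>" using \<epsilon>(1) M by (simp add: field_simps)
  have "near e (deform x) (deform y)" if xy: "x \<in> \<Omega>" "y \<in> \<Omega>" "near \<epsilon> x y" for x y
  proof -
    obtain v where v: "norm v < \<epsilon>" "\<And>w. norm w < 1 / \<epsilon> \<Longrightarrow> w \<in> x \<longleftrightarrow> w + v \<in> y"
      using xy(3) by (auto simp: near_def)
    define y' where "y' = shift v y"
    have y': "y' \<in> \<Omega>" unfolding y'_def by (rule shift_in_delone_hull[OF xy(2)])
    have agree: "w \<in> x \<longleftrightarrow> w \<in> y'" if "norm w < 1 / \<epsilon>" for w using v(2)[OF that] by (simp add: y'_def)
    have "near \<epsilon> x y'" unfolding near_def using \<epsilon>(1) agree by (intro exI[of _ 0]) auto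
    then have "near \<epsilon>1 x y'" by (rule near_mono[OF _ \<epsilon>(1,2)])
    then obtain u where u: "norm u < e'" "\<And>i. f i y' = cis (b i \<bullet> u) * f i x" using \<epsilon>1(2)[OF xy(1) y'] by blast
    have u\<delta>: "norm u < \<delta>" using u(1) e'(3) by simp
    have eq: "displace x p = displace y' p + u" if "norm p + R < 1 / \<epsilon>" for p
      by (rule displace_eq[OF xy(1) y' u\<delta> u(2) agree that])
    have "w \<in> deform x \<longleftrightarrow> w + (v - u) \<in> deform y" if w: "norm w < 1 / e" for w
    proof -
      have "w \<in> deform x \<longleftrightarrow> w - u \<in> deform y'"
      proof
        assume "w \<in> deform x"
        then obtain p where p: "p \<in> x" "w = displace x p" by (auto simp: deform_def)
        have "norm p \<le> norm w + \<delta>"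
          using norm_triangle_ineq4[of w "displace x p - p"] displace_near[OF xy(1), of p] p(2) by simp
        then have np: "norm p + R < 1 / \<epsilon>" using w M\<epsilon> \<delta>(1) unfolding M_def by linarith
        then have "p \<in> y'" using agree[of p] p(1) R by simp
        moreover have "w - u = displace y' p" using eq[OF np] p(2) by simp
        ultimately show "w - u \<in> deform y'" unfolding deform_def by blast
      next
        assume "w - u \<in> deform y'"
        then obtain p where p: "p \<in> y'" "w - u = displace y' p" by (auto simp: deform_def)
        have "norm p \<le> norm (w - u) + \<delta>"
          using norm_triangle_ineq4[of "w - u" "displace y' p - p"] displace_near[OF y', of p] p(2) by simp
        also have "norm (w - u) \<le> norm w + \<delta>" using norm_triangle_ineq4[of w u] u\<delta> by simp
        finally have np: "norm p + R < 1 / \<epsilon>" using w M\<epsilon> unfolding M_def by linarith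
        then have "p \<in> x" using agree[of p] p(1) R by simp
        moreover have "w = displace x p" using eq[OF np] p(2) by (simp add: algebra_simps)
        ultimately show "w \<in> deform x" unfolding deform_def by blast
      qed
      also have "\<dots> \<longleftrightarrow> w + (v - u) \<in> deform y" by (simp add: y'_def deform_shift algebra_simps)
      finally show ?thesis .
    qed
    moreover have "norm (v - u) < e" using norm_triangle_ineq4[of v u] v(1) u(1) \<epsilon>(3) e'(2) by linarith
    ultimately show ?thesis unfolding near_def by blast
  qed
  then show ?thesis using that \<epsilon>(1) by blast
qed

text \<open>
  Corresponding points of \<open>x\<close> and \<open>y\<close> with equal deformations differ by the same vector, because
  differences of neighbours are determined up to errors of size \<open>4 * \<delta>\<close>.
\<close>

lemma deform_inj: "inj_on deform \<Omega>"
proof (rule inj_onI)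
  fix x y assume x: "x \<in> \<Omega>" and y: "y \<in> \<Omega>" and xy: "deform x = deform y"
  have "\<exists>p'\<in>y. displace x p = displace y p'" if "p \<in> x" for p
    using that xy unfolding deform_def by (metis imageE imageI)
  then obtain c where c: "\<And>p. p \<in> x \<Longrightarrow> c p \<in> y" "\<And>p. p \<in> x \<Longrightarrow> displace x p = displace y (c p)" by metis
  have c_near: "norm (c p - p) \<le> 2 * \<delta>" if "p \<in> x" for p
    using norm_triangle_ineq4[of "displace x p - p" "displace y (c p) - c p"] c(2)[OF that]
      displace_near[OF x, of p] displace_near[OF y, of "c p"] by simp
  have step: "c q - q = c p - p" if "p \<in> x" "q \<in> x" "norm (q - p) \<le> 2 * rad + 1" for p q
  proof -
    have "norm ((c q - c p) - (q - p)) \<le> 4 * \<delta>"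
      using norm_triangle_ineq4[of "c q - q" "c p - p"] c_near[OF that(1)] c_near[OF that(2)] by (simp add: algebra_simps)
    then have "c q - c p = q - p" by (intro differences[OF x y that(1,2) c(1)[OF that(1)] c(1)[OF that(2)] that(3)])
    then show ?thesis by (simp add: algebra_simps)
  qed
  have const: "c q - q = c p - p" if "p \<in> x" "q \<in> x" "norm (q - p) \<le> real n" for p q n
    using that
  proof (induction n arbitrary: q)
    case 0
    then show ?case by simp
  next
    case (Suc n)
    show ?case
    proof (cases "norm (q - p) \<le> 2 * rad + 1")
      case True
      then show ?thesis using step Suc.prems by blast
    next
      case False
      define D where "D = norm (q - p)"
      \<comment> \<open>A step of length \<open>rad + 1\<close> towards \<open>p\<close>. A point
        \<open>r\<close> within \<open>rad\<close> of its end is at most \<open>2 * rad + 1\<close>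
        from \<open>q\<close> and nearer to \<open>p\<close> by at least 1, so the induction
        hypothesis applies to it.\<close>
      define a where "a = (rad + 1) / D"
      have D: "D > 0" "D > 2 * rad + 1" using False rad(1) by (auto simp: D_def)
      have a: "0 \<le> a" "a * D = rad + 1" "a \<le> 1" using D rad(1) by (auto simp: a_def)
      obtain r where r: "r \<in> x" "dist (q + a *\<^sub>R (p - q)) r \<le> rad" using hull_rad[OF x] by blast
      have "norm (a *\<^sub>R (p - q)) = rad + 1" using a by (simp add: D_def norm_minus_commute)
      then have "norm (r - q) \<le> 2 * rad + 1"
        using norm_triangle_ineq4[of "a *\<^sub>R (p - q)" "(q + a *\<^sub>R (p - q)) - r"] r(2) by (simp add: dist_norm)
      moreover have "norm (r - p) \<le> real n"
      proof -
        have "r - p = (1 - a) *\<^sub>R (q - p) - ((q + a *\<^sub>R (p - q)) - r)" by (simp add: algebra_simps)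
        then have "norm (r - p) \<le> norm ((1 - a) *\<^sub>R (q - p)) + norm ((q + a *\<^sub>R (p - q)) - r)"
          by (simp only: norm_triangle_ineq4)
        also have "norm ((q + a *\<^sub>R (p - q)) - r) \<le> rad" using r(2) by (simp only: dist_norm)
        also have "norm ((1 - a) *\<^sub>R (q - p)) = D - (rad + 1)" using a by (simp add: D_def[symmetric] left_diff_distrib)
        finally show ?thesis using Suc.prems(3) by (simp add: D_def)
      qed
      ultimately have "c r - r = c p - p" "c r - r = c q - q"
        using Suc.IH[OF Suc.prems(1) r(1)] step[OF Suc.prems(2) r(1)] by auto
      then show ?thesis by simp
    qed
  qed
  obtain p0 where p0: "p0 \<in> x" using hull_nonempty[OF x] by blast
  define s where "s = c p0 - p0"
  have cs: "c p = p + s" if "p \<in> x" for p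
  proof -
    obtain n where "norm (p - p0) \<le> real n" using real_arch_simple by blast
    then have "c p - p = s" unfolding s_def using const[OF p0 that] by blast
    then show ?thesis by (simp add: algebra_simps)
  qed
  have y_eq: "y = shift (- s) x"
  proof -
    have mem: "w \<in> y \<longleftrightarrow> w + (- s) \<in> x" for w
    proof
      assume w: "w \<in> y"
      then have "displace y w \<in> deform y" unfolding deform_def by (rule imageI)
      then have "displace y w \<in> deform x" unfolding xy .
      then obtain p where p: "p \<in> x" "displace y w = displace x p" unfolding deform_def by blast
      then have "displace y w = displace y (c p)" using c(2) by simp
      then have "w = c p" using displace_sep[OF y w c(1)[OF p(1)]] sep(1) by simp
      then show "w + (- s) \<in> x" using cs p(1) by simp
    next
      assume ws: "w + (- s) \<in> x"
      have "c (w + (- s)) = w" using cs[OF ws] by simp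
      then show "w \<in> y" using c(1)[OF ws] by simp
    qed
    show ?thesis by (rule Set.set_eqI) (simp only: mem_shift mem)
  qed
  \<comment> \<open>As \<open>y\<close> is \<open>x\<close> translated by \<open>s\<close>, the
    deformed set has period \<open>s\<close>; a period shorter than the separation
    \<open>sep / 2\<close> is 0.\<close>
  have "deform x = deform (shift (- s) x)" using xy unfolding y_eq .
  then have period: "shift (- s) (deform x) = deform x" by (simp only: deform_shift)
  have "displace x p0 \<in> deform x" unfolding deform_def using p0 by (rule imageI)
  then have "displace x p0 + s \<in> shift (- s) (deform x)" by simp
  then have "displace x p0 + s \<in> deform x" unfolding period .
  then obtain q where q: "q \<in> x" "displace x p0 + s = displace x q" by (auto simp: deform_def)
  have "norm s \<le> 2 * \<delta>" using c_near[OF p0] by (simp add: s_def)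
  then have "dist (displace x p0) (displace x q) < sep / 2"
    using \<delta> unfolding q(2)[symmetric] by (simp add: dist_norm)
  then have "p0 = q" by (rule displace_sep[OF x p0 q(1)])
  then have "s = 0" using q(2) by simp
  then show "x = y" using y_eq by simp
qed

text \<open>Seen from \<open>p\<close>, \<open>x\<close> agrees on a large ball with
  \<open>L\<close> seen from some \<open>q\<close>. \<open>deform_near\<close> passes this to the
  deformations up to a small translation, which the choice of the centre in \<open>deform L\<close>
  absorbs.\<close>

lemma deform_in_hull:
  assumes x: "x \<in> \<Omega>" shows "deform x \<in> delone_hull (deform L)"
proof (rule delone_hullI[OF deform_delone[OF x]])
  fix m r assume "m \<in> deform x"
  then obtain p where p: "p \<in> x" "m = displace x p" by (auto simp: deform_def)
  \<comment> \<open>Makes \<open>1 / e\<close> exceed the window radius plus the distance of at most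
    \<open>\<delta>\<close> between \<open>m\<close> and \<open>p\<close>.\<close>
  define e where "e = 1 / (max r 0 + \<delta> + 1)"
  have e: "e > 0" using \<delta>(1) by (simp add: e_def add_nonneg_pos)
  obtain \<epsilon> where \<epsilon>: "\<epsilon> > 0" "\<And>x y. x \<in> \<Omega> \<Longrightarrow> y \<in> \<Omega> \<Longrightarrow> near \<epsilon> x y \<Longrightarrow> near e (deform x) (deform y)"
    using deform_near[OF e] by blast
  obtain q where q: "q \<in> L" "\<And>w. norm w \<le> 1 / \<epsilon> \<Longrightarrow> p + w \<in> x \<longleftrightarrow> q + w \<in> L"
    using delone_hull_lookup[OF x p(1), of "1 / \<epsilon>"] by blast
  have "near \<epsilon> (shift p x) (shift q L)"
    unfolding near_def using \<epsilon>(1) q(2) by (intro exI[of _ 0]) (auto simp: add.commute)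
  then have "near e (shift p (deform x)) (shift q (deform L))"
    using \<epsilon>(2)[OF shift_in_delone_hull[OF x] shift_in_delone_hull[OF L_in]] by (simp add: deform_shift)
  then obtain v where v: "\<And>w. norm w < 1 / e \<Longrightarrow> w + p \<in> deform x \<longleftrightarrow> w + v + q \<in> deform L"
    by (auto simp: near_def)
  have mp: "norm (m - p) \<le> \<delta>" using displace_near[OF x] p(2) by simp
  have agree: "m + w \<in> deform x \<longleftrightarrow> (m - p + v + q) + w \<in> deform L" if w: "norm w \<le> max r 0" for w
  proof -
    have "norm (m - p + w) < 1 / e" using norm_triangle_ineq[of "m - p" w] mp w by (simp add: e_def)
    from v[OF this] show ?thesis by (simp add: algebra_simps)
  qed
  have "m - p + v + q \<in> deform L" using agree[of 0] \<open>m \<in> deform x\<close> by simp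
  then show "\<exists>q\<in>deform L. \<forall>w. norm w \<le> r \<longrightarrow> (m + w \<in> deform x \<longleftrightarrow> q + w \<in> deform L)"
    using agree by (intro bexI[of _ "m - p + v + q"]) auto
qed

text \<open>A closed-graph statement: it turns sequential compactness of the hull into surjectivity
  and openness of the deformation.\<close>

lemma deform_limit:
  assumes z: "z \<in> \<Omega>" and w: "\<And>n. w n \<in> \<Omega>" and A: "uniform_discrete A"
    and lim: "\<And>\<epsilon>. \<epsilon> > 0 \<Longrightarrow> \<forall>\<^sub>F n in sequentially. near \<epsilon> z (w n)"
    and lim': "\<And>\<epsilon>. \<epsilon> > 0 \<Longrightarrow> \<forall>\<^sub>F n in sequentially. near \<epsilon> (deform (w n)) A"
  shows "deform z = A"
proof (rule near_imp_eq[OF _ _ A])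
  show "deform z \<noteq> {}" using hull_nonempty[OF z] by (auto simp: deform_def)
  fix e :: real assume e: "e > 0"
  define e' where "e' = min (e / 2) (1 / 2)"
  have e': "e' > 0" "e' \<le> 1 / 2" "2 * e' \<le> e" using e by (auto simp: e'_def)
  obtain \<epsilon> where \<epsilon>: "\<epsilon> > 0" "\<And>x y. x \<in> \<Omega> \<Longrightarrow> y \<in> \<Omega> \<Longrightarrow> near \<epsilon> x y \<Longrightarrow> near e' (deform x) (deform y)"
    using deform_near[OF e'(1)] by blast
  obtain n where n: "near \<epsilon> z (w n)" "near e' (deform (w n)) A"
    using eventually_happens[OF eventually_conj[OF lim[OF \<epsilon>(1)] lim'[OF e'(1)]]] by auto
  have "near (2 * e') (deform z) A" by (rule near_trans[OF \<epsilon>(2)[OF z w n(1)] n(2) e'(1,2)])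
  then show "near e (deform z) A" by (rule near_mono) (use e' in auto)
qed

text \<open>Up to a translation \<open>M\<close> is a limit of translates of
  \<open>deform L\<close>, that is, of deformations of translates of \<open>L\<close>; these
  translates subconverge in the hull.\<close>

lemma deform_surj:
  assumes M: "M \<in> delone_hull (deform L)" shows "M \<in> deform ` \<Omega>"
proof -
  have "delone M" using M by (simp add: delone_hull_def)
  then obtain m0 where m0: "m0 \<in> M" using delone_nonempty by blast
  have "\<exists>q. \<forall>w. norm w \<le> real n \<longrightarrow> (m0 + w \<in> M \<longleftrightarrow> q + w \<in> deform L)" for n
    using delone_hull_lookup[OF M m0, of "real n"] by metis
  then obtain q where q: "\<And>n w. norm w \<le> real n \<Longrightarrow> m0 + w \<in> M \<longleftrightarrow> q n + w \<in> deform L" by metis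
  obtain r z where r: "strict_mono (r :: nat \<Rightarrow> nat)" and z: "z \<in> \<Omega>"
    "\<And>\<epsilon>. \<epsilon> > 0 \<Longrightarrow> \<forall>\<^sub>F n in sequentially. near \<epsilon> z (shift (q (r n)) L)"
    using hull_sequentially_compact[of "\<lambda>n. shift (q n) L"] shift_in_delone_hull[OF L_in] by blast
  have "deform z = shift m0 M"
  proof (rule deform_limit[OF z(1) shift_in_delone_hull[OF L_in] _ z(2)])
    show "uniform_discrete (shift m0 M)" using \<open>delone M\<close> by (simp add: delone_def uniform_discrete_shift)
    fix e :: real assume e: "e > 0"
    obtain k where k: "1 / e \<le> real k" using real_arch_simple by blast
    show "\<forall>\<^sub>F n in sequentially. near e (deform (shift (q (r n)) L)) (shift m0 M)"
    proof (rule eventually_sequentiallyI[of k])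
      fix n assume "n \<ge> k"
      then have "1 / e \<le> real (r n)" using k seq_suble[OF r, of n] by simp
      then have "w \<in> shift (q (r n)) (deform L) \<longleftrightarrow> w + 0 \<in> shift m0 M" if "norm w < 1 / e" for w
        using q[of w "r n"] that by (simp add: add.commute)
      then show "near e (deform (shift (q (r n)) L)) (shift m0 M)"
        unfolding near_def deform_shift using e by (intro exI[of _ 0]) auto
    qed
  qed
  then have "M = deform (shift (- m0) z)" by (simp add: deform_shift shift_shift)
  then show ?thesis using shift_in_delone_hull[OF z(1)] by blast
qed

text \<open>Openness is continuity of the inverse: preimages of a convergent sequence subconverge by
  compactness, and injectivity identifies their limit.\<close>

lemma deform_conjugacy:
  "topologically_conjugate (hull_topology L) shift (hull_topology (deform L)) shift"
  unfolding topologically_conjugate_def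
proof (intro exI[of _ deform] conjI)
  have img: "deform ` \<Omega> = delone_hull (deform L)" using deform_in_hull deform_surj by blast
  show "homeomorphic_map (hull_topology L) (hull_topology (deform L)) deform"
  proof (rule bijective_open_imp_homeomorphic_map)
    show "continuous_map (hull_topology L) (hull_topology (deform L)) deform"
      unfolding continuous_map_def topspace_hull_topology
    proof (intro conjI allI impI)
      fix U assume U: "openin (hull_topology (deform L)) U"
      show "openin (hull_topology L) {x \<in> \<Omega>. deform x \<in> U}"
        unfolding openin_hull_near
      proof (intro conjI ballI)
        fix x assume x: "x \<in> {x \<in> \<Omega>. deform x \<in> U}"
        then obtain e where e: "e > 0" "\<And>B. B \<in> delone_hull (deform L) \<Longrightarrow> near e (deform x) B \<Longrightarrow> B \<in> U"
          using U unfolding openin_hull_near by blast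
        obtain \<epsilon> where \<epsilon>: "\<epsilon> > 0" "\<And>x y. x \<in> \<Omega> \<Longrightarrow> y \<in> \<Omega> \<Longrightarrow> near \<epsilon> x y \<Longrightarrow> near e (deform x) (deform y)"
          using deform_near[OF e(1)] by blast
        have "\<forall>y\<in>\<Omega>. near \<epsilon> x y \<longrightarrow> y \<in> {x \<in> \<Omega>. deform x \<in> U}"
          using x \<epsilon>(2) e(2) deform_in_hull by blast
        then show "\<exists>\<epsilon>>0. \<forall>y\<in>\<Omega>. near \<epsilon> x y \<longrightarrow> y \<in> {x \<in> \<Omega>. deform x \<in> U}" using \<epsilon>(1) by blast
      qed auto
    qed (use deform_in_hull in auto)
    show "deform ` topspace (hull_topology L) = topspace (hull_topology (deform L))"
      by (simp add: topspace_hull_topology img)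
    show "inj_on deform (topspace (hull_topology L))" by (simp add: topspace_hull_topology deform_inj)
    show "open_map (hull_topology L) (hull_topology (deform L)) deform"
      unfolding open_map_def
    proof (intro allI impI)
      fix U assume U: "openin (hull_topology L) U"
      then have U\<Omega>: "U \<subseteq> \<Omega>" by (simp add: openin_hull_near)
      show "openin (hull_topology (deform L)) (deform ` U)"
        unfolding openin_hull_near
      proof (intro conjI ballI)
        show "deform ` U \<subseteq> delone_hull (deform L)" using U\<Omega> img by blast
        fix A assume "A \<in> deform ` U"
        then obtain x where x: "x \<in> U" "A = deform x" by blast
        have x\<Omega>: "x \<in> \<Omega>" using x(1) U\<Omega> by blast
        show "\<exists>\<epsilon>>0. \<forall>B\<in>delone_hull (deform L). near \<epsilon> A B \<longrightarrow> B \<in> deform ` U"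
        proof (rule ccontr)
          assume contra: "\<not> ?thesis"
          have "\<exists>y\<in>\<Omega>. near (1 / real (n + 2)) A (deform y) \<and> y \<notin> U" for n
          proof -
            have "1 / real (n + 2) > 0" by simp
            then obtain B where B: "B \<in> delone_hull (deform L)" "near (1 / real (n + 2)) A B" "B \<notin> deform ` U"
              using contra by blast
            then obtain y where "y \<in> \<Omega>" "B = deform y" using img by blast
            then show ?thesis using B by blast
          qed
          then obtain y where y: "\<And>n. y n \<in> \<Omega>" "\<And>n. near (1 / real (n + 2)) A (deform (y n))" "\<And>n. y n \<notin> U"
            by metis
          obtain r z where r: "strict_mono (r :: nat \<Rightarrow> nat)" and z: "z \<in> \<Omega>"
            "\<And>\<epsilon>. \<epsilon> > 0 \<Longrightarrow> \<forall>\<^sub>F n in sequentially. near \<epsilon> z (y (r n))"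
            using hull_sequentially_compact[of y] y(1) by blast
          have "deform z = A"
          proof (rule deform_limit[OF z(1) y(1) _ z(2)])
            show "uniform_discrete A" using deform_delone[OF x\<Omega>] x(2) by (simp add: delone_def)
            fix e :: real assume e: "e > 0"
            define e' where "e' = min (e / 2) (1 / 2)"
            have e': "e' > 0" "e' \<le> 1 / 2" "2 * e' \<le> e" using e by (auto simp: e'_def)
            obtain k where k: "1 / e' \<le> real k" using real_arch_simple by blast
            show "\<forall>\<^sub>F n in sequentially. near e (deform (y (r n))) A"
            proof (rule eventually_sequentiallyI[of k])
              fix n assume "n \<ge> k"
              then have "1 / e' \<le> real (r n + 2)" using k seq_suble[OF r, of n] by simp
              then have "1 / real (r n + 2) \<le> e'" using e'(1) by (simp add: field_simps)
              then have "near e' A (deform (y (r n)))" by (intro near_mono[OF y(2)]) auto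
              then have "near (2 * e') (deform (y (r n))) A" by (rule near_sym[OF _ e'(1,2)])
              then show "near e (deform (y (r n))) A" by (rule near_mono) (use e' in auto)
            qed
          qed
          then have "z = x" using deform_inj z(1) x\<Omega> x(2) by (auto dest: inj_onD)
          obtain \<epsilon> where \<epsilon>: "\<epsilon> > 0" "\<And>B. B \<in> \<Omega> \<Longrightarrow> near \<epsilon> x B \<Longrightarrow> B \<in> U"
            using U x(1) unfolding openin_hull_near by blast
          have "\<forall>\<^sub>F n in sequentially. y (r n) \<in> U"
            using z(2)[OF \<epsilon>(1)] by eventually_elim (use \<epsilon>(2) y(1) \<open>z = x\<close> in blast)
          then show False using y(3) by simp
        qed
      qed
    qed
  qed
  show "\<forall>t. \<forall>x\<in>topspace (hull_topology L). deform (shift t x) = shift t (deform x)"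
    by (simp add: deform_shift)
qed

end

section \<open>Choice of pattern representatives and constants\<close>

lemma (in repetitive_delone) meyer_conjugate:
  fixes b :: "'n \<Rightarrow> real^'n"
  assumes eig: "\<And>i. (\<lambda>t. cis (b i \<bullet> t)) \<in> eigenvalues"
    and indep: "\<And>v. (\<And>i. b i \<bullet> v = 0) \<Longrightarrow> v = 0"
  shows "\<exists>M :: (real^'n) set. meyer M \<and>
    topologically_conjugate (hull_topology L) shift (hull_topology M) shift"
proof -
  have "\<exists>f. continuous_map (hull_topology L) euclidean f \<and>
      (\<forall>t. \<forall>x\<in>\<Omega>. f (shift t x) = cis (b i \<bullet> t) * f x) \<and> (\<forall>x\<in>\<Omega>. norm (f x) = 1)" for i
    by (rule eigenvalue_obtain[OF eig[of i]]) blast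
  then obtain f where f: "\<And>i. continuous_map (hull_topology L) euclidean (f i)"
    "\<And>i t x. x \<in> \<Omega> \<Longrightarrow> f i (shift t x) = cis (b i \<bullet> t) * f i x" "\<And>i x. x \<in> \<Omega> \<Longrightarrow> norm (f i x) = 1"
    by metis
  have f_nz: "f i x \<noteq> 0" if "x \<in> \<Omega>" for i x using f(3)[OF that, of i] by auto
  have lin: "linear (\<lambda>v. \<chi> i. b i \<bullet> v)"
    by (rule linearI) (simp_all add: vec_eq_iff inner_add_right)
  have "inj (\<lambda>v. \<chi> i. b i \<bullet> v)"
  proof (rule injI)
    fix v w assume "(\<chi> i. b i \<bullet> v) = (\<chi> i. b i \<bullet> w)"
    then have "b i \<bullet> (v - w) = 0" for i by (simp add: vec_eq_iff inner_diff_right)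
    then have "v - w = 0" by (rule indep)
    then show "v = w" by simp
  qed
  then have "\<exists>A. linear A \<and> (\<forall>x. (\<chi> i. b i \<bullet> A x) = x)"
    using linear_injective_isomorphism[OF lin] by auto
  then obtain A where A: "linear A" "\<And>x. (\<chi> i. b i \<bullet> A x) = x" by blast
  have bA: "b i \<bullet> A x = x $ i" for i x using arg_cong[OF A(2)[of x], of "\<lambda>v. v $ i"] by simp
  obtain c where c: "c > 0" "\<And>x. norm (A x) \<le> c * norm x" using linear_bounded_pos[OF A(1)] by blast
  \<comment> \<open>A simultaneous logarithm: \<open>A\<close> inverts the map taking a vector to
    its products with the \<open>b i\<close>, so the characters at \<open>lg u\<close> are the
    unimodular numbers \<open>u i\<close>. It is small near 1, where the principal argument is
    continuous.\<close>
  define lg where "lg u = A (\<chi> i. Arg (u i))" for u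
  have cis_lg: "cis (b i \<bullet> lg u) = u i" if "norm (u i) = 1" for u i
  proof -
    have "u i \<noteq> 0" using that by auto
    then show ?thesis using that by (simp add: lg_def bA cis_Arg sgn_div_norm)
  qed
  have lg_small: "\<exists>\<eta>>0. \<forall>u. (\<forall>i. norm (u i - 1) < \<eta>) \<longrightarrow> norm (lg u) < e" if e: "e > 0" for e
  proof -
    define \<tau> where "\<tau> = e / (c * (CARD('n) + 1))"
    have \<tau>: "\<tau> > 0" using e c by (simp add: \<tau>_def)
    have "continuous (at 1) Arg" by (rule continuous_at_Arg) simp
    then obtain \<eta> where \<eta>: "\<eta> > 0" "\<And>z. dist z 1 < \<eta> \<Longrightarrow> dist (Arg z) (Arg 1) < \<tau>"
      using \<tau> unfolding continuous_at by (metis continuous_at continuous_at_eps_delta dist_norm norm_minus_commute real_norm_def)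
    have "norm (lg u) < e" if u: "\<forall>i. norm (u i - 1) < \<eta>" for u
    proof -
      have "norm ((\<chi> i. Arg (u i)) :: real^'n) \<le> (\<Sum>i\<in>UNIV. \<bar>(\<chi> i. Arg (u i)) $ i\<bar>)" by (rule norm_le_l1_cart)
      also have "\<dots> \<le> (\<Sum>i\<in>(UNIV :: 'n set). \<tau>)"
        using \<eta>(2) u by (intro sum_mono) (simp add: dist_norm less_imp_le)
      finally have "norm ((\<chi> i. Arg (u i)) :: real^'n) \<le> CARD('n) * \<tau>" by simp
      then have "norm (lg u) \<le> c * (CARD('n) * \<tau>)"
        unfolding lg_def using c by (meson order_trans mult_left_mono less_imp_le)
      also have "\<dots> < c * ((CARD('n) + 1) * \<tau>)" using c \<tau> by (intro mult_strict_left_mono) auto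
      also have "\<dots> = e" using c by (simp add: \<tau>_def)
      finally show ?thesis .
    qed
    then show ?thesis using \<eta>(1) by blast
  qed
  have f_uc: "\<exists>\<epsilon>>0. \<forall>x\<in>\<Omega>. \<forall>y\<in>\<Omega>. near \<epsilon> x y \<longrightarrow> (\<forall>i. norm (f i y / f i x - 1) < e)" if e: "e > 0" for e
  proof -
    have "\<exists>\<epsilon>>0. \<forall>x\<in>\<Omega>. \<forall>y\<in>\<Omega>. near \<epsilon> x y \<longrightarrow> norm (f i x - f i y) < e" for i
      by (rule eigenfunction_uniformly_continuous[OF f(1,2) _ e, of i]) (simp, simp, blast)
    then obtain ep where ep: "\<And>i. ep i > 0" "\<And>i x y. x \<in> \<Omega> \<Longrightarrow> y \<in> \<Omega> \<Longrightarrow> near (ep i) x y \<Longrightarrow> norm (f i x - f i y) < e"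
      by metis
    define \<epsilon> where "\<epsilon> = Min (range ep)"
    have \<epsilon>: "\<epsilon> > 0" "\<And>i. \<epsilon> \<le> ep i" using ep(1) by (auto simp: \<epsilon>_def)
    have "norm (f i y / f i x - 1) < e" if xy: "x \<in> \<Omega>" "y \<in> \<Omega>" "near \<epsilon> x y" for x y i
    proof -
      have "f i y / f i x - 1 = (f i y - f i x) / f i x" using f_nz[OF xy(1)] by (simp add: diff_divide_distrib)
      moreover have "norm (f i x - f i y) < e" by (rule ep(2)[OF xy(1,2) near_mono[OF xy(3) \<epsilon>]])
      ultimately show ?thesis using f(3)[OF xy(1)] by (simp add: norm_divide norm_minus_commute)
    qed
    then show ?thesis using \<epsilon>(1) by blast
  qed
  \<comment> \<open>Below this radius all products with the \<open>b i\<close> are less than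
    \<open>2 * pi\<close> in modulus, so for a lattice vector they vanish, and independence gives
    0.\<close>
  define \<rho> where "\<rho> = 2 * pi / (1 + (\<Sum>i\<in>UNIV. norm (b i)))"
  have bpos: "1 + (\<Sum>i\<in>UNIV. norm (b i)) > 0" by (intro add_pos_nonneg sum_nonneg) auto
  have \<rho>: "\<rho> > 0" using bpos by (simp add: \<rho>_def)
  have lattice: "v = 0" if v: "\<And>i. cis (b i \<bullet> v) = 1" "norm v < \<rho>" for v
  proof (rule indep)
    fix i
    have "cos (b i \<bullet> v) = 1" using v(1)[of i] by (metis cis.simps(1) one_complex.simps(1))
    then obtain k :: int where k: "b i \<bullet> v = k * 2 * pi" by (auto simp: cos_one_2pi_int)
    have "norm (b i) \<le> (\<Sum>i\<in>UNIV. norm (b i))" by (rule member_le_sum) auto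
    then have "\<bar>b i \<bullet> v\<bar> \<le> (1 + (\<Sum>i\<in>UNIV. norm (b i))) * norm v"
      by (intro order_trans[OF Cauchy_Schwarz_ineq2] mult_right_mono) auto
    also have "\<dots> < (1 + (\<Sum>i\<in>UNIV. norm (b i))) * \<rho>" using v(2) bpos by (intro mult_strict_left_mono)
    also have "\<dots> = 2 * pi" using bpos by (simp add: \<rho>_def)
    finally have "\<bar>real_of_int k\<bar> * (2 * pi) < 1 * (2 * pi)" unfolding k by (simp add: abs_mult)
    then have "\<bar>real_of_int k\<bar> < 1" by (simp only: mult_less_cancel_right_pos pi_gt_zero mult_pos_pos zero_less_numeral)
    then have "k = 0" by simp
    then show "b i \<bullet> v = 0" using k by simp
  qed
  \<comment> \<open>The radius exceeds that of neighbours, \<open>2 * rad + 1\<close>, by 1: room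
    for the error \<open>4 * \<delta>\<close>.\<close>
  obtain D where D: "finite D" "\<And>x p q. x \<in> \<Omega> \<Longrightarrow> p \<in> x \<Longrightarrow> q \<in> x \<Longrightarrow> norm (q - p) \<le> 2 * rad + 2 \<Longrightarrow> q - p \<in> D"
    using finite_differences[of "2 * rad + 2"] by blast
  have "uniform_discrete D" using D(1) uniform_discrete_finite_iff by blast
  then obtain \<delta>0 where \<delta>0: "\<delta>0 > 0" "\<And>x y. x \<in> D \<Longrightarrow> y \<in> D \<Longrightarrow> dist x y < \<delta>0 \<Longrightarrow> x = y"
    unfolding uniform_discrete_def by blast
  \<comment> \<open>\<open>sep / 9\<close> yields the strict bound
    \<open>8 * \<delta> < sep\<close>. The other terms stay below the lattice radius, the gaps in
    \<open>D\<close> and the room just left.\<close>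
  define \<delta> where "\<delta> = min (min (sep / 9) (\<rho> / 4)) (min (\<delta>0 / 8) (1 / 4))"
  have \<delta>: "\<delta> > 0" "8 * \<delta> < sep" "4 * \<delta> \<le> \<rho>" "4 * \<delta> < \<delta>0" "4 * \<delta> \<le> 1"
    using sep(1) \<rho> \<delta>0(1) unfolding \<delta>_def by (auto simp: min_def)
  obtain \<eta> where \<eta>: "\<eta> > 0" "\<And>u. (\<And>i. norm (u i - 1) < \<eta>) \<Longrightarrow> norm (lg u) < \<delta>" using lg_small[OF \<delta>(1)] by blast
  obtain \<epsilon> where \<epsilon>: "\<epsilon> > 0" "\<And>x y i. x \<in> \<Omega> \<Longrightarrow> y \<in> \<Omega> \<Longrightarrow> near \<epsilon> x y \<Longrightarrow> norm (f i y / f i x - 1) < \<eta>"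
    using f_uc[OF \<eta>(1)] by blast
  \<comment> \<open>Sets with equal patterns of this radius are \<open>near \<epsilon>\<close>, so
    their eigenfunction values have quotients within \<open>\<eta>\<close> of 1 and the correction
    is shorter than \<open>\<delta>\<close>.\<close>
  define R where "R = 1 / \<epsilon>"
  \<comment> \<open>One representative per pattern makes \<open>g\<close> depend on the pattern
    alone; \<open>cor\<close> measures the deviation of the actual set from it.\<close>
  define rep where "rep P = (SOME y. y \<in> \<Omega> \<and> y \<inter> cball 0 R = P)" for P
  have rep: "rep (y \<inter> cball 0 R) \<in> \<Omega>" "rep (y \<inter> cball 0 R) \<inter> cball 0 R = y \<inter> cball 0 R" if "y \<in> \<Omega>" for y
    using someI[of "\<lambda>z. z \<in> \<Omega> \<and> z \<inter> cball 0 R = y \<inter> cball 0 R" y] that unfolding rep_def by auto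
  define g where "g i y = f i (rep (y \<inter> cball 0 R))" for i y
  define cor where "cor y = lg (\<lambda>i. f i y / g i y)" for y
  \<comment> \<open>The pattern of a set through the origin is a patch of \<open>L\<close>, so
    finite local complexity leaves finitely many value vectors.\<close>
  define C where "C = (\<lambda>P i. f i (rep P)) ` patches (cball 0 R) L"
  interpret meyer_deformation L b f g cor \<delta> R C
  proof
    show "\<exists>\<epsilon>>0. \<forall>x\<in>\<Omega>. \<forall>y\<in>\<Omega>. near \<epsilon> x y \<longrightarrow> (\<exists>u. norm u < e \<and> (\<forall>i. f i y = cis (b i \<bullet> u) * f i x))"
      if e: "e > 0" for e
    proof -
      obtain \<eta>' where \<eta>': "\<eta>' > 0" "\<And>u. (\<And>i. norm (u i - 1) < \<eta>') \<Longrightarrow> norm (lg u) < e" using lg_small[OF e] by blast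
      obtain \<epsilon>' where \<epsilon>': "\<epsilon>' > 0" "\<And>x y i. x \<in> \<Omega> \<Longrightarrow> y \<in> \<Omega> \<Longrightarrow> near \<epsilon>' x y \<Longrightarrow> norm (f i y / f i x - 1) < \<eta>'"
        using f_uc[OF \<eta>'(1)] by blast
      have "\<exists>u. norm u < e \<and> (\<forall>i. f i y = cis (b i \<bullet> u) * f i x)" if xy: "x \<in> \<Omega>" "y \<in> \<Omega>" "near \<epsilon>' x y" for x y
      proof -
        have "norm (lg (\<lambda>i. f i y / f i x)) < e" by (rule \<eta>'(2)) (rule \<epsilon>'(2)[OF xy])
        moreover have "f i y = cis (b i \<bullet> lg (\<lambda>i. f i y / f i x)) * f i x" for i
          using f(3)[OF xy(1)] f(3)[OF xy(2)] f_nz[OF xy(1)] by (subst cis_lg) (simp_all add: norm_divide)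
        ultimately show ?thesis by blast
      qed
      then show ?thesis using \<epsilon>'(1) by blast
    qed
    show "norm (cor y) \<le> \<delta>" if y: "y \<in> \<Omega>" for y
    proof -
      have "w \<in> rep (y \<inter> cball 0 R) \<longleftrightarrow> w + 0 \<in> y" if "norm w < 1 / \<epsilon>" for w
      proof -
        have "w \<in> rep (y \<inter> cball 0 R) \<inter> cball 0 R \<longleftrightarrow> w \<in> y \<inter> cball 0 R" unfolding rep(2)[OF y] ..
        then show ?thesis using that by (simp add: R_def)
      qed
      then have "near \<epsilon> (rep (y \<inter> cball 0 R)) y" unfolding near_def using \<epsilon>(1) by (intro exI[of _ 0]) auto
      from \<epsilon>(2)[OF rep(1)[OF y] y this] have "norm (cor y) < \<delta>" unfolding cor_def g_def by (rule \<eta>(2))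
      then show ?thesis by simp
    qed
    show "cis (b i \<bullet> cor y) * g i y = f i y" if y: "y \<in> \<Omega>" for y i
    proof -
      have "norm (g i y) = 1" "g i y \<noteq> 0" unfolding g_def using f(3)[OF rep(1)[OF y]] f_nz[OF rep(1)[OF y]] by auto
      then show ?thesis unfolding cor_def using f(3)[OF y] by (subst cis_lg) (simp_all add: norm_divide)
    qed
    show "(\<lambda>i. g i y) \<in> C" if y: "y \<in> \<Omega>" "0 \<in> y" for y
    proof -
      have "shift 0 y \<inter> cball 0 R \<in> patches (cball 0 R) y" unfolding patches_def using y(2) by blast
      then have "y \<inter> cball 0 R \<in> patches (cball 0 R) L"
        using y(1) compact_cball[of 0 R] unfolding delone_hull_def shift_zero by blast
      then show ?thesis unfolding C_def g_def by blast
    qed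
    show "q' - p' = q - p"
      if xy: "x \<in> \<Omega>" "y \<in> \<Omega>" "p \<in> x" "q \<in> x" "p' \<in> y" "q' \<in> y"
        and n: "norm (q - p) \<le> 2 * rad + 1" "norm ((q' - p') - (q - p)) \<le> 4 * \<delta>" for x y p q p' q'
    proof (rule \<delta>0(2))
      show "q - p \<in> D" using n(1) by (intro D(2)[OF xy(1,3,4)]) simp
      have "norm (q' - p') \<le> 2 * rad + 2"
        using norm_triangle_ineq[of "q - p" "(q' - p') - (q - p)"] n \<delta>(5) by simp
      then show "q' - p' \<in> D" by (rule D(2)[OF xy(2,5,6)])
      show "dist (q' - p') (q - p) < \<delta>0" using n(2) \<delta>(4) by (simp add: dist_norm)
    qed
    show "finite C" using flc compact_cball[of 0 R] by (simp add: C_def finite_local_complexity_def)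
    show "v = 0" if "\<And>i. cis (b i \<bullet> v) = 1" "norm v < 4 * \<delta>" for v
      using lattice[OF that(1)] that(2) \<delta>(3) by simp
    show "(\<lambda>i. g i x) = (\<lambda>i. g i y)" if "x \<inter> cball 0 R = y \<inter> cball 0 R" for x y
      unfolding g_def that ..
  qed (use f(2) f_nz \<delta> \<epsilon>(1) in \<open>auto simp: R_def\<close>)
  show ?thesis using deform_meyer deform_conjugacy by blast
qed

theorem theorem4p12:
  fixes L :: "(real^'n) set"
    and X\<^sub>m\<^sub>a\<^sub>x :: "'y topology"
    and \<beta> :: "real^'n \<Rightarrow> 'y \<Rightarrow> 'y"
    and \<pi> :: "(real^'n) set \<Rightarrow> 'y"
    and \<xi> :: 'y
  assumes "delone L" and "finite_local_complexity L" and "repetitive L"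
    and "maximal_equicontinuous_factor (hull_topology L) shift X\<^sub>m\<^sub>a\<^sub>x \<beta> \<pi>"
    and "\<xi> \<in> topspace X\<^sub>m\<^sub>a\<^sub>x"
    and "coincidence_rank (hull_topology L) delone_dist shift \<pi> \<xi> < \<infinity>"
  shows "(\<exists>M :: (real^'n) set. meyer M \<and>
            topologically_conjugate (hull_topology L) shift (hull_topology M) shift) \<and>
         ((\<forall>t. shift t L = L \<longrightarrow> t = 0) \<longrightarrow>
            subgroup (topological_eigenvalues (hull_topology L) shift) dual_group \<and>
            dual_topology closure_of topological_eigenvalues (hull_topology L) shift
              = carrier dual_group)"
proof -
  interpret repetitive_delone L using assms(1-3) by unfold_locales
  have fac: "factor_map (hull_topology L) shift X\<^sub>m\<^sub>a\<^sub>x \<beta> \<pi>" and eq: "equicontinuous X\<^sub>m\<^sub>a\<^sub>x \<beta>"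
    using assms(4) by (auto simp: maximal_equicontinuous_factor_def)
  obtain K where K: "\<And>s. (\<And>\<eta>. \<eta> \<in> eigenvalues \<Longrightarrow> \<eta> s = 1) \<Longrightarrow> \<exists>k\<in>{1..K}. shift (real k *\<^sub>R s) L = L"
    using eigenvalue_annihilator_period[OF fac eq assms(5,6)] by blast
  obtain b :: "'n \<Rightarrow> real^'n" where b: "\<And>i. (\<lambda>t. cis (b i \<bullet> t)) \<in> eigenvalues"
    "\<And>v. (\<And>i. b i \<bullet> v = 0) \<Longrightarrow> v = 0"
    using eigenvalue_coordinates[OF K] by blast
  have "\<exists>M :: (real^'n) set. meyer M \<and>
      topologically_conjugate (hull_topology L) shift (hull_topology M) shift"
    by (rule meyer_conjugate[of b]) (rule b(1), rule b(2))
  moreover have "dual_topology closure_of eigenvalues = carrier dual_group"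
    if "\<forall>t. shift t L = L \<longrightarrow> t = 0"
    by (rule eigenvalues_dense[OF K]) (use that in auto)
  ultimately show ?thesis using eigenvalues_subgroup by blast
qed

end
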